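(* Let $(R,\mathfrak m)$ be a commutative noetherian local ring and let $X$ be a homologically finite $R$-complex. Each length system of parameters $\mathbf x$ for $X$ satisfies $\mathfrak m\in\operatorname{Anc}_R(K^R(\mathbf x)\otimes_R X)$. In particular, $\operatorname{ldim}_R(X)\ge\dim_R(X)$.
   Context: An $R$-complex is a chain complex of $R$-modules indexed homologically (the differential lowers degree by 1). For an $R$-complex $X$: $\inf(X)=\inf\{i\in\mathbb Z\mid\operatorname{H}_i(X)\ne0\}$; $X$ is homologically finite if $\coprod_{i\in\mathbb Z}\operatorname{H}_i(X)$ is finitely generated over $R$; $\operatorname{Supp}_R(X)=\bigcup_{i}\operatorname{Supp}_R(\operatorname{H}_i(X))$; and $\dim_R(X)=\sup\{\dim(R/\mathfrak p)-\inf(X_{\mathfrak p})\mid\mathfrak p\in\operatorname{Supp}_R(X)\}$ (with $\inf\varnothing=\infty$, $\sup\varnothing=-\infty$). When $\inf(X)>-\infty$, a prime $\mathfrak p$ is an anchor prime for $X$ if $\dim_{R_{\mathfrak p}}(X_{\mathfrak p})=-\inf(X_{\mathfrak p})$, and $\operatorname{Anc}_R(X)$ is the set of anchor primes for $X$. $K^R(\mathbf x)$ is the Koszul complex over $R$ on the sequence $\mathbf x$. A length sequence for $X$ is a sequence $\mathbf x=x_1,\dots,x_d\in\mathfrak m$ such that each $\operatorname{H}_i(K^R(\mathbf x)\otimes_R X)$ has finite length over $R$. If $m$ is the length of the shortest length sequence for $X$, the length dimension of $X$ is $\operatorname{ldim}_R(X)=m-\inf(X)$. A length system of parameters for $X$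 is a length sequence $x_1,\dots,x_m\in\mathfrak m$ for $X$ with $m=\operatorname{ldim}_R(X)+\inf(X)$ (i.e. a length sequence of shortest possible length). *)

theory Defs
  imports "HOL-Algebra.Module" "HOL-Algebra.Ring_Divisibility" "HOL-Library.Extended_Real"
begin

section \<open>Modules\<close>

text \<open>A module record extends a ring record; its multiplicative fields play no role for a module
  and are left \<^const>\<open>undefined\<close> below.\<close>

definition mod_hom ::
  "('a, 'r) ring_scheme \<Rightarrow> ('a, 'b, 'm) module_scheme \<Rightarrow> ('a, 'c, 'n) module_scheme \<Rightarrow> ('b \<Rightarrow> 'c) set"
  where "mod_hom R M N = {h \<in> hom (add_monoid M) (add_monoid N).
    \<forall>a\<in>carrier R. \<forall>x\<in>carrier M. h (a \<odot>\<^bsub>M\<^esub> x) = a \<odot>\<^bsub>N\<^esub> h x}"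

definition submod_gen :: "('a, 'r) ring_scheme \<Rightarrow> ('a, 'b) module \<Rightarrow> 'b set \<Rightarrow> 'b set"
  where "submod_gen R M S = \<Inter>{N. submodule N R M \<and> S \<subseteq> N}"

definition fin_gen :: "('a, 'r) ring_scheme \<Rightarrow> ('a, 'b) module \<Rightarrow> bool"
  where "fin_gen R M \<longleftrightarrow> (\<exists>S. finite S \<and> S \<subseteq> carrier M \<and> submod_gen R M S = carrier M)"

definition zero_mod :: "('a, 'b) module \<Rightarrow> bool"
  where "zero_mod M \<longleftrightarrow> carrier M = {\<zero>\<^bsub>M\<^esub>}"

text \<open>Finite length: existence of a composition series.\<close>

definition finite_length :: "('a, 'r) ring_scheme \<Rightarrow> ('a, 'b) module \<Rightarrow> bool"
  where "finite_length R M \<longleftrightarrow> (\<exists>(n::nat) N.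
     N 0 = {\<zero>\<^bsub>M\<^esub>} \<and> N n = carrier M \<and> (\<forall>i\<le>n. submodule (N i) R M) \<and>
     (\<forall>i<n. N i \<subset> N (Suc i) \<and>
        (\<forall>L. submodule L R M \<and> N i \<subseteq> L \<and> L \<subseteq> N (Suc i) \<longrightarrow> L = N i \<or> L = N (Suc i))))"

text \<open>The module analogue of \<^const>\<open>FactRing\<close>.\<close>

definition fact_mod :: "('a, 'b) module \<Rightarrow> 'b set \<Rightarrow> ('a, 'b set) module"
  where "fact_mod M N =
    \<lparr>carrier = a_rcosets\<^bsub>M\<^esub> N, monoid.mult = undefined, monoid.one = undefined,
     ring.zero = N, ring.add = set_add M, smult = (\<lambda>r C. \<Union>x\<in>C. N +>\<^bsub>M\<^esub> (r \<odot>\<^bsub>M\<^esub> x))\<rparr>"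

definition dsum :: "'i set \<Rightarrow> ('i \<Rightarrow> ('a, 'b) module) \<Rightarrow> ('a, 'i \<Rightarrow> 'b) module"
  where "dsum I M =
    \<lparr>carrier = {f \<in> (\<Pi>\<^sub>E i\<in>I. carrier (M i)). finite {i \<in> I. f i \<noteq> \<zero>\<^bsub>M i\<^esub>}},
     monoid.mult = undefined, monoid.one = undefined,
     ring.zero = (\<lambda>i\<in>I. \<zero>\<^bsub>M i\<^esub>), ring.add = (\<lambda>f g. \<lambda>i\<in>I. f i \<oplus>\<^bsub>M i\<^esub> g i),
     smult = (\<lambda>r f. \<lambda>i\<in>I. r \<odot>\<^bsub>M i\<^esub> f i)\<rparr>"

definition self_mod :: "('a, 'r) ring_scheme \<Rightarrow> ('a, 'a) module"
  where "self_mod R = \<lparr>carrier = carrier R, monoid.mult = monoid.mult R, monoid.one = \<one>\<^bsub>R\<^esub>,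
     ring.zero = \<zero>\<^bsub>R\<^esub>, ring.add = ring.add R, smult = monoid.mult R\<rparr>"

definition free_mod :: "('a, 'r) ring_scheme \<Rightarrow> 'i set \<Rightarrow> ('a, 'i \<Rightarrow> 'a) module"
  where "free_mod R B = dsum B (\<lambda>_. self_mod R)"

definition free_basis :: "('a, 'r) ring_scheme \<Rightarrow> 'i set \<Rightarrow> 'i \<Rightarrow> ('i \<Rightarrow> 'a)"
  where "free_basis R B b = (\<lambda>c\<in>B. if c = b then \<one>\<^bsub>R\<^esub> else \<zero>\<^bsub>R\<^esub>)"

section \<open>Tensor products of modules\<close>

text \<open>The tensor product of \<open>M\<close> and \<open>N\<close> is the free module on the set \<open>M \<times> N\<close> modulo the submodule
  generated by the bilinearity relations.\<close>

definition tensor_rels ::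
  "('a, 'r) ring_scheme \<Rightarrow> ('a, 'b) module \<Rightarrow> ('a, 'c) module \<Rightarrow> ('b \<times> 'c \<Rightarrow> 'a) set"
  where "tensor_rels R M N =
    (let F = free_mod R (carrier M \<times> carrier N);
         e = (\<lambda>x y. free_basis R (carrier M \<times> carrier N) (x, y))
     in {e (x \<oplus>\<^bsub>M\<^esub> x') y \<ominus>\<^bsub>F\<^esub> (e x y \<oplus>\<^bsub>F\<^esub> e x' y) | x x' y.
           x \<in> carrier M \<and> x' \<in> carrier M \<and> y \<in> carrier N} \<union>
        {e x (y \<oplus>\<^bsub>N\<^esub> y') \<ominus>\<^bsub>F\<^esub> (e x y \<oplus>\<^bsub>F\<^esub> e x y') | x y y'.
           x \<in> carrier M \<and> y \<in> carrier N \<and> y' \<in> carrier N} \<union>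
        {e (r \<odot>\<^bsub>M\<^esub> x) y \<ominus>\<^bsub>F\<^esub> (r \<odot>\<^bsub>F\<^esub> e x y) | r x y.
           r \<in> carrier R \<and> x \<in> carrier M \<and> y \<in> carrier N} \<union>
        {e x (r \<odot>\<^bsub>N\<^esub> y) \<ominus>\<^bsub>F\<^esub> (r \<odot>\<^bsub>F\<^esub> e x y) | r x y.
           r \<in> carrier R \<and> x \<in> carrier M \<and> y \<in> carrier N})"

definition tensor_ker ::
  "('a, 'r) ring_scheme \<Rightarrow> ('a, 'b) module \<Rightarrow> ('a, 'c) module \<Rightarrow> ('b \<times> 'c \<Rightarrow> 'a) set"
  where "tensor_ker R M N =
    submod_gen R (free_mod R (carrier M \<times> carrier N)) (tensor_rels R M N)"

definition tensor_mod ::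
  "('a, 'r) ring_scheme \<Rightarrow> ('a, 'b) module \<Rightarrow> ('a, 'c) module \<Rightarrow> ('a, ('b \<times> 'c \<Rightarrow> 'a) set) module"
  where "tensor_mod R M N =
    fact_mod (free_mod R (carrier M \<times> carrier N)) (tensor_ker R M N)"

definition pure_tensor ::
  "('a, 'r) ring_scheme \<Rightarrow> ('a, 'b) module \<Rightarrow> ('a, 'c) module \<Rightarrow> 'b \<Rightarrow> 'c \<Rightarrow> ('b \<times> 'c \<Rightarrow> 'a) set"
  where "pure_tensor R M N x y =
    tensor_ker R M N +>\<^bsub>free_mod R (carrier M \<times> carrier N)\<^esub>
      free_basis R (carrier M \<times> carrier N) (x, y)"

text \<open>The map from the tensor product of \<open>M\<close> and \<open>N\<close> to that of \<open>M'\<close> and \<open>N'\<close> induced by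
  homomorphisms \<open>f\<close> and \<open>g\<close>: the class of a formal combination of pairs \<open>(x, y)\<close> goes to the
  corresponding combination of the pure tensors of \<open>f x\<close> and \<open>g y\<close>, which does not depend on the
  representative.\<close>

definition tensor_map ::
  "('a, 'r) ring_scheme \<Rightarrow> ('a, 'b) module \<Rightarrow> ('a, 'c) module \<Rightarrow> ('a, 'd) module \<Rightarrow> ('a, 'e) module \<Rightarrow>
   ('b \<Rightarrow> 'd) \<Rightarrow> ('c \<Rightarrow> 'e) \<Rightarrow> ('b \<times> 'c \<Rightarrow> 'a) set \<Rightarrow> ('d \<times> 'e \<Rightarrow> 'a) set"
  where "tensor_map R M N M' N' f g C =
    the_elem ((\<lambda>\<phi>. \<Oplus>\<^bsub>tensor_mod R M' N'\<^esub> p \<in> {p \<in> carrier M \<times> carrier N. \<phi> p \<noteq> \<zero>\<^bsub>R\<^esub>}.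
      \<phi> p \<odot>\<^bsub>tensor_mod R M' N'\<^esub> pure_tensor R M' N' (f (fst p)) (g (snd p))) ` C)"

section \<open>Localization\<close>

definition frac_rel ::
  "('a, 'r) ring_scheme \<Rightarrow> 'a set \<Rightarrow> ('a, 'b) module \<Rightarrow> (('b \<times> 'a) \<times> ('b \<times> 'a)) set"
  where "frac_rel R S M = {((x, s), (y, t)). x \<in> carrier M \<and> s \<in> S \<and> y \<in> carrier M \<and> t \<in> S \<and>
     (\<exists>u\<in>S. u \<odot>\<^bsub>M\<^esub> (t \<odot>\<^bsub>M\<^esub> x) = u \<odot>\<^bsub>M\<^esub> (s \<odot>\<^bsub>M\<^esub> y))}"

definition fraction :: "('a, 'r) ring_scheme \<Rightarrow> 'a set \<Rightarrow> ('a, 'b) module \<Rightarrow> 'b \<Rightarrow> 'a \<Rightarrow> ('b \<times> 'a) set"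
  where "fraction R S M x s = frac_rel R S M `` {(x, s)}"

definition loc_mod ::
  "('a, 'r) ring_scheme \<Rightarrow> 'a set \<Rightarrow> ('a, 'b) module \<Rightarrow> (('a \<times> 'a) set, ('b \<times> 'a) set) module"
  where "loc_mod R S M =
    \<lparr>carrier = (carrier M \<times> S) // frac_rel R S M, monoid.mult = undefined, monoid.one = undefined,
     ring.zero = fraction R S M \<zero>\<^bsub>M\<^esub> \<one>\<^bsub>R\<^esub>,
     ring.add = (\<lambda>C D. \<Union>(x, s)\<in>C. \<Union>(y, t)\<in>D. fraction R S M (t \<odot>\<^bsub>M\<^esub> x \<oplus>\<^bsub>M\<^esub> s \<odot>\<^bsub>M\<^esub> y) (s \<otimes>\<^bsub>R\<^esub> t)),
     smult = (\<lambda>A C. \<Union>(a, s)\<in>A. \<Union>(x, t)\<in>C. fraction R S M (a \<odot>\<^bsub>M\<^esub> x) (s \<otimes>\<^bsub>R\<^esub> t))\<rparr>"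

definition loc_ring :: "('a, 'r) ring_scheme \<Rightarrow> 'a set \<Rightarrow> ('a \<times> 'a) set ring"
  where "loc_ring R S = (let L = loc_mod R S (self_mod R) in
    \<lparr>carrier = carrier L, monoid.mult = smult L, monoid.one = fraction R S (self_mod R) \<one>\<^bsub>R\<^esub> \<one>\<^bsub>R\<^esub>,
     ring.zero = \<zero>\<^bsub>L\<^esub>, ring.add = ring.add L\<rparr>)"

text \<open>Localization at the complement of a prime ideal.\<close>

definition prime_loc_ring :: "('a, 'r) ring_scheme \<Rightarrow> 'a set \<Rightarrow> ('a \<times> 'a) set ring"
  where "prime_loc_ring R P = loc_ring R (carrier R - P)"

definition mod_Supp :: "('a, 'r) ring_scheme \<Rightarrow> ('a, 'b) module \<Rightarrow> 'a set set"
  where "mod_Supp R M = {P. primeideal P R \<and> \<not> zero_mod (loc_mod R (carrier R - P) M)}"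

section \<open>Complexes\<close>

text \<open>Homologically indexed: \<open>bd X i\<close> goes from degree \<open>i\<close> to degree \<open>i - 1\<close>. The
  modules in the various degrees have a common element type but arbitrary carriers in it.\<close>

record ('a, 'b) cx =
  obj :: "int \<Rightarrow> ('a, 'b) module"
  bd :: "int \<Rightarrow> 'b \<Rightarrow> 'b"

locale ring_complex = cring R for R :: "('a, 'r) ring_scheme" (structure) +
  fixes X :: "('a, 'b) cx"
  assumes obj_module: "module R (obj X i)"
    and bd_hom: "bd X i \<in> mod_hom R (obj X i) (obj X (i - 1))"
    and bd_bd: "x \<in> carrier (obj X i) \<Longrightarrow> bd X (i - 1) (bd X i x) = \<zero>\<^bsub>obj X (i - 1 - 1)\<^esub>"

definition cycles :: "('a, 'b) cx \<Rightarrow> int \<Rightarrow> 'b set"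
  where "cycles X i = a_kernel (obj X i) (obj X (i - 1)) (bd X i)"

definition boundaries :: "('a, 'b) cx \<Rightarrow> int \<Rightarrow> 'b set"
  where "boundaries X i = bd X (i + 1) ` carrier (obj X (i + 1))"

definition homology :: "('a, 'b) cx \<Rightarrow> int \<Rightarrow> ('a, 'b set) module"
  where "homology X i = fact_mod ((obj X i)\<lparr>carrier := cycles X i\<rparr>) (boundaries X i)"

definition homologically_finite :: "('a, 'r) ring_scheme \<Rightarrow> ('a, 'b) cx \<Rightarrow> bool"
  where "homologically_finite R X \<longleftrightarrow> fin_gen R (dsum UNIV (homology X))"

definition cx_inf :: "('a, 'b) cx \<Rightarrow> ereal"
  where "cx_inf X = Inf {ereal (of_int i) | i. \<not> zero_mod (homology X i)}"

definition prime_loc_cx ::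
  "('a, 'r) ring_scheme \<Rightarrow> 'a set \<Rightarrow> ('a, 'b) cx \<Rightarrow> (('a \<times> 'a) set, ('b \<times> 'a) set) cx"
  where "prime_loc_cx R P X = (let S = carrier R - P in
    \<lparr>obj = (\<lambda>i. loc_mod R S (obj X i)),
     bd = (\<lambda>i C. \<Union>(x, s)\<in>C. fraction R S (obj X (i - 1)) (bd X i x) s)\<rparr>)"

definition cx_Supp :: "('a, 'r) ring_scheme \<Rightarrow> ('a, 'b) cx \<Rightarrow> 'a set set"
  where "cx_Supp R X = (\<Union>i. mod_Supp R (homology X i))"

definition alt_sign :: "('a, 'r) ring_scheme \<Rightarrow> int \<Rightarrow> 'a"
  where "alt_sign R i = (if even i then \<one>\<^bsub>R\<^esub> else \<ominus>\<^bsub>R\<^esub> \<one>\<^bsub>R\<^esub>)"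

text \<open>The degree \<open>n\<close> part of the tensor product is the direct sum over all \<open>i\<close> of the tensor
  products of \<open>obj X i\<close> and \<open>obj Y (n - i)\<close>; the differential sends the tensor of \<open>x\<close> and \<open>y\<close>
  to the tensor of \<open>bd x\<close> and \<open>y\<close> plus \<open>(-1)\<^sup>i\<close> times the tensor of \<open>x\<close> and \<open>bd y\<close>, where \<open>i\<close> is
  the degree of \<open>x\<close>.\<close>

definition tensor_cx ::
  "('a, 'r) ring_scheme \<Rightarrow> ('a, 'b) cx \<Rightarrow> ('a, 'c) cx \<Rightarrow> ('a, int \<Rightarrow> ('b \<times> 'c \<Rightarrow> 'a) set) cx"
  where "tensor_cx R X Y =
    \<lparr>obj = (\<lambda>n. dsum UNIV (\<lambda>i. tensor_mod R (obj X i) (obj Y (n - i)))),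
     bd = (\<lambda>n u i. let T = tensor_mod R (obj X i) (obj Y (n - 1 - i)) in
       tensor_map R (obj X (i + 1)) (obj Y (n - 1 - i)) (obj X i) (obj Y (n - 1 - i))
         (bd X (i + 1)) id (u (i + 1))
       \<oplus>\<^bsub>T\<^esub> alt_sign R i \<odot>\<^bsub>T\<^esub>
       tensor_map R (obj X i) (obj Y (n - i)) (obj X i) (obj Y (n - 1 - i))
         id (bd Y (n - i)) (u i))\<rparr>"

text \<open>The Koszul complex on \<open>x\<^sub>0, \<dots>, x\<^bsub>n-1\<^esub>\<close> is the exterior algebra on \<open>R\<^sup>n\<close>: its degree \<open>i\<close>
  part is free on the \<open>i\<close>-element subsets \<open>S = {j\<^sub>1 < \<dots> < j\<^sub>i}\<close> of \<open>{..<n}\<close>, and the differential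
  sends the basis element of \<open>S\<close> to the sum over \<open>k\<close> of \<open>(-1)\<^bsup>k+1\<^esup> x\<^bsub>j\<^sub>k\<^esub>\<close> times the basis element
  of \<open>S - {j\<^sub>k}\<close>. Below, this is written in coordinates.\<close>

definition koszul_basis :: "nat \<Rightarrow> int \<Rightarrow> nat set set"
  where "koszul_basis n i = {S. S \<subseteq> {..<n} \<and> int (card S) = i}"

definition koszul :: "('a, 'r) ring_scheme \<Rightarrow> 'a list \<Rightarrow> ('a, nat set \<Rightarrow> 'a) cx"
  where "koszul R xs =
    \<lparr>obj = (\<lambda>i. free_mod R (koszul_basis (length xs) i)),
     bd = (\<lambda>i f. \<lambda>T\<in>koszul_basis (length xs) (i - 1).
       \<Oplus>\<^bsub>R\<^esub> j \<in> {..<length xs} - T.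
         alt_sign R (int (card {k \<in> T. k < j})) \<otimes>\<^bsub>R\<^esub> (xs ! j) \<otimes>\<^bsub>R\<^esub> f (insert j T))\<rparr>"

section \<open>Dimension, anchor primes and length dimension\<close>

definition krull_dim :: "('a, 'r) ring_scheme \<Rightarrow> ereal"
  where "krull_dim R = Sup {ereal (of_nat n) | n.
    \<exists>P. (\<forall>i\<le>n. primeideal (P i) R) \<and> (\<forall>i<n. P i \<subset> P (Suc i))}"

definition cx_dim :: "('a, 'r) ring_scheme \<Rightarrow> ('a, 'b) cx \<Rightarrow> ereal"
  where "cx_dim R X =
    Sup {krull_dim (R Quot P) - cx_inf (prime_loc_cx R P X) | P. P \<in> cx_Supp R X}"

definition Anc :: "('a, 'r) ring_scheme \<Rightarrow> ('a, 'b) cx \<Rightarrow> 'a set set"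
  where "Anc R X = {P. cx_inf X > -\<infinity> \<and> primeideal P R \<and>
    cx_dim (prime_loc_ring R P) (prime_loc_cx R P X) = - cx_inf (prime_loc_cx R P X)}"

locale noetherian_local_ring = noetherian_ring R + cring R + maximalideal \<mm> R
  for R (structure) and \<mm> +
  assumes unique_maximal: "maximalideal \<nn> R \<Longrightarrow> \<nn> = \<mm>"

text \<open>In the next three definitions \<open>\<mm>\<close> is the maximal ideal of \<open>R\<close>.\<close>

definition length_seq ::
  "('a, 'r) ring_scheme \<Rightarrow> 'a set \<Rightarrow> ('a, 'b) cx \<Rightarrow> 'a list \<Rightarrow> bool"
  where "length_seq R \<mm> X xs \<longleftrightarrow>
    set xs \<subseteq> \<mm> \<and> (\<forall>i. finite_length R (homology (tensor_cx R (koszul R xs) X) i))"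

definition ldim :: "('a, 'r) ring_scheme \<Rightarrow> 'a set \<Rightarrow> ('a, 'b) cx \<Rightarrow> ereal"
  where "ldim R \<mm> X = Inf {ereal (of_nat (length xs)) | xs. length_seq R \<mm> X xs} - cx_inf X"

text \<open>A length sequence of shortest possible length. For \<open>cx_inf X\<close> finite, this says that its
  length is \<open>ldim R \<mm> X + cx_inf X\<close>; if \<open>X\<close> is acyclic, that sum is not meaningful.\<close>

definition length_sop ::
  "('a, 'r) ring_scheme \<Rightarrow> 'a set \<Rightarrow> ('a, 'b) cx \<Rightarrow> 'a list \<Rightarrow> bool"
  where "length_sop R \<mm> X xs \<longleftrightarrow>
    length_seq R \<mm> X xs \<and> (\<forall>ys. length_seq R \<mm> X ys \<longrightarrow> length xs \<le> length ys)"

end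

theory Submission
  imports Defs
begin

text \<open>
Write \<open>K\<close> for \<open>K(xs) \<otimes> X\<close>. Its homology is bounded below, and has finite length when \<open>xs\<close> is a
length sequence. A local complex whose homology is annihilated, element by element, by powers of the
elements of the maximal ideal is supported at most there, so its dimension is minus its infimum; this
is the first claim.

For the second claim, a prime \<open>P\<close> in the support of \<open>X\<close> satisfies \<open>inf X \<le> inf X\<^sub>P\<close>, so it suffices
that \<open>dim R/P \<le> length xs\<close> for every length sequence \<open>xs\<close>. Let \<open>q\<close> be a prime containing \<open>P\<close> and
\<open>xs\<close>. The complex \<open>K\<close> is an iterated cone of multiplications by elements of \<open>q\<close>, and all homology
modules in sight are finitely generated, so by Nakayama's lemma \<open>H(K)\<^sub>q = 0\<close> would force
\<open>H(X)\<^sub>q = 0\<close> and thus \<open>H(X)\<^sub>P = 0\<close>. Hence \<open>q\<close> lies in the support of \<open>H(K)\<close> and is the maximal ideal,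
and Krull's height theorem bounds \<open>dim R/P\<close> by \<open>length xs\<close>.
\<close>

section \<open>Modules and homomorphisms\<close>

text \<open>The obstacle is that quotients, localizations and tensor products each change the
  element type, so an induction over the Koszul elements cannot run through homology modules.
  Subquotients therefore stay pairs \<open>B\<close>, \<open>Z\<close> of submodules of one fixed
  module: \<open>noeth_between\<close> states that \<open>Z/B\<close> is noetherian, and
  \<open>Z \<subseteq> saturation R q M B\<close> that \<open>Z/B\<close> vanishes at
  \<open>q\<close>. Both conditions pass elementwise through the exact sequence of a cone. The cone
  structure itself is invisible in the tensor complex, whose elements are built from cosets of
  formal sums. It is exposed by \<open>koszul_model\<close>, whose components are indexed by subsets
  of \<open>{..<n}\<close>: one more Koszul element doubles the index set, while all the models
  share one element type, so that an induction on \<open>n\<close> is possible.\<close>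

lemma mod_homD:
  assumes "h \<in> mod_hom R M N"
  shows "x \<in> carrier M \<Longrightarrow> h x \<in> carrier N"
    and "\<lbrakk>x \<in> carrier M; y \<in> carrier M\<rbrakk> \<Longrightarrow> h (x \<oplus>\<^bsub>M\<^esub> y) = h x \<oplus>\<^bsub>N\<^esub> h y"
    and "\<lbrakk>a \<in> carrier R; x \<in> carrier M\<rbrakk> \<Longrightarrow> h (a \<odot>\<^bsub>M\<^esub> x) = a \<odot>\<^bsub>N\<^esub> h x"
  using assms unfolding mod_hom_def hom_def by auto

lemma mod_homI:
  assumes "\<And>x. x \<in> carrier M \<Longrightarrow> h x \<in> carrier N"
    and "\<And>x y. \<lbrakk>x \<in> carrier M; y \<in> carrier M\<rbrakk> \<Longrightarrow> h (x \<oplus>\<^bsub>M\<^esub> y) = h x \<oplus>\<^bsub>N\<^esub> h y"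
    and "\<And>a x. \<lbrakk>a \<in> carrier R; x \<in> carrier M\<rbrakk> \<Longrightarrow> h (a \<odot>\<^bsub>M\<^esub> x) = a \<odot>\<^bsub>N\<^esub> h x"
  shows "h \<in> mod_hom R M N"
  using assms unfolding mod_hom_def hom_def by auto

lemma mod_hom_zero:
  assumes "module R M" "module R N" "h \<in> mod_hom R M N"
  shows "h \<zero>\<^bsub>M\<^esub> = \<zero>\<^bsub>N\<^esub>"
proof -
  interpret M: module R M by fact
  interpret N: module R N by fact
  have "h (\<zero>\<^bsub>R\<^esub> \<odot>\<^bsub>M\<^esub> \<zero>\<^bsub>M\<^esub>) = \<zero>\<^bsub>R\<^esub> \<odot>\<^bsub>N\<^esub> h \<zero>\<^bsub>M\<^esub>"
    using mod_homD(3)[OF assms(3)] by blast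
  then show ?thesis using mod_homD(1)[OF assms(3)] by simp
qed

lemma (in module) minus_eq_smult:
  "x \<in> carrier M \<Longrightarrow> \<ominus>\<^bsub>M\<^esub> x = (\<ominus>\<^bsub>R\<^esub> \<one>\<^bsub>R\<^esub>) \<odot>\<^bsub>M\<^esub> x"
  by (simp add: smult_l_minus)

lemma mod_hom_a_inv:
  assumes "module R M" "module R N" "h \<in> mod_hom R M N" "x \<in> carrier M"
  shows "h (\<ominus>\<^bsub>M\<^esub> x) = \<ominus>\<^bsub>N\<^esub> h x"
proof -
  interpret M: module R M by fact
  interpret N: module R N by fact
  show ?thesis
    using assms(4) by (simp add: M.minus_eq_smult N.minus_eq_smult mod_homD[OF assms(3)])
qed

lemma mod_hom_id: "id \<in> mod_hom R M M"
  by (rule mod_homI) auto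

lemma mod_hom_comp:
  "\<lbrakk>f \<in> mod_hom R L M; g \<in> mod_hom R M N\<rbrakk> \<Longrightarrow> (\<lambda>x. g (f x)) \<in> mod_hom R L N"
  by (rule mod_homI) (simp_all add: mod_homD)

lemma (in module) submoduleI':
  assumes "H \<subseteq> carrier M" "\<zero>\<^bsub>M\<^esub> \<in> H"
    and "\<And>a b. \<lbrakk>a \<in> H ; b \<in> H\<rbrakk> \<Longrightarrow> a \<oplus>\<^bsub>M\<^esub> b \<in> H"
    and "\<And>a x. \<lbrakk>a \<in> carrier R; x \<in> H\<rbrakk> \<Longrightarrow> a \<odot>\<^bsub>M\<^esub> x \<in> H"
  shows "submodule H R M"
proof (rule submoduleI)
  show "\<ominus>\<^bsub>M\<^esub> a \<in> H" if "a \<in> H" for a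
    using that assms(1) by (simp add: minus_eq_smult assms(4) subsetD)
qed (use assms in auto)

lemma (in module) submodule_zero:
  "submodule H R M \<Longrightarrow> \<zero>\<^bsub>M\<^esub> \<in> H"
  using submodule.axioms(1)[of H R M] subgroup.one_closed by fastforce

lemma (in module) submodule_minus:
  "\<lbrakk>submodule H R M; x \<in> H; y \<in> H\<rbrakk> \<Longrightarrow> x \<ominus>\<^bsub>M\<^esub> y \<in> H"
  by (simp add: M.minus_eq submoduleE(3,5))

lemma (in module) submodule_add_cancel:
  assumes "submodule H R M" "x \<in> carrier M" "y \<in> H" "x \<oplus>\<^bsub>M\<^esub> y \<in> H"
  shows "x \<in> H"
proof -
  have "x = (x \<oplus>\<^bsub>M\<^esub> y) \<ominus>\<^bsub>M\<^esub> y"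
    using assms submoduleE(1)[OF assms(1)] by (auto simp: M.minus_eq M.a_assoc M.r_neg)
  then show ?thesis
    using submodule_minus[OF assms(1,4,3)] by simp
qed

lemma (in module) submodule_Int:
  "\<lbrakk>submodule H R M; submodule K R M\<rbrakk> \<Longrightarrow> submodule (H \<inter> K) R M"
  by (rule submoduleI') (auto simp: submodule_zero submoduleE dest: submoduleE(1))

lemma (in module) submodule_zero_set: "submodule {\<zero>\<^bsub>M\<^esub>} R M"
  by (rule submoduleI') auto

text \<open>This is the image of \<open>N\<close> in the quotient \<open>C/B\<close>, pulled back to
  \<open>C\<close>; it lets a map into a subquotient be handled inside \<open>C\<close>.\<close>

lemma submodule_image_add:
  assumes "module R M" "module R C" "h \<in> mod_hom R M C" "submodule N R M" "submodule B R C"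
  shows "submodule {h n \<oplus>\<^bsub>C\<^esub> c |n c. n \<in> N \<and> c \<in> B} R C"
proof -
  interpret M: module R M by fact
  interpret C: module R C by fact
  note sN = M.submoduleE[OF assms(4)]
  note sB = C.submoduleE[OF assms(5)]
  have N: "n \<in> carrier M" if "n \<in> N" for n using that sN(1) by auto
  have B: "n \<in> carrier C" if "n \<in> B" for n using that sB(1) by auto
  show ?thesis
  proof (rule C.submoduleI')
    show "\<zero>\<^bsub>C\<^esub> \<in> {h n \<oplus>\<^bsub>C\<^esub> c |n c. n \<in> N \<and> c \<in> B}"
      using M.submodule_zero[OF assms(4)] C.submodule_zero[OF assms(5)]
        mod_hom_zero[OF assms(1-3)] by force
  next
    fix a b assume "a \<in> {h n \<oplus>\<^bsub>C\<^esub> c |n c. n \<in> N \<and> c \<in> B}" "b \<in> {h n \<oplus>\<^bsub>C\<^esub> c |n c. n \<in> N \<and> c \<in> B}"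
    then obtain n c n' c' where *: "a = h n \<oplus>\<^bsub>C\<^esub> c" "b = h n' \<oplus>\<^bsub>C\<^esub> c'" "n \<in> N" "n' \<in> N" "c \<in> B" "c' \<in> B"
      by blast
    then have "a \<oplus>\<^bsub>C\<^esub> b = h (n \<oplus>\<^bsub>M\<^esub> n') \<oplus>\<^bsub>C\<^esub> (c \<oplus>\<^bsub>C\<^esub> c')"
      by (simp add: N B mod_homD[OF assms(3)] C.M.a_ac)
    then show "a \<oplus>\<^bsub>C\<^esub> b \<in> {h n \<oplus>\<^bsub>C\<^esub> c |n c. n \<in> N \<and> c \<in> B}"
      using * sN(5) sB(5) by blast
  next
    fix r b assume r: "r \<in> carrier R" and "b \<in> {h n \<oplus>\<^bsub>C\<^esub> c |n c. n \<in> N \<and> c \<in> B}"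
    then obtain n c where *: "b = h n \<oplus>\<^bsub>C\<^esub> c" "n \<in> N" "c \<in> B"
      by blast
    then have "r \<odot>\<^bsub>C\<^esub> b = h (r \<odot>\<^bsub>M\<^esub> n) \<oplus>\<^bsub>C\<^esub> (r \<odot>\<^bsub>C\<^esub> c)"
      using r by (simp add: N B mod_homD[OF assms(3)] C.smult_r_distr)
    then show "r \<odot>\<^bsub>C\<^esub> b \<in> {h n \<oplus>\<^bsub>C\<^esub> c |n c. n \<in> N \<and> c \<in> B}"
      using * r sN(4) sB(4) by blast
  qed (use N B mod_homD[OF assms(3)] in auto)
qed

lemma submodule_vimage:
  assumes "module R M" "module R C" "h \<in> mod_hom R M C" "submodule L R C"
  shows "submodule {a \<in> carrier M. h a \<in> L} R M"
proof -
  interpret M: module R M by fact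
  interpret C: module R C by fact
  show ?thesis
    by (rule M.submoduleI')
      (auto simp: mod_homD[OF assms(3)] mod_hom_zero[OF assms(1-3)] C.submodule_zero[OF assms(4)]
        C.submoduleE[OF assms(4)])
qed

section \<open>The ring as a module over itself\<close>

lemma self_mod_simps [simp]:
  "carrier (self_mod R) = carrier R" "\<zero>\<^bsub>self_mod R\<^esub> = \<zero>\<^bsub>R\<^esub>"
  "x \<oplus>\<^bsub>self_mod R\<^esub> y = x \<oplus>\<^bsub>R\<^esub> y" "a \<odot>\<^bsub>self_mod R\<^esub> x = a \<otimes>\<^bsub>R\<^esub> x"
  by (simp_all add: self_mod_def)

lemma (in cring) self_mod_module: "module R (self_mod R)"
proof (rule moduleI)
  show "abelian_group (self_mod R)"
  proof (rule abelian_groupI)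
    show "\<exists>y\<in>carrier (self_mod R). y \<oplus>\<^bsub>self_mod R\<^esub> x = \<zero>\<^bsub>self_mod R\<^esub>" if "x \<in> carrier (self_mod R)" for x
      using that by (auto intro: bexI[of _ "\<ominus> x"] l_neg)
  qed (auto simp: a_ac)
qed (auto simp: is_cring l_distr r_distr m_assoc)

lemma (in cring) submodule_self_mod_iff: "submodule I R (self_mod R) \<longleftrightarrow> ideal I R"
proof
  interpret S: module R "self_mod R" by (rule self_mod_module)
  assume I: "submodule I R (self_mod R)"
  note sI = S.submoduleE[OF I]
  have "subgroup I (add_monoid R)"
  proof (rule add.subgroupI)
    show "\<ominus> a \<in> I" if "a \<in> I" for a
      using sI(4)[of "\<ominus> \<one>" a] sI(1) that by (auto simp: l_minus)
  qed (use sI in auto)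
  then show "ideal I R"
  proof (rule idealI[OF ring_axioms])
    show "x \<otimes> a \<in> I" if "a \<in> I" "x \<in> carrier R" for a x using sI(4) that by simp
    then show "a \<otimes> x \<in> I" if "a \<in> I" "x \<in> carrier R" for a x
      using that sI(1) by (metis self_mod_simps(1) subsetD m_comm)
  qed
next
  interpret S: module R "self_mod R" by (rule self_mod_module)
  assume "ideal I R"
  then interpret I: ideal I R .
  show "submodule I R (self_mod R)"
    by (rule S.submoduleI') (auto simp: I.I_l_closed I.Icarr)
qed

lemma (in module) smult_hom: "m \<in> carrier M \<Longrightarrow> (\<lambda>r. r \<odot>\<^bsub>M\<^esub> m) \<in> mod_hom R (self_mod R) M"
  by (rule mod_homI) (auto simp: smult_l_distr smult_assoc1)

text \<open>When \<open>B\<close> is a submodule, this is the least submodule containing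
  \<open>B\<close> and \<open>m\<close>. Inductions over finite generating sets proceed by adjoining
  one generator at a time.\<close>

definition adjoin :: "('a, 'r) ring_scheme \<Rightarrow> ('a, 'b, 'm) module_scheme \<Rightarrow> 'b set \<Rightarrow> 'b \<Rightarrow> 'b set"
  where "adjoin R M B m = {r \<odot>\<^bsub>M\<^esub> m \<oplus>\<^bsub>M\<^esub> b |r b. r \<in> carrier R \<and> b \<in> B}"

lemma (in module) submodule_adjoin:
  assumes "submodule B R M" "m \<in> carrier M"
  shows "submodule (adjoin R M B m) R M" "B \<subseteq> adjoin R M B m" "m \<in> adjoin R M B m"
    "\<lbrakk>submodule L R M; m \<in> L; B \<subseteq> L\<rbrakk> \<Longrightarrow> adjoin R M B m \<subseteq> L"
proof -
  interpret S: module R "self_mod R" by (rule self_mod_module)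
  have B: "B \<subseteq> carrier M" using submoduleE(1)[OF assms(1)] .
  show "submodule (adjoin R M B m) R M"
    unfolding adjoin_def
    using submodule_image_add[OF S.module_axioms module_axioms smult_hom[OF assms(2)] S.carrier_is_submodule assms(1)]
    by simp
  show "B \<subseteq> adjoin R M B m"
  proof
    fix b assume b: "b \<in> B"
    then have "b = \<zero>\<^bsub>R\<^esub> \<odot>\<^bsub>M\<^esub> m \<oplus>\<^bsub>M\<^esub> b" using assms(2) B by auto
    then show "b \<in> adjoin R M B m" using b unfolding adjoin_def by blast
  qed
  have "m = \<one>\<^bsub>R\<^esub> \<odot>\<^bsub>M\<^esub> m \<oplus>\<^bsub>M\<^esub> \<zero>\<^bsub>M\<^esub>" using assms(2) by auto
  then show "m \<in> adjoin R M B m" using submodule_zero[OF assms(1)] unfolding adjoin_def by blast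
  show "adjoin R M B m \<subseteq> L" if "submodule L R M" "m \<in> L" "B \<subseteq> L"
    using that submoduleE[OF that(1)] by (auto simp: adjoin_def)
qed

section \<open>Noetherian subquotients\<close>

text \<open>For submodules \<open>B \<subseteq> Z\<close> this says that the module
  \<open>Z/B\<close> is noetherian. Stating it inside \<open>M\<close> keeps the element type
  fixed.\<close>

definition noeth_between :: "('a, 'r) ring_scheme \<Rightarrow> ('a, 'b, 'm) module_scheme \<Rightarrow> 'b set \<Rightarrow> 'b set \<Rightarrow> bool"
  where "noeth_between R M B Z \<longleftrightarrow> (\<forall>N. submodule N R M \<and> B \<subseteq> N \<and> N \<subseteq> Z \<longrightarrow>
    (\<exists>S. finite S \<and> S \<subseteq> N \<and> (\<forall>L. submodule L R M \<and> B \<subseteq> L \<and> S \<subseteq> L \<longrightarrow> N \<subseteq> L)))"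

lemma noeth_betweenD:
  assumes "noeth_between R M B Z" "submodule N R M" "B \<subseteq> N" "N \<subseteq> Z"
  obtains S where "finite S" "S \<subseteq> N" "\<And>L. \<lbrakk>submodule L R M; B \<subseteq> L; S \<subseteq> L\<rbrakk> \<Longrightarrow> N \<subseteq> L"
  using assms unfolding noeth_between_def by metis

lemma noeth_between_mono:
  "\<lbrakk>noeth_between R M B Z; Z' \<subseteq> Z\<rbrakk> \<Longrightarrow> noeth_between R M B Z'"
  unfolding noeth_between_def by (meson order_trans)

lemma noeth_between_antimono:
  assumes "noeth_between R M B Z" "B \<subseteq> B'"
  shows "noeth_between R M B' Z"
  unfolding noeth_between_def
proof (intro allI impI, elim conjE)
  fix N assume N: "submodule N R M" "B' \<subseteq> N" "N \<subseteq> Z"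
  have "B \<subseteq> N" using N(2) assms(2) by (rule order_trans[rotated])
  then obtain S where S: "finite S" "S \<subseteq> N" "\<And>L. \<lbrakk>submodule L R M; B \<subseteq> L; S \<subseteq> L\<rbrakk> \<Longrightarrow> N \<subseteq> L"
    using noeth_betweenD[OF assms(1) N(1) _ N(3)] by metis
  have "N \<subseteq> L" if "submodule L R M" "B' \<subseteq> L" "S \<subseteq> L" for L
    using S(3)[OF that(1) order_trans[OF assms(2) that(2)] that(3)] .
  with S show "\<exists>S. finite S \<and> S \<subseteq> N \<and> (\<forall>L. submodule L R M \<and> B' \<subseteq> L \<and> S \<subseteq> L \<longrightarrow> N \<subseteq> L)"
    by (intro exI[of _ S]) simp
qed

lemma noeth_between_refl: "Z \<subseteq> B \<Longrightarrow> noeth_between R M B Z"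
  unfolding noeth_between_def by (meson empty_subsetI finite.emptyI order_trans)

text \<open>Generators of \<open>N\<close> come from two sources: lifts of generators of its image
  modulo \<open>BC\<close>, and images under \<open>\<phi>\<close> of generators of its preimage in
  \<open>ZA\<close>. Read on subquotients, the hypothesis \<open>exact\<close> is exactness of
  \<open>ZA/BA \<rightarrow> ZM/BM \<rightarrow> ZC/BC\<close> at the middle term, which is what the
  homology sequence of a cone provides.\<close>

lemma noeth_between_extension:
  assumes mods: "module R A" "module R M" "module R C"
    and \<phi>: "\<phi> \<in> mod_hom R A M" and \<psi>: "\<psi> \<in> mod_hom R M C"
    and sub: "submodule ZA R A" "submodule BM R M" "submodule BC R C"
    and BA: "BA \<subseteq> ZA" "\<And>a. a \<in> BA \<Longrightarrow> \<phi> a \<in> BM"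
    and BC: "BC \<subseteq> ZC" and ZM: "submodule ZM R M" "\<And>z. z \<in> ZM \<Longrightarrow> \<psi> z \<in> ZC"
    and ZC: "submodule ZC R C"
    and exact: "\<And>z. \<lbrakk>z \<in> ZM; \<psi> z \<in> BC\<rbrakk> \<Longrightarrow> \<exists>a\<in>ZA. \<exists>b\<in>BM. z = \<phi> a \<oplus>\<^bsub>M\<^esub> b"
    and noeth: "noeth_between R A BA ZA" "noeth_between R C BC ZC"
  shows "noeth_between R M BM ZM"
  unfolding noeth_between_def
proof (intro allI impI, elim conjE)
  interpret A: module R A by fact
  interpret M: module R M by fact
  interpret C: module R C by fact
  fix N assume N: "submodule N R M" "BM \<subseteq> N" "N \<subseteq> ZM"
  have Nc: "N \<subseteq> carrier M" using M.submoduleE(1)[OF N(1)] .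
  define im where "im = (\<lambda>N. {\<psi> n \<oplus>\<^bsub>C\<^esub> c |n c. n \<in> N \<and> c \<in> BC})"
  have im: "submodule (im N) R C" if "submodule N R M" for N
    unfolding im_def by (rule submodule_image_add[OF mods(2,3) \<psi> that sub(3)])
  have BCc: "BC \<subseteq> carrier C" using C.submoduleE(1)[OF sub(3)] .
  have BC_im: "BC \<subseteq> im N" if "submodule N R M" for N
  proof
    fix b assume "b \<in> BC"
    moreover from this have "b = \<psi> \<zero>\<^bsub>M\<^esub> \<oplus>\<^bsub>C\<^esub> b"
      using mod_hom_zero[OF mods(2,3) \<psi>] BCc by auto
    ultimately show "b \<in> im N" using M.submodule_zero[OF that] unfolding im_def by blast
  qed
  have "im N \<subseteq> ZC"
    using ZM(2) N(3) BC C.submoduleE(5)[OF ZC] unfolding im_def by blast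
  then obtain S' where S': "finite S'" "S' \<subseteq> im N"
      "\<And>L. \<lbrakk>submodule L R C; BC \<subseteq> L; S' \<subseteq> L\<rbrakk> \<Longrightarrow> im N \<subseteq> L"
    using noeth_betweenD[OF noeth(2) im[OF N(1)] BC_im[OF N(1)]] by metis
  have "\<forall>s\<in>S'. \<exists>n\<in>N. \<exists>c\<in>BC. s = \<psi> n \<oplus>\<^bsub>C\<^esub> c"
    using S'(2) unfolding im_def by blast
  then obtain g where g: "\<And>s. s \<in> S' \<Longrightarrow> g s \<in> N \<and> (\<exists>c\<in>BC. s = \<psi> (g s) \<oplus>\<^bsub>C\<^esub> c)"
    by metis
  define N'' where "N'' = {a \<in> carrier A. \<phi> a \<in> N} \<inter> ZA"
  have sN'': "submodule N'' R A"
    unfolding N''_def by (rule A.submodule_Int[OF submodule_vimage[OF mods(1,2) \<phi> N(1)] sub(1)])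
  have "BA \<subseteq> N''" "N'' \<subseteq> ZA"
    using BA N(2) A.submoduleE(1)[OF sub(1)] unfolding N''_def by auto
  then obtain S'' where S'': "finite S''" "S'' \<subseteq> N''"
      "\<And>L. \<lbrakk>submodule L R A; BA \<subseteq> L; S'' \<subseteq> L\<rbrakk> \<Longrightarrow> N'' \<subseteq> L"
    using noeth_betweenD[OF noeth(1) sN''] by metis
  show "\<exists>S. finite S \<and> S \<subseteq> N \<and> (\<forall>L. submodule L R M \<and> BM \<subseteq> L \<and> S \<subseteq> L \<longrightarrow> N \<subseteq> L)"
  proof (intro exI conjI allI impI)
    show "finite (g ` S' \<union> \<phi> ` S'')" using S' S'' by simp
    show "g ` S' \<union> \<phi> ` S'' \<subseteq> N" using g S''(2) unfolding N''_def by auto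
    fix L assume L: "submodule L R M \<and> BM \<subseteq> L \<and> g ` S' \<union> \<phi> ` S'' \<subseteq> L"
    then have sL: "submodule L R M" by simp
    \<comment> \<open>The comparison uses the image of \<open>L \<inter> N\<close> so that the
      element \<open>l\<close> found below lies in \<open>N\<close>: then \<open>n - l\<close> stays
      in \<open>N\<close>, and the part of it that comes from \<open>ZA\<close> falls into
      \<open>N''\<close>.\<close>
    have sLN: "submodule (L \<inter> N) R M" by (rule M.submodule_Int[OF sL N(1)])
    have "S' \<subseteq> im (L \<inter> N)"
      using g L unfolding im_def by blast
    then have imN: "im N \<subseteq> im (L \<inter> N)"
      using S'(3)[OF im[OF sLN] BC_im[OF sLN]] by simp
    have sL'': "submodule {a \<in> carrier A. \<phi> a \<in> L} R A"
      by (rule submodule_vimage[OF mods(1,2) \<phi> sL])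
    have "BA \<subseteq> {a \<in> carrier A. \<phi> a \<in> L}" using BA L A.submoduleE(1)[OF sub(1)] by auto
    moreover have "S'' \<subseteq> {a \<in> carrier A. \<phi> a \<in> L}"
      using S''(2) L A.submoduleE(1)[OF sN''] by auto
    ultimately have N''L: "N'' \<subseteq> {a \<in> carrier A. \<phi> a \<in> L}" using S''(3)[OF sL''] by simp
    show "N \<subseteq> L"
    proof
      fix n assume n: "n \<in> N"
      then have "\<psi> n \<oplus>\<^bsub>C\<^esub> \<zero>\<^bsub>C\<^esub> \<in> im N"
        using C.submodule_zero[OF sub(3)] unfolding im_def by blast
      then have "\<psi> n \<oplus>\<^bsub>C\<^esub> \<zero>\<^bsub>C\<^esub> \<in> im (L \<inter> N)" using imN by blast
      moreover have "\<psi> n \<oplus>\<^bsub>C\<^esub> \<zero>\<^bsub>C\<^esub> = \<psi> n" using n Nc mod_homD(1)[OF \<psi>] by auto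
      ultimately have "\<psi> n \<in> im (L \<inter> N)" by simp
      then obtain l c where l: "l \<in> L" "l \<in> N" "c \<in> BC" "\<psi> n = \<psi> l \<oplus>\<^bsub>C\<^esub> c" unfolding im_def by blast
      have nc: "n \<in> carrier M" "l \<in> carrier M" "c \<in> carrier C" using n l Nc BCc by auto
      have "\<psi> (n \<ominus>\<^bsub>M\<^esub> l) = c"
        using nc l(4) by (simp add: M.M.minus_eq mod_homD[OF \<psi>] mod_hom_a_inv[OF mods(2,3) \<psi>] C.M.a_ac
            C.M.r_neg C.M.r_neg1 C.M.r_neg2)
      moreover have nl: "n \<ominus>\<^bsub>M\<^esub> l \<in> N" using M.submodule_minus[OF N(1)] n l by simp
      ultimately obtain a b where ab: "a \<in> ZA" "b \<in> BM" "n \<ominus>\<^bsub>M\<^esub> l = \<phi> a \<oplus>\<^bsub>M\<^esub> b"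
        using exact[of "n \<ominus>\<^bsub>M\<^esub> l"] N(3) l by auto
      have ac: "a \<in> carrier A" using ab A.submoduleE(1)[OF sub(1)] by auto
      have "\<phi> a \<in> N"
        using M.submodule_add_cancel[OF N(1), of "\<phi> a" b] ab nl N(2) mod_homD(1)[OF \<phi> ac] by auto
      then have "\<phi> a \<in> L" using N''L ab ac unfolding N''_def by auto
      then have "n \<ominus>\<^bsub>M\<^esub> l \<in> L" using ab L M.submoduleE(5)[OF sL] by auto
      moreover have "n = (n \<ominus>\<^bsub>M\<^esub> l) \<oplus>\<^bsub>M\<^esub> l" using nc by (simp add: M.M.minus_eq M.M.a_assoc M.M.l_neg)
      ultimately show "n \<in> L" using M.submoduleE(5)[OF sL] l(1) by metis
    qed
  qed
qed

text \<open>The extension lemma for the maps \<open>Z/B \<rightarrow> W/B \<rightarrow> W/Z\<close>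
  induced by the identity.\<close>

lemma (in module) noeth_between_trans:
  assumes sub: "submodule B R M" "submodule Z R M" "submodule W R M" and le: "B \<subseteq> Z" "Z \<subseteq> W"
    and "noeth_between R M B Z" "noeth_between R M Z W"
  shows "noeth_between R M B W"
proof (rule noeth_between_extension[OF module_axioms module_axioms module_axioms mod_hom_id mod_hom_id,
        of Z B Z B W W])
  show "\<exists>a\<in>Z. \<exists>b\<in>B. z = id a \<oplus>\<^bsub>M\<^esub> b" if "z \<in> W" "id z \<in> Z" for z
    using that submoduleE(1)[OF sub(2)] submodule_zero[OF sub(1)] by force
qed (use assms in auto)

lemma (in noetherian_ring) noeth_between_self_mod:
  assumes "cring R"
  shows "noeth_between R (self_mod R) {\<zero>} (carrier R)"
  unfolding noeth_between_def
proof (intro allI impI, elim conjE)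
  interpret cring R by fact
  fix N assume N: "submodule N R (self_mod R)"
  then obtain S where S: "S \<subseteq> carrier R" "finite S" "N = Idl S"
    using finetely_gen submodule_self_mod_iff by metis
  show "\<exists>S. finite S \<and> S \<subseteq> N \<and> (\<forall>L. submodule L R (self_mod R) \<and> {\<zero>} \<subseteq> L \<and> S \<subseteq> L \<longrightarrow> N \<subseteq> L)"
    using S genideal_self[OF S(1)] genideal_minimal submodule_self_mod_iff by metis
qed

text \<open>\<open>(R m + B)/B\<close> is the image of \<open>R\<close> under multiplication into
  \<open>m\<close>. In the extension lemma the right-hand term is made zero by choosing
  \<open>R m + B\<close> for both of its submodules.\<close>

lemma (in module) noeth_between_adjoin:
  assumes "noetherian_ring R" and B: "submodule B R M" and m: "m \<in> carrier M"
  shows "noeth_between R M B (adjoin R M B m)"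
proof -
  interpret S: module R "self_mod R" by (rule self_mod_module)
  note ad = submodule_adjoin[OF B m]
  show ?thesis
  proof (rule noeth_between_extension[OF S.module_axioms module_axioms module_axioms smult_hom[OF m] mod_hom_id
        S.carrier_is_submodule B ad(1) _ _ _ ad(1) _ ad(1)])
    show "noeth_between R (self_mod R) {\<zero>\<^bsub>R\<^esub>} (carrier (self_mod R))"
      using noetherian_ring.noeth_between_self_mod[OF assms(1) is_cring] by simp
    show "\<exists>a\<in>carrier (self_mod R). \<exists>b\<in>B. z = a \<odot>\<^bsub>M\<^esub> m \<oplus>\<^bsub>M\<^esub> b" if "z \<in> adjoin R M B m" for z
      using that by (auto simp: adjoin_def)
  qed (use m submodule_zero[OF B] in \<open>auto simp: noeth_between_refl\<close>)
qed

text \<open>Adjoining the generators one at a time filters \<open>Z/B\<close> by cyclic modules,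
  each a quotient of the noetherian ring.\<close>

lemma (in module) noeth_between_finite:
  assumes "noetherian_ring R" "finite S" "submodule B R M" "submodule Z R M" "B \<subseteq> Z" "S \<subseteq> Z"
    and "\<And>L. \<lbrakk>submodule L R M; B \<subseteq> L; S \<subseteq> L\<rbrakk> \<Longrightarrow> Z \<subseteq> L"
  shows "noeth_between R M B Z"
  using assms(2-)
proof (induction S arbitrary: B)
  case empty
  then show ?case by (simp add: noeth_between_refl)
next
  case (insert m S)
  have m: "m \<in> carrier M" using insert.prems(2,4) submoduleE(1) by auto
  note ad = submodule_adjoin[OF insert.prems(1) m]
  have adZ: "adjoin R M B m \<subseteq> Z" using ad(4)[OF insert.prems(2)] insert.prems by auto
  have "noeth_between R M (adjoin R M B m) Z"
  proof (rule insert.IH)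
    show "Z \<subseteq> L" if "submodule L R M" "adjoin R M B m \<subseteq> L" "S \<subseteq> L" for L
      using insert.prems(5)[of L] that ad(2,3) by blast
  qed (use ad insert.prems adZ in auto)
  then show ?case
    using noeth_between_trans[OF insert.prems(1) ad(1) insert.prems(2) ad(2) adZ
      noeth_between_adjoin[OF assms(1) insert.prems(1) m]] by simp
qed

section \<open>Saturation and Nakayama's lemma\<close>

text \<open>For a prime \<open>q\<close> and a submodule \<open>B\<close> this is the kernel of the
  map from \<open>M\<close> to the localization of \<open>M/B\<close> at \<open>q\<close>. Thus
  vanishing at \<open>q\<close> is expressed without forming a localization.\<close>

definition saturation :: "('a, 'r) ring_scheme \<Rightarrow> 'a set \<Rightarrow> ('a, 'b, 'm) module_scheme \<Rightarrow> 'b set \<Rightarrow> 'b set"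
  where "saturation R q M B = {z \<in> carrier M. \<exists>s\<in>carrier R - q. s \<odot>\<^bsub>M\<^esub> z \<in> B}"

lemma prime_mult_notin:
  assumes "primeideal q R" "s \<in> carrier R - q" "t \<in> carrier R - q"
  shows "s \<otimes>\<^bsub>R\<^esub> t \<in> carrier R - q"
proof -
  interpret primeideal q R by fact
  show ?thesis using assms(2,3) I_prime by auto
qed

lemma prime_one_notin:
  assumes "primeideal q R"
  shows "\<one>\<^bsub>R\<^esub> \<in> carrier R - q"
proof -
  interpret primeideal q R by fact
  show ?thesis using one_imp_carrier I_notcarr by auto
qed

lemma prime_pow_notin:
  assumes "primeideal q R" "y \<in> carrier R - q"
  shows "y [^]\<^bsub>R\<^esub> (n::nat) \<in> carrier R - q"
proof -
  interpret primeideal q R by fact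
  show ?thesis
    by (induction n) (use assms(2) prime_one_notin[OF assms(1)] prime_mult_notin[OF assms(1)] in auto)
qed

lemma (in module) submodule_saturation:
  assumes q: "primeideal q R" and B: "submodule B R M"
  shows "submodule (saturation R q M B) R M" "B \<subseteq> saturation R q M B"
    "saturation R q M (saturation R q M B) = saturation R q M B"
proof -
  note sB = submoduleE[OF B]
  show le: "B \<subseteq> saturation R q M B"
    using sB(1) prime_one_notin[OF q] by (force simp: saturation_def)
  show "submodule (saturation R q M B) R M"
  proof (rule submoduleI')
    show "\<zero>\<^bsub>M\<^esub> \<in> saturation R q M B" using le submodule_zero[OF B] by auto
    fix a b assume "a \<in> saturation R q M B" "b \<in> saturation R q M B"
    then obtain s t where *: "a \<in> carrier M" "b \<in> carrier M" "s \<in> carrier R - q" "t \<in> carrier R - q"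
        "s \<odot>\<^bsub>M\<^esub> a \<in> B" "t \<odot>\<^bsub>M\<^esub> b \<in> B" by (auto simp: saturation_def)
    then have "(s \<otimes>\<^bsub>R\<^esub> t) \<odot>\<^bsub>M\<^esub> (a \<oplus>\<^bsub>M\<^esub> b) = t \<odot>\<^bsub>M\<^esub> (s \<odot>\<^bsub>M\<^esub> a) \<oplus>\<^bsub>M\<^esub> s \<odot>\<^bsub>M\<^esub> (t \<odot>\<^bsub>M\<^esub> b)"
      by (simp add: smult_r_distr smult_assoc1[symmetric] R.m_comm)
    then have "(s \<otimes>\<^bsub>R\<^esub> t) \<odot>\<^bsub>M\<^esub> (a \<oplus>\<^bsub>M\<^esub> b) \<in> B"
      using * sB(4,5) by simp
    then show "a \<oplus>\<^bsub>M\<^esub> b \<in> saturation R q M B"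
      using *(1,2) prime_mult_notin[OF q *(3,4)] unfolding saturation_def by blast
  next
    fix r a assume "r \<in> carrier R" "a \<in> saturation R q M B"
    moreover from this obtain s where *: "a \<in> carrier M" "s \<in> carrier R - q" "s \<odot>\<^bsub>M\<^esub> a \<in> B"
      by (auto simp: saturation_def)
    ultimately have "s \<odot>\<^bsub>M\<^esub> (r \<odot>\<^bsub>M\<^esub> a) = r \<odot>\<^bsub>M\<^esub> (s \<odot>\<^bsub>M\<^esub> a)"
      by (simp add: smult_assoc1[symmetric] R.m_comm)
    then show "r \<odot>\<^bsub>M\<^esub> a \<in> saturation R q M B"
      using *(1,2) sB(4)[OF \<open>r \<in> carrier R\<close> *(3)] \<open>r \<in> carrier R\<close>
      by (auto simp: saturation_def intro!: bexI[of _ s])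
  qed (auto simp: saturation_def)
  have "saturation R q M B \<subseteq> saturation R q M (saturation R q M B)"
  proof
    fix z assume z: "z \<in> saturation R q M B"
    then have "z \<in> carrier M" by (simp add: saturation_def)
    with z have "\<one>\<^bsub>R\<^esub> \<odot>\<^bsub>M\<^esub> z \<in> saturation R q M B" by simp
    with \<open>z \<in> carrier M\<close> show "z \<in> saturation R q M (saturation R q M B)"
      using prime_one_notin[OF q] unfolding saturation_def[of R q M "saturation R q M B"] by blast
  qed
  moreover have "saturation R q M (saturation R q M B) \<subseteq> saturation R q M B"
  proof
    fix z assume "z \<in> saturation R q M (saturation R q M B)"
    then obtain s t where *: "z \<in> carrier M" "s \<in> carrier R - q" "t \<in> carrier R - q" "t \<odot>\<^bsub>M\<^esub> (s \<odot>\<^bsub>M\<^esub> z) \<in> B"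
      by (auto simp: saturation_def)
    then have "(t \<otimes>\<^bsub>R\<^esub> s) \<odot>\<^bsub>M\<^esub> z \<in> B" by (simp add: smult_assoc1)
    then show "z \<in> saturation R q M B"
      using * prime_mult_notin[OF q *(3,2)] unfolding saturation_def by blast
  qed
  ultimately show "saturation R q M (saturation R q M B) = saturation R q M B" by simp
qed

lemma saturation_mono: "B \<subseteq> C \<Longrightarrow> saturation R q M B \<subseteq> saturation R q M C"
  by (auto simp: saturation_def)

text \<open>Nakayama's lemma for a single generator \<open>m\<close>: up to a factor
  \<open>t\<close> outside \<open>q\<close>, the element \<open>w\<close> is a multiple
  \<open>r m\<close> modulo \<open>L\<close>, so the relation \<open>s m = x w + b\<close> becomes
  \<open>(t s - x r) m \<in> L\<close>. Here \<open>t s\<close> lies outside \<open>q\<close> and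
  \<open>x r\<close> inside, so the coefficient is outside \<open>q\<close> and \<open>m\<close>
  vanishes at \<open>q\<close> modulo \<open>L\<close>.\<close>

lemma (in module) nakayama_step:
  assumes q: "primeideal q R" "x \<in> q" and L: "submodule L R M" "B \<subseteq> L" and m: "m \<in> Z" "Z \<subseteq> carrier M"
    and hyp: "\<exists>s\<in>carrier R - q. \<exists>w\<in>Z. \<exists>b\<in>B. s \<odot>\<^bsub>M\<^esub> m = x \<odot>\<^bsub>M\<^esub> w \<oplus>\<^bsub>M\<^esub> b"
    and Z: "Z \<subseteq> saturation R q M (adjoin R M L m)"
  shows "Z \<subseteq> saturation R q M L"
proof -
  interpret q: primeideal q R by fact
  note sL = submoduleE[OF L(1)]
  note sat = submodule_saturation[OF q(1) L(1)]
  obtain s w b where s: "s \<in> carrier R - q" "w \<in> Z" "b \<in> B" "s \<odot>\<^bsub>M\<^esub> m = x \<odot>\<^bsub>M\<^esub> w \<oplus>\<^bsub>M\<^esub> b"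
    using hyp by blast
  obtain t r l where t: "t \<in> carrier R - q" "r \<in> carrier R" "l \<in> L" "t \<odot>\<^bsub>M\<^esub> w = r \<odot>\<^bsub>M\<^esub> m \<oplus>\<^bsub>M\<^esub> l"
    using Z s(2) unfolding saturation_def adjoin_def by blast
  have c: "s \<in> carrier R" "t \<in> carrier R" "x \<in> carrier R" "w \<in> carrier M" "m \<in> carrier M" "b \<in> carrier M"
    "l \<in> carrier M" using s t m L sL(1) q(2) q.Icarr by auto
  define u where "u = t \<otimes>\<^bsub>R\<^esub> s \<ominus>\<^bsub>R\<^esub> x \<otimes>\<^bsub>R\<^esub> r"
  have u: "u \<in> carrier R - q"
  proof -
    have "t \<otimes>\<^bsub>R\<^esub> s \<notin> q" using prime_mult_notin[OF q(1) t(1) s(1)] by simp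
    moreover have "x \<otimes>\<^bsub>R\<^esub> r \<in> q" using q.I_r_closed[OF q(2) t(2)] .
    moreover have "t \<otimes>\<^bsub>R\<^esub> s = u \<oplus>\<^bsub>R\<^esub> x \<otimes>\<^bsub>R\<^esub> r"
      using c t(2) by (simp add: u_def R.minus_eq R.a_assoc R.l_neg)
    ultimately have "u \<notin> q" using q.a_closed[of u "x \<otimes>\<^bsub>R\<^esub> r"] by argo
    then show ?thesis using c t(2) by (simp add: u_def)
  qed
  have "(t \<otimes>\<^bsub>R\<^esub> s) \<odot>\<^bsub>M\<^esub> m = t \<odot>\<^bsub>M\<^esub> (x \<odot>\<^bsub>M\<^esub> w \<oplus>\<^bsub>M\<^esub> b)" using c s by (simp add: smult_assoc1)
  also have "\<dots> = x \<odot>\<^bsub>M\<^esub> (t \<odot>\<^bsub>M\<^esub> w) \<oplus>\<^bsub>M\<^esub> t \<odot>\<^bsub>M\<^esub> b"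
    using c by (simp add: smult_r_distr smult_assoc1[symmetric] R.m_comm)
  also have "\<dots> = (x \<otimes>\<^bsub>R\<^esub> r) \<odot>\<^bsub>M\<^esub> m \<oplus>\<^bsub>M\<^esub> (x \<odot>\<^bsub>M\<^esub> l \<oplus>\<^bsub>M\<^esub> t \<odot>\<^bsub>M\<^esub> b)"
    using c t by (simp add: smult_r_distr smult_assoc1 M.a_assoc)
  finally have e: "(t \<otimes>\<^bsub>R\<^esub> s) \<odot>\<^bsub>M\<^esub> m = \<dots>" .
  have "u \<odot>\<^bsub>M\<^esub> m = (t \<otimes>\<^bsub>R\<^esub> s) \<odot>\<^bsub>M\<^esub> m \<oplus>\<^bsub>M\<^esub> \<ominus>\<^bsub>M\<^esub> ((x \<otimes>\<^bsub>R\<^esub> r) \<odot>\<^bsub>M\<^esub> m)"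
    using c t(2) by (simp add: u_def R.minus_eq smult_l_distr smult_l_minus)
  also have "\<dots> = x \<odot>\<^bsub>M\<^esub> l \<oplus>\<^bsub>M\<^esub> t \<odot>\<^bsub>M\<^esub> b"
    unfolding e using c t(2) by (simp add: M.a_ac M.r_neg M.r_neg1 M.r_neg2)
  also have "\<dots> \<in> L" using c s t L sL(4,5) by blast
  finally have um: "u \<odot>\<^bsub>M\<^esub> m \<in> L" .
  then have "m \<in> saturation R q M L" using u c by (auto simp: saturation_def)
  then have "adjoin R M L m \<subseteq> saturation R q M L"
    using submodule_adjoin(4)[OF L(1) c(5) sat(1)] sat(2) by simp
  then show ?thesis using Z saturation_mono sat(3) by blast
qed

text \<open>The last hypothesis reads \<open>Z/B = x (Z/B)\<close> at \<open>q\<close>. Generators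
  are discarded one by one; to make this an induction, the claim is proved over every intermediate
  submodule \<open>L\<close> over which finitely many elements of \<open>Z\<close> generate
  \<open>Z\<close>.\<close>

lemma (in module) nakayama:
  assumes q: "primeideal q R" "x \<in> q" and B: "submodule B R M" "B \<subseteq> Z" and Z: "submodule Z R M"
    and noeth: "noeth_between R M B Z"
    and hyp: "\<And>z. z \<in> Z \<Longrightarrow> \<exists>s\<in>carrier R - q. \<exists>w\<in>Z. \<exists>b\<in>B. s \<odot>\<^bsub>M\<^esub> z = x \<odot>\<^bsub>M\<^esub> w \<oplus>\<^bsub>M\<^esub> b"
  shows "Z \<subseteq> saturation R q M B"
proof -
  have Zc: "Z \<subseteq> carrier M" using submoduleE(1)[OF Z] .
  have *: "Z \<subseteq> saturation R q M L"
    if "finite S" "S \<subseteq> Z" "submodule L R M" "B \<subseteq> L"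
      "\<And>K. \<lbrakk>submodule K R M; L \<subseteq> K; S \<subseteq> K\<rbrakk> \<Longrightarrow> Z \<subseteq> K" for S L
    using that
  proof (induction S arbitrary: L)
    case empty
    then have "Z \<subseteq> L" by simp
    then show ?case using submodule_saturation(2)[OF q(1) empty.prems(2)] by simp
  next
    case (insert m S)
    have m: "m \<in> carrier M" using insert.prems(1) Zc by auto
    note ad = submodule_adjoin[OF insert.prems(2) m]
    have "Z \<subseteq> saturation R q M (adjoin R M L m)"
    proof (rule insert.IH)
      show "Z \<subseteq> K" if "submodule K R M" "adjoin R M L m \<subseteq> K" "S \<subseteq> K" for K
        using insert.prems(4)[of K] that ad(2,3) by blast
    qed (use insert.prems ad in auto)
    then show ?case
      using insert.prems hyp by (intro nakayama_step[OF q insert.prems(2,3) _ Zc]) auto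
  qed
  obtain S where "finite S" "S \<subseteq> Z" "\<And>K. \<lbrakk>submodule K R M; B \<subseteq> K; S \<subseteq> K\<rbrakk> \<Longrightarrow> Z \<subseteq> K"
    using noeth_betweenD[OF noeth Z B(2)] by auto
  then show ?thesis using *[of S B] B(1) by simp
qed

section \<open>Krull's height theorem\<close>

lemma (in noetherian_ring) noetherian_maximal:
  assumes "\<S> \<noteq> {}" "\<And>I. I \<in> \<S> \<Longrightarrow> ideal I R"
  obtains M where "M \<in> \<S>" "\<And>I. \<lbrakk>I \<in> \<S>; M \<subseteq> I\<rbrakk> \<Longrightarrow> I = M"
proof -
  have "\<exists>M\<in>\<S>. \<forall>I\<in>\<S>. M \<subseteq> I \<longrightarrow> I = M"
  proof (rule subset_Zorn)
    fix C assume C: "subset.chain \<S> C"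
    show "\<exists>U\<in>\<S>. \<forall>I\<in>C. I \<subseteq> U"
    proof (cases "C = {}")
      case False
      moreover have "subset.chain {I. ideal I R} C"
        using C assms(2) unfolding pred_on.chain_def by auto
      \<comment> \<open>In a noetherian ring the union of a nonempty chain of ideals is a member of
        the chain, hence an upper bound inside the family.\<close>
      ultimately have "\<Union>C \<in> C" by (rule ideal_chain_is_trivial)
      moreover have "C \<subseteq> \<S>" using C unfolding pred_on.chain_def by simp
      ultimately show ?thesis by (intro bexI[of _ "\<Union>C"]) auto
    qed (use assms(1) in auto)
  qed
  then show ?thesis using that by blast
qed

lemma (in noetherian_ring) noetherian_induct [consumes 1, case_names step]:
  assumes "ideal I R" and step: "\<And>I. \<lbrakk>ideal I R; \<And>J. \<lbrakk>ideal J R; I \<subset> J\<rbrakk> \<Longrightarrow> P J\<rbrakk> \<Longrightarrow> P I"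
  shows "P I"
proof (rule ccontr)
  assume "\<not> P I"
  then have "{I. ideal I R \<and> \<not> P I} \<noteq> {}" using assms(1) by blast
  then obtain M where "M \<in> {I. ideal I R \<and> \<not> P I}"
      "\<And>I. \<lbrakk>I \<in> {I. ideal I R \<and> \<not> P I}; M \<subseteq> I\<rbrakk> \<Longrightarrow> I = M"
    using noetherian_maximal[of "{I. ideal I R \<and> \<not> P I}"] by blast
  then show False using step[of M] by blast
qed

text \<open>Choose an annihilator that is maximal among those of nonzero classes of
  \<open>R/I\<close>. If \<open>r s\<close> kills the class of \<open>a\<close> and \<open>s\<close>
  does not, then the annihilator of \<open>s a\<close> contains that of \<open>a\<close>, so the two
  agree, and \<open>r\<close> belongs to them. The result is an associated prime of
  \<open>R/I\<close>.\<close>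

lemma prime_annihilator:
  fixes R (structure)
  assumes "noetherian_ring R" "cring R" "ideal I R" "I \<noteq> carrier R"
  obtains a where "a \<in> carrier R" "a \<notin> I" "primeideal {r \<in> carrier R. r \<otimes>\<^bsub>R\<^esub> a \<in> I} R"
proof -
  interpret noetherian_ring R by fact
  interpret cring R by fact
  interpret I: ideal I R by fact
  interpret S: module R "self_mod R" by (rule self_mod_module)
  define ann where "ann = (\<lambda>a. {r \<in> carrier R. r \<otimes> a \<in> I})"
  have ideal_ann: "ideal (ann a) R" if "a \<in> carrier R" for a
    using submodule_vimage[OF S.module_axioms S.module_axioms S.smult_hom[of a], of I] that assms(3)
    by (simp add: submodule_self_mod_iff ann_def)
  have "ann ` (carrier R - I) \<noteq> {}" using assms(4) I.a_subset by auto
  then obtain M where M: "M \<in> ann ` (carrier R - I)"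
      "\<And>J. \<lbrakk>J \<in> ann ` (carrier R - I); M \<subseteq> J\<rbrakk> \<Longrightarrow> J = M"
    using noetherian_maximal[of "ann ` (carrier R - I)"] ideal_ann by blast
  then obtain a where a: "a \<in> carrier R" "a \<notin> I" "M = ann a" by blast
  have "primeideal (ann a) R"
  proof (rule primeidealI[OF ideal_ann[OF a(1)] is_cring])
    have "\<one> \<notin> ann a" using a by (simp add: ann_def)
    then show "carrier R \<noteq> ann a" by auto
    fix r s assume rs: "r \<in> carrier R" "s \<in> carrier R" "r \<otimes> s \<in> ann a"
    show "r \<in> ann a \<or> s \<in> ann a"
    proof (rule disjCI)
      assume "s \<notin> ann a"
      then have "s \<otimes> a \<in> carrier R - I" using rs a by (simp add: ann_def)
      moreover have "ann a \<subseteq> ann (s \<otimes> a)"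
      proof
        fix t assume "t \<in> ann a"
        then have "t \<in> carrier R" "s \<otimes> (t \<otimes> a) \<in> I" using I.I_l_closed rs(2) by (auto simp: ann_def)
        then show "t \<in> ann (s \<otimes> a)" using rs(2) a(1) by (simp add: ann_def m_lcomm)
      qed
      ultimately have "ann (s \<otimes> a) = ann a" using M(2) a(3) by blast
      moreover have "r \<in> ann (s \<otimes> a)" using rs a(1) by (simp add: ann_def m_assoc)
      ultimately show "r \<in> ann a" by simp
    qed
  qed
  then show ?thesis using that a unfolding ann_def by blast
qed

text \<open>The descending chain condition in the local ring at \<open>P\<close> modulo \<open>K\<close>, phrased with
  saturated ideals in order to avoid the localization.\<close>

lemma saturated_dcc:
  fixes R (structure) and J :: "nat \<Rightarrow> 'a set" and P :: "'a set"
  defines "sat \<equiv> saturation R P (self_mod R)"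
  assumes "noetherian_ring R" "cring R" and P: "primeideal P R"
    and min: "\<And>q. \<lbrakk>primeideal q R; K \<subseteq> q; q \<subseteq> P\<rbrakk> \<Longrightarrow> q = P"
    and I: "ideal I R" "K \<subseteq> I" "sat I = I"
    and J: "\<And>n. ideal (J n) R" "\<And>n. sat (J n) = J n" "\<And>n. I \<subseteq> J n" "\<And>n. J (Suc n) \<subseteq> J n"
  shows "\<exists>N. \<forall>n\<ge>N. J n = J N"
proof -
  interpret noetherian_ring R by fact
  interpret cring R by fact
  interpret P: primeideal P R by fact
  interpret S: module R "self_mod R" by (rule self_mod_module)
  note sub = submodule_self_mod_iff
  have sat_ideal: "ideal (sat L) R" "L \<subseteq> sat L" "sat (sat L) = sat L" if "ideal L R" for L
    using S.submodule_saturation[OF P] that unfolding sat_def sub by auto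
  have satI: "z \<in> sat L" if "z \<in> carrier R" "s \<in> carrier R - P" "s \<otimes> z \<in> L" for z s L
    using that by (auto simp: sat_def saturation_def)
  have satE: "\<exists>s\<in>carrier R - P. s \<otimes> z \<in> L" if "z \<in> sat L" for z L
    using that by (auto simp: sat_def saturation_def)
  show ?thesis
    using I J
  proof (induction I arbitrary: J rule: noetherian_induct)
    \<comment> \<open>The induction hypothesis covers all larger ideals. A chain above
      \<open>I\<close> is compared with its traces below and above a saturated ideal
      \<open>I'\<close> that is next to \<open>I\<close>.\<close>
    case (step I)
    interpret I: ideal I R by fact
    have sI: "J n \<subseteq> carrier R" for n using ideal.Icarr[OF step.prems(3)] by blast
    have anti: "antimono J" using step.prems(6) by (simp add: decseq_Suc_iff)
    show ?case
    proof (cases "I = carrier R")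
      case True
      then have "J n = carrier R" for n using sI[of n] step.prems(5)[of n] by blast
      then show ?thesis by simp
    next
      case False
      then obtain a where a: "a \<in> carrier R" "a \<notin> I" "primeideal {r \<in> carrier R. r \<otimes> a \<in> I} R"
        using prime_annihilator[OF assms(2,3) step.hyps(1)] by blast
      \<comment> \<open>The annihilator contains \<open>K\<close> because \<open>I\<close> does, and
        it lies in \<open>P\<close> because \<open>I\<close> is saturated and misses
        \<open>a\<close>. Minimality of \<open>P\<close> over \<open>K\<close> then identifies
        it.\<close>
      have "{r \<in> carrier R. r \<otimes> a \<in> I} = P"
      proof (rule min[OF a(3)])
        show "K \<subseteq> {r \<in> carrier R. r \<otimes> a \<in> I}"
          using step.prems(1) a(1) I.I_r_closed I.Icarr by blast
        show "{r \<in> carrier R. r \<otimes> a \<in> I} \<subseteq> P"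
          using satI[of a _ I] step.prems(2) a by auto
      qed
      then have Pa: "r \<otimes> a \<in> I \<longleftrightarrow> r \<in> P" if "r \<in> carrier R" for r using that by blast
      \<comment> \<open>At \<open>P\<close> the quotient \<open>I'/I\<close> is generated by the
        class of \<open>a\<close>, whose annihilator is \<open>P\<close>. It is thus a copy of the
        residue field, and no saturated ideal lies strictly between \<open>I\<close> and
        \<open>I'\<close>.\<close>
      define I' where "I' = sat (adjoin R (self_mod R) I a)"
      have ad: "ideal (adjoin R (self_mod R) I a) R" "I \<subseteq> adjoin R (self_mod R) I a"
          "a \<in> adjoin R (self_mod R) I a"
        using S.submodule_adjoin(1-3)[of I a] a step.hyps(1) by (simp_all add: sub)
      have I': "ideal I' R" "sat I' = I'" "I \<subseteq> I'" "a \<in> I'"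
        unfolding I'_def using sat_ideal[OF ad(1)] ad by auto
      interpret I': ideal I' R by fact
      have simple: "L = I \<or> I' \<subseteq> L" if L: "ideal L R" "sat L = L" "I \<subseteq> L" "L \<subseteq> I'" for L
      proof (rule disjCI)
        interpret L: ideal L R by fact
        assume "\<not> I' \<subseteq> L"
        show "L = I"
        proof (rule ccontr)
          assume "L \<noteq> I"
          then obtain b where b: "b \<in> L" "b \<notin> I" using L(3) by blast
          then obtain s where s: "s \<in> carrier R - P" "s \<otimes> b \<in> adjoin R (self_mod R) I a"
            using L(4) satE unfolding I'_def by blast
          then obtain r i where r: "r \<in> carrier R" "i \<in> I" "s \<otimes> b = r \<otimes> a \<oplus> i"
            unfolding adjoin_def by auto
          have "r \<notin> P"
          proof
            assume "r \<in> P"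
            then have "s \<otimes> b \<in> I" using Pa[OF r(1)] r by simp
            then have "b \<in> sat I" using satI s b L.Icarr by blast
            then show False using step.prems(2) b by simp
          qed
          moreover have "r \<otimes> a \<in> L"
          proof -
            have "r \<otimes> a = s \<otimes> b \<ominus> i"
              using r a(1) s b L.Icarr I.Icarr by (simp add: minus_eq a_assoc r_neg)
            moreover have "s \<otimes> b \<in> L" using s(1) b(1) by (simp add: L.I_l_closed)
            moreover have "\<ominus> i \<in> L" using r(2) L(3) by auto
            ultimately show ?thesis by (simp only: minus_eq L.a_closed)
          qed
          ultimately have "a \<in> sat L" using satI a(1) r(1) by blast
          then have "adjoin R (self_mod R) I a \<subseteq> L"
            using S.submodule_adjoin(4)[of I a L] L(1-3) a(1) step.hyps(1) by (simp add: sub)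
          then have "I' \<subseteq> L"
            unfolding I'_def using saturation_mono[of _ L R P "self_mod R"] L(2) unfolding sat_def by blast
          then show False using \<open>\<not> I' \<subseteq> L\<close> by simp
        qed
      qed
      have inter: "ideal (J n \<inter> I') R" "sat (J n \<inter> I') = J n \<inter> I'" for n
      proof -
        show i: "ideal (J n \<inter> I') R" by (rule i_intersect[OF step.prems(3) I'(1)])
        have "sat (J n \<inter> I') \<subseteq> sat (J n) \<inter> sat I'"
          unfolding sat_def by (auto simp: saturation_def)
        then show "sat (J n \<inter> I') = J n \<inter> I'"
          using sat_ideal(2)[OF i] step.prems(4) I'(2) by auto
      qed
      \<comment> \<open>Each of these intersections is \<open>I\<close> or \<open>I'\<close>, and a
        descending sequence of them can drop only once.\<close>
      have "\<exists>N. \<forall>n\<ge>N. J n \<inter> I' = J N \<inter> I'"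
      proof (cases "\<forall>n. J n \<inter> I' = I'")
        case False
        then obtain N where "J N \<inter> I' \<noteq> I'" by blast
        moreover have "J n \<inter> I' \<subseteq> J N \<inter> I'" if "n \<ge> N" for n
          using antimonoD[OF anti that] by blast
        ultimately have "J n \<inter> I' = I" if "n \<ge> N" for n
          using simple[OF inter(1,2), of n] step.prems(5)[of n] I'(3) that by blast
        then show ?thesis by auto
      qed auto
      then obtain N1 where N1: "\<And>n. n \<ge> N1 \<Longrightarrow> J n \<inter> I' = J N1 \<inter> I'" by blast
      \<comment> \<open>The sums with \<open>I'\<close>, saturated again, form a chain above the
        larger ideal \<open>I'\<close>, to which the induction hypothesis applies.\<close>
      define J' where "J' = (\<lambda>n. sat (J n <+>\<^bsub>R\<^esub> I'))"
      have sum: "ideal (J n <+>\<^bsub>R\<^esub> I') R" for n by (rule add_ideals[OF step.prems(3) I'(1)])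
      have sum_le: "I' \<subseteq> J n <+>\<^bsub>R\<^esub> I'" "J n \<subseteq> J n <+>\<^bsub>R\<^esub> I'" for n
      proof -
        have z: "\<zero> \<in> J n"
          by (rule additive_subgroup.zero_closed[OF ideal.axioms(1)[OF step.prems(3)]])
        show "I' \<subseteq> J n <+>\<^bsub>R\<^esub> I'"
        proof
          fix i assume i: "i \<in> I'"
          then have "i = \<zero> \<oplus> i" using I'.Icarr by simp
          then show "i \<in> J n <+>\<^bsub>R\<^esub> I'" using i z unfolding set_add_def' by blast
        qed
        show "J n \<subseteq> J n <+>\<^bsub>R\<^esub> I'"
        proof
          fix i assume i: "i \<in> J n"
          then have "i = i \<oplus> \<zero>" using sI[of n] by auto
          then show "i \<in> J n <+>\<^bsub>R\<^esub> I'" using i I'.zero_closed unfolding set_add_def' by blast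
        qed
      qed
      have "\<exists>N. \<forall>n\<ge>N. J' n = J' N"
      proof (rule step.IH[OF I'(1)])
        show "I \<subset> I'" using I'(3,4) a(2) by blast
        show "K \<subseteq> I'" using step.prems(1) I'(3) by blast
        show "I' \<subseteq> J' n" for n unfolding J'_def using sum_le(1) sat_ideal(2)[OF sum] by blast
        show "J' (Suc n) \<subseteq> J' n" for n
        proof -
          have "J (Suc n) <+>\<^bsub>R\<^esub> I' \<subseteq> J n <+>\<^bsub>R\<^esub> I'" using step.prems(6)[of n] by (auto simp: set_add_def')
          then show ?thesis unfolding J'_def sat_def by (rule saturation_mono)
        qed
      qed (use I'(2) sat_ideal[OF sum] in \<open>auto simp: J'_def\<close>)
      then obtain N2 where N2: "\<And>n. n \<ge> N2 \<Longrightarrow> J' n = J' N2" by blast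
      define N where "N = max N1 N2"
      \<comment> \<open>The modular law: the nested ideals \<open>J n\<close> and \<open>J N\<close>
        have the same intersection with \<open>I'\<close> and, at \<open>P\<close>, the same sum
        with it, so they agree.\<close>
      have "J n = J N" if "n \<ge> N" for n
      proof
        show "J n \<subseteq> J N" using antimonoD[OF anti that] .
        show "J N \<subseteq> J n"
        proof
          interpret Jn: ideal "J n" R by (rule step.prems(3))
          interpret JN: ideal "J N" R by (rule step.prems(3))
          fix b assume b: "b \<in> J N"
          have "J' N = J' n" using N2[of N] N2[of n] that by (simp add: N_def)
          then have "b \<in> J' n" using b sum_le(2)[of N] sat_ideal(2)[OF sum, of N] unfolding J'_def by blast
          then obtain s where s: "s \<in> carrier R - P" "s \<otimes> b \<in> J n <+>\<^bsub>R\<^esub> I'"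
            using satE unfolding J'_def by blast
          then obtain c i where ci: "c \<in> J n" "i \<in> I'" "s \<otimes> b = c \<oplus> i" by (auto simp: set_add_def')
          have "i = s \<otimes> b \<ominus> c"
            using ci(3) Jn.Icarr[OF ci(1)] I'.Icarr[OF ci(2)]
            by (simp add: minus_eq a_comm[of c] a_assoc r_neg)
          moreover have "c \<in> J N" using ci(1) antimonoD[OF anti that] by blast
          moreover have "s \<otimes> b \<in> J N" using b s(1) by (simp add: JN.I_l_closed)
          ultimately have "i \<in> J N \<inter> I'" using ci(2) by (simp only: minus_eq JN.a_closed JN.a_inv_closed) simp
          then have "i \<in> J n" using N1[of N] N1[of n] that by (auto simp: N_def)
          then have "s \<otimes> b \<in> J n" using ci by simp
          then show "b \<in> J n" using satI[of b s "J n"] s b JN.Icarr step.prems(4) by auto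
        qed
      qed
      then show ?thesis by blast
    qed
  qed
qed

text \<open>The principal ideal theorem. With \<open>y\<close> in \<open>Q1\<close> but not in \<open>Q0\<close>, let \<open>I n\<close> be the ideal
  \<open>(y\<^sup>n) + Q0\<close>, saturated at \<open>Q1\<close>. If the theorem fails, the ideals \<open>I n + (x)\<close>
  become stationary at \<open>P\<close>, so that \<open>I n\<close> equals \<open>I (n + 1)\<close> at \<open>P\<close> by Nakayama's lemma,
  and \<open>y\<close> is a unit at \<open>Q1\<close>.\<close>

lemma principal_ideal_theorem:
  fixes R (structure)
  assumes "noetherian_ring R" "cring R"
    and Q0: "primeideal Q0 R" and Q1: "primeideal Q1 R" and P: "primeideal P R"
    and lt: "Q0 \<subset> Q1" "Q1 \<subset> P" and x: "x \<in> P"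
  obtains (hyp) q where "primeideal q R" "Q0 \<subseteq> q" "x \<in> q" "q \<subset> P"
proof (rule ccontr)
  assume no: "\<not> thesis"
  \<comment> \<open>The negated conclusion makes \<open>P\<close> minimal over \<open>Q0\<close> and
    \<open>x\<close>.\<close>
  have min: "q = P" if "primeideal q R" "Q0 \<subseteq> q" "x \<in> q" "q \<subseteq> P" for q
    using no that(4) hyp[OF that(1-3)] by blast
  interpret noetherian_ring R by fact
  interpret cring R by fact
  interpret Q0: primeideal Q0 R by fact
  interpret Q1: primeideal Q1 R by fact
  interpret P: primeideal P R by fact
  interpret S: module R "self_mod R" by (rule self_mod_module)
  note sub = submodule_self_mod_iff
  have xR: "x \<in> carrier R" using x P.Icarr by simp
  have xQ1: "x \<notin> Q1" using min[OF Q1] lt by blast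
  obtain y where y: "y \<in> Q1" "y \<notin> Q0" using lt by blast
  have yR: "y \<in> carrier R" using y Q1.Icarr by simp
  \<comment> \<open>Powers of the single element \<open>y\<close> take the place of symbolic powers
    of \<open>Q1\<close>: in the domain \<open>R/Q0\<close> they can be cancelled at the
    end.\<close>
  define I where "I = (\<lambda>n::nat. saturation R Q1 (self_mod R) (adjoin R (self_mod R) Q0 (y [^]\<^bsub>R\<^esub> n)))"
  have Q0s: "submodule Q0 R (self_mod R)" using Q0.ideal_axioms by (simp add: sub)
  have yn: "y [^]\<^bsub>R\<^esub> n \<in> carrier (self_mod R)" for n :: nat using yR by simp
  note ad = S.submodule_adjoin[OF Q0s yn]
  have I: "submodule (I n) R (self_mod R)" "saturation R Q1 (self_mod R) (I n) = I n" "Q0 \<subseteq> I n"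
      "y [^]\<^bsub>R\<^esub> n \<in> I n" for n
    unfolding I_def using S.submodule_saturation[OF Q1 ad(1), of n] ad(2,3)[of n] by auto
  have Ic: "I n \<subseteq> carrier R" for n using S.submoduleE(1)[OF I(1)] by simp
  have I_Suc: "I (Suc n) \<subseteq> I n" for n
  proof -
    have "y [^]\<^bsub>R\<^esub> Suc n \<in> adjoin R (self_mod R) Q0 (y [^]\<^bsub>R\<^esub> n)"
      using S.submoduleE(4)[OF ad(1) yR ad(3), of n] yR by (simp add: m_comm)
    then show ?thesis
      unfolding I_def by (intro saturation_mono ad(4) ad(1) ad(2))
  qed
  define J where "J = (\<lambda>n. saturation R P (self_mod R) (adjoin R (self_mod R) (I n) x))"
  have xS: "x \<in> carrier (self_mod R)" using xR by simp
  note adJ = S.submodule_adjoin[OF I(1) xS]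
  note adK = S.submodule_adjoin[OF Q0s xS]
  define K where "K = adjoin R (self_mod R) Q0 x"
  have "\<exists>N. \<forall>n\<ge>N. J n = J N"
  proof (rule saturated_dcc[OF assms(1,2) P, where K = K])
    show "q = P" if "primeideal q R" "K \<subseteq> q" "q \<subseteq> P" for q
      using min[OF that(1) _ _ that(3)] adK(2,3) that(2) unfolding K_def by blast
    show "ideal (saturation R P (self_mod R) K) R" "K \<subseteq> saturation R P (self_mod R) K"
      "saturation R P (self_mod R) (saturation R P (self_mod R) K) = saturation R P (self_mod R) K"
      using S.submodule_saturation[OF P adK(1)] by (simp_all add: K_def sub)
    show "ideal (J n) R" "saturation R P (self_mod R) (J n) = J n" for n
      using S.submodule_saturation[OF P adJ(1)] by (simp_all add: J_def sub)
    show "saturation R P (self_mod R) K \<subseteq> J n" for n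
      unfolding J_def K_def using adJ(2)[of n] I(3)[of n] adJ(3)[of n]
      by (intro saturation_mono adK(4) adJ(1)) auto
    show "J (Suc n) \<subseteq> J n" for n
      unfolding J_def using I_Suc[of n] adJ(2)[of n] adJ(3)[of n]
      by (intro saturation_mono adJ(4) adJ(1)) auto
  qed
  then obtain n where n: "J (Suc n) = J n" by (metis le_SucI le_refl)
  have noeth: "noeth_between R (self_mod R) (I (Suc n)) (I n)"
    by (rule noeth_between_mono[OF noeth_between_antimono[OF noeth_between_self_mod[OF is_cring]]])
      (use Ic S.submodule_zero[OF I(1)] in auto)
  \<comment> \<open>The input for Nakayama's lemma is \<open>I n = x (I n) + I (Suc n)\<close> at
    \<open>P\<close>. Stationarity writes \<open>z\<close>, up to a factor outside \<open>P\<close>,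
    as \<open>r x + c\<close> with \<open>c \<in> I (Suc n)\<close>. Then
    \<open>r x \<in> I n\<close>, and \<open>r\<close> falls back into \<open>I n\<close> because
    that ideal is saturated at \<open>Q1\<close>, which misses \<open>x\<close>.\<close>
  have "I n \<subseteq> saturation R P (self_mod R) (I (Suc n))"
  proof (rule S.nakayama[OF P x I(1) I_Suc I(1) noeth])
    fix z assume z: "z \<in> I n"
    then have "z \<in> J n"
      unfolding J_def using adJ(2)[of n] S.submodule_saturation(2)[OF P adJ(1)] by blast
    then have "z \<in> J (Suc n)" using n by simp
    then obtain s r c where s: "s \<in> carrier R - P" "r \<in> carrier R" "c \<in> I (Suc n)"
        "s \<otimes> z = r \<otimes> x \<oplus> c"
      unfolding J_def saturation_def adjoin_def by auto
    have c: "c \<in> I n" "c \<in> carrier R" "z \<in> carrier R" using s(3) I_Suc Ic z by blast+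
    have "r \<otimes> x = s \<otimes> z \<ominus> c" using s c xR by (simp add: minus_eq a_assoc r_neg)
    moreover have "s \<otimes> z \<ominus> c \<in> I n"
      using z s c ideal.I_l_closed[of "I n" R z s] additive_subgroup.a_inv_closed[of "I n" R c]
        additive_subgroup.a_closed[of "I n" R "s \<otimes> z" "\<ominus> c"] I(1)[of n]
      by (simp add: minus_eq sub ideal.axioms(1))
    ultimately have "x \<otimes> r \<in> I n" using xR s(2) by (simp add: m_comm)
    then have "r \<in> saturation R Q1 (self_mod R) (I n)"
      using xQ1 xR s(2) unfolding saturation_def by auto
    then have "r \<in> I n" using I(2) by simp
    moreover have "s \<otimes> z = x \<otimes> r \<oplus> c" using s xR by (simp add: m_comm)
    ultimately show "\<exists>s\<in>carrier R - P. \<exists>w\<in>I n. \<exists>b\<in>I (Suc n).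
        s \<odot>\<^bsub>self_mod R\<^esub> z = x \<odot>\<^bsub>self_mod R\<^esub> w \<oplus>\<^bsub>self_mod R\<^esub> b"
      using s by auto
  qed
  then obtain s where s: "s \<in> carrier R - P" "s \<otimes> y [^]\<^bsub>R\<^esub> n \<in> I (Suc n)"
    using I(4)[of n] unfolding saturation_def by auto
  then obtain u r c where u: "u \<in> carrier R - Q1" "r \<in> carrier R" "c \<in> Q0"
      "u \<otimes> (s \<otimes> y [^]\<^bsub>R\<^esub> n) = r \<otimes> y [^]\<^bsub>R\<^esub> Suc n \<oplus> c"
    unfolding I_def saturation_def adjoin_def by auto
  have cR: "c \<in> carrier R" using u(3) Q0.Icarr by simp
  \<comment> \<open>Cancelling the power of \<open>y\<close> modulo \<open>Q0\<close> leaves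
    \<open>u s - r y \<in> Q0\<close>, hence \<open>u s \<in> Q1\<close>, although both factors lie
    outside \<open>Q1\<close>.\<close>
  have "(u \<otimes> s \<ominus> r \<otimes> y) \<otimes> y [^]\<^bsub>R\<^esub> n = u \<otimes> (s \<otimes> y [^]\<^bsub>R\<^esub> n) \<ominus> r \<otimes> y [^]\<^bsub>R\<^esub> Suc n"
    using u(1,2) s(1) yR by (simp add: minus_eq l_distr l_minus m_assoc m_comm[of y])
  also have "\<dots> = c"
    unfolding u(4) using u(1,2) cR yR by (simp add: minus_eq a_ac r_neg r_neg1 r_neg2)
  finally have "(u \<otimes> s \<ominus> r \<otimes> y) \<otimes> y [^]\<^bsub>R\<^esub> n \<in> Q0" using u(3) by simp
  then have "u \<otimes> s \<ominus> r \<otimes> y \<in> Q0"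
    using Q0.I_prime[of "u \<otimes> s \<ominus> r \<otimes> y" "y [^]\<^bsub>R\<^esub> n"] prime_pow_notin[OF Q0, of y n] yR y u(1,2) s(1)
    by auto
  then have "u \<otimes> s \<ominus> r \<otimes> y \<in> Q1" using lt by blast
  moreover have "r \<otimes> y \<in> Q1" using Q1.I_l_closed y u(2) by simp
  ultimately have "(u \<otimes> s \<ominus> r \<otimes> y) \<oplus> r \<otimes> y \<in> Q1" by (rule Q1.a_closed)
  moreover have "(u \<otimes> s \<ominus> r \<otimes> y) \<oplus> r \<otimes> y = u \<otimes> s"
    using u(1,2) s(1) yR by (simp add: minus_eq a_assoc l_neg)
  moreover have "s \<in> carrier R - Q1" using s lt by blast
  ultimately show False using prime_mult_notin[OF Q1 u(1)] by auto
qed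

section \<open>Chains of primes and their length\<close>

definition prime_chain :: "('a, 'r) ring_scheme \<Rightarrow> nat \<Rightarrow> (nat \<Rightarrow> 'a set) \<Rightarrow> bool"
  where "prime_chain R n p \<longleftrightarrow> (\<forall>i\<le>n. primeideal (p i) R) \<and> (\<forall>i<n. p i \<subset> p (Suc i))"

lemma prime_chain_extend:
  assumes "prime_chain R n p" "primeideal P R" "p n \<subset> P"
  shows "prime_chain R (Suc n) (p(Suc n := P))"
  using assms unfolding prime_chain_def by (auto simp: le_Suc_eq less_Suc_eq)

lemma prime_chain_Suc:
  "prime_chain R (Suc n) p \<longleftrightarrow> prime_chain R n p \<and> primeideal (p (Suc n)) R \<and> p n \<subset> p (Suc n)"
  unfolding prime_chain_def by (auto simp: le_Suc_eq less_Suc_eq)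

lemma prime_chain_le: "\<lbrakk>prime_chain R n p; i \<le> n\<rbrakk> \<Longrightarrow> p i \<subseteq> p n"
proof (induction n)
  case (Suc n)
  then show ?case by (auto simp: prime_chain_Suc le_Suc_eq)
qed simp

text \<open>At the cost of one link, \<open>x\<close> is pushed from the top of the chain down to
  its bottom. If the prime below the top misses \<open>x\<close>, the principal ideal theorem,
  applied to the three highest primes, replaces it by one that contains \<open>x\<close>; the chain
  below the top is then treated by induction.\<close>

lemma prime_chain_shift:
  assumes "noetherian_ring R" "cring R" "prime_chain R (Suc n) p" "x \<in> p (Suc n)"
  shows "\<exists>p'. prime_chain R n p' \<and> p 0 \<subseteq> p' 0 \<and> x \<in> p' 0 \<and> p' n = p (Suc n)"
  using assms(3,4)
proof (induction n arbitrary: p)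
  case 0
  then show ?case by (intro exI[of _ "\<lambda>_. p 1"]) (auto simp: prime_chain_def)
next
  case (Suc n)
  have ch: "prime_chain R (Suc n) p" "primeideal (p (Suc (Suc n))) R" "p (Suc n) \<subset> p (Suc (Suc n))"
    using Suc.prems by (simp_all add: prime_chain_Suc[of R "Suc n"])
  obtain q where q: "prime_chain R (Suc n) q" "q 0 = p 0" "x \<in> q (Suc n)" "q (Suc n) \<subset> p (Suc (Suc n))"
  proof (cases "x \<in> p (Suc n)")
    case True
    then show ?thesis using that ch by blast
  next
    case False
    have ch': "prime_chain R n p" "primeideal (p (Suc n)) R" "p n \<subset> p (Suc n)" "primeideal (p n) R"
      using ch(1) by (auto simp: prime_chain_Suc prime_chain_def)
    obtain q where q: "primeideal q R" "p n \<subseteq> q" "x \<in> q" "q \<subset> p (Suc (Suc n))"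
      using principal_ideal_theorem[OF assms(1,2) ch'(4,2) ch(2) ch'(3) ch(3) Suc.prems(2)] by blast
    have "p n \<subset> q" using q ch' False by blast
    then show ?thesis
      using that[of "p(Suc n := q)"] prime_chain_extend[OF ch'(1) q(1)] q by simp
  qed
  obtain p' where p': "prime_chain R n p'" "q 0 \<subseteq> p' 0" "x \<in> p' 0" "p' n = q (Suc n)"
    using Suc.IH[OF q(1,3)] by blast
  have "prime_chain R (Suc n) (p'(Suc n := p (Suc (Suc n))))"
    by (rule prime_chain_extend[OF p'(1) ch(2)]) (simp only: p'(4) q(4))
  moreover have "p 0 \<subseteq> (p'(Suc n := p (Suc (Suc n)))) 0" "x \<in> (p'(Suc n := p (Suc (Suc n)))) 0"
      "(p'(Suc n := p (Suc (Suc n)))) (Suc n) = p (Suc (Suc n))"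
    using q(2) p'(2,3) by simp_all
  ultimately show ?case by blast
qed

text \<open>Each element of \<open>xs\<close> costs one link: \<open>prime_chain_shift\<close> moves
  the head of the list into the bottom prime, and the top prime remains minimal over the new bottom
  prime and the tail. With no elements left, minimality forces top and bottom to agree.\<close>

lemma krull_height:
  assumes "noetherian_ring R" "cring R" "prime_chain R n p" "set xs \<subseteq> p n"
    and "\<And>q. \<lbrakk>primeideal q R; p 0 \<subseteq> q; set xs \<subseteq> q; q \<subseteq> p n\<rbrakk> \<Longrightarrow> q = p n"
  shows "n \<le> length xs"
  using assms(3-)
proof (induction xs arbitrary: n p)
  case Nil
  have "primeideal (p 0) R" "p 0 \<subseteq> p n" using Nil prime_chain_le[OF Nil(1)] by (auto simp: prime_chain_def)
  then have eq: "p 0 = p n" using Nil.prems(3) by simp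
  show ?case
  proof (cases n)
    case (Suc k)
    then have "p 0 \<subseteq> p k" "p k \<subset> p n" using Nil.prems(1) prime_chain_le[of R k p 0]
      by (auto simp: prime_chain_Suc)
    then show ?thesis using eq by blast
  qed simp
next
  case (Cons x xs)
  show ?case
  proof (cases n)
    case (Suc k)
    obtain p' where p': "prime_chain R k p'" "p 0 \<subseteq> p' 0" "x \<in> p' 0" "p' k = p n"
      using prime_chain_shift[OF assms(1,2), of k p x] Cons.prems Suc by auto
    have "k \<le> length xs"
    proof (rule Cons.IH[OF p'(1)])
      show "q = p' k" if "primeideal q R" "p' 0 \<subseteq> q" "set xs \<subseteq> q" "q \<subseteq> p' k" for q
        using Cons.prems(3)[of q] that p'(2-4) by auto
    qed (use Cons.prems p' in auto)
    then show ?thesis using Suc by simp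
  qed simp
qed

lemma prime_vimage_quot:
  assumes "cring R" "ideal I R" "primeideal Q (R Quot I)"
  shows "primeideal {r \<in> carrier R. I +>\<^bsub>R\<^esub> r \<in> Q} R"
  using ring_hom_ring.primeideal_vimage[OF ideal.rcos_ring_hom_ring[OF assms(2)] assms(1,3)] by simp

lemma prime_chain_quot:
  fixes R (structure)
  assumes "cring R" "ideal I R" "prime_chain (R Quot I) n p"
  shows "prime_chain R n (\<lambda>i. {r \<in> carrier R. I +>\<^bsub>R\<^esub> r \<in> p i})" (is "prime_chain R n ?p")
    and "I \<subseteq> {r \<in> carrier R. I +>\<^bsub>R\<^esub> r \<in> p 0}"
proof -
  interpret cring R by fact
  interpret I: ideal I R by fact
  have car: "carrier (R Quot I) = (\<lambda>r. I +> r) ` carrier R"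
    by (auto simp: FactRing_def A_RCOSETS_def')
  have pr: "primeideal (p i) (R Quot I)" if "i \<le> n" for i using assms(3) that by (simp add: prime_chain_def)
  have "?p i \<subset> ?p (Suc i)" if "i < n" for i
  proof -
    have lt: "p i \<subset> p (Suc i)" using assms(3) that by (simp add: prime_chain_def)
    then obtain c where c: "c \<in> p (Suc i)" "c \<notin> p i" by blast
    then have "c \<in> carrier (R Quot I)"
      using ideal.Icarr[OF primeideal.axioms(1)[OF pr[of "Suc i"]]] that by simp
    then obtain r where "r \<in> carrier R" "c = I +> r" using car by blast
    then have "r \<in> ?p (Suc i)" "r \<notin> ?p i" using c by auto
    moreover have "?p i \<subseteq> ?p (Suc i)" using lt by blast
    ultimately show ?thesis by (intro psubsetI) auto
  qed
  then show "prime_chain R n ?p"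
    using prime_vimage_quot[OF assms(1,2) pr] unfolding prime_chain_def by blast
  \<comment> \<open>\<open>I\<close> is the zero of \<open>R Quot I\<close>, so it belongs to every
    ideal, and it is the class of each element of \<open>I\<close>.\<close>
  have "I \<in> p 0"
    using additive_subgroup.zero_closed[OF ideal.axioms(1)[OF primeideal.axioms(1)[OF pr[of 0]]]]
    by (simp add: FactRing_def)
  then show "I \<subseteq> {r \<in> carrier R. I +>\<^bsub>R\<^esub> r \<in> p 0}"
    using a_rcos_zero[OF assms(2)] I.Icarr by auto
qed

section \<open>Local rings\<close>

lemma (in noetherian_local_ring) prime_le_max:
  assumes "ideal I R" "I \<noteq> carrier R"
  shows "I \<subseteq> \<mm>"
proof -
  define \<S> where "\<S> = {J. ideal J R \<and> I \<subseteq> J \<and> J \<noteq> carrier R}"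
  have ne: "\<S> \<noteq> {}" using assms unfolding \<S>_def by blast
  have id: "ideal J R" if "J \<in> \<S>" for J using that unfolding \<S>_def by simp
  obtain M where M: "M \<in> \<S>" "\<And>J. \<lbrakk>J \<in> \<S>; M \<subseteq> J\<rbrakk> \<Longrightarrow> J = M"
    using noetherian_maximal[OF ne id] by metis
  have M': "ideal M R" "I \<subseteq> M" "M \<noteq> carrier R" using M(1) unfolding \<S>_def by simp_all
  have "maximalideal M R"
  proof (rule maximalidealI[OF M'(1)])
    show "J = M \<or> J = carrier R" if "ideal J R" "M \<subseteq> J" for J
      using M(2)[of J] that M'(2) unfolding \<S>_def by (simp add: order_trans[of I M J]) blast
  qed (use M'(3) in simp)
  then show ?thesis using unique_maximal M'(2) by simp
qed

lemma (in noetherian_local_ring) Units_local: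
  assumes "a \<in> carrier R - \<mm>"
  shows "a \<in> Units R"
proof (rule ccontr)
  assume a: "a \<notin> Units R"
  have "PIdl a \<noteq> carrier R"
  proof
    assume "PIdl a = carrier R"
    then have "\<one> \<in> PIdl a" by simp
    then obtain b where b: "b \<in> carrier R" "\<one> = b \<otimes> a" unfolding cgenideal_def by blast
    moreover from b have "\<one> = a \<otimes> b" using m_comm[of a b] assms by simp
    ultimately have "a \<in> Units R" using assms unfolding Units_def by auto
    with a show False by simp
  qed
  then have "PIdl a \<subseteq> \<mm>" using prime_le_max cgenideal_ideal assms by simp
  then show False using cgenideal_self[of a] assms by auto
qed

lemma (in noetherian_local_ring) primeideal_max: "primeideal \<mm> R"
  using maximalideal_prime maximalideal_axioms by simp

lemma (in noetherian_local_ring) krull_dim_quot_le: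
  assumes P: "primeideal P R" and xs: "set xs \<subseteq> \<mm>"
    and min: "\<And>q. \<lbrakk>primeideal q R; P \<subseteq> q; set xs \<subseteq> q\<rbrakk> \<Longrightarrow> q = \<mm>"
  shows "krull_dim (R Quot P) \<le> ereal (of_nat (length xs))"
  unfolding krull_dim_def
proof (rule Sup_least, clarify)
  fix n p assume "\<forall>i\<le>n. primeideal (p i) (R Quot P)" "\<forall>i<n. p i \<subset> p (Suc i)"
  then have ch: "prime_chain (R Quot P) n p" by (simp add: prime_chain_def)
  have "n \<le> length xs"
  proof (cases n)
    case (Suc k)
    have iP: "ideal P R" using primeideal.axioms(1)[OF P] .
    define p' where "p' = (\<lambda>i. {r \<in> carrier R. P +> r \<in> p i})"
    have p': "prime_chain R (Suc k) p'" "P \<subseteq> p' 0"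
      using prime_chain_quot[OF is_cring iP ch] Suc unfolding p'_def by auto
    have "p' (Suc k) \<subseteq> \<mm>"
      using p'(1) primeideal.axioms(1) primeideal.I_notcarr by (intro prime_le_max) (fastforce simp: prime_chain_Suc)+
    \<comment> \<open>\<open>krull_height\<close> asks for a chain whose top is minimal over
      \<open>P\<close> and \<open>xs\<close>. Putting \<open>\<mm>\<close> in place of the top prime
      achieves this and keeps the length.\<close>
    then have "prime_chain R (Suc k) (p'(Suc k := \<mm>))"
      using p'(1) primeideal_max by (intro prime_chain_extend) (auto simp: prime_chain_Suc)
    then have "Suc k \<le> length xs"
      using p'(2) xs min by (intro krull_height[OF noetherian_ring_axioms is_cring, where p = "p'(Suc k := \<mm>)"]) auto
    then show ?thesis using Suc by simp
  qed simp
  then show "ereal (of_nat n) \<le> ereal (of_nat (length xs))" by simp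
qed

section \<open>Quotient modules, direct sums and homology\<close>

lemma (in module) submodule_abelian_subgroup:
  assumes "submodule N R M"
  shows "abelian_subgroup N M"
  using assms by (intro abelian_subgroupI3 additive_subgroupI) (auto simp: submodule_def M.abelian_group_axioms)

lemma (in module) coset_eq_iff:
  assumes N: "submodule N R M" and x: "x \<in> carrier M" "y \<in> carrier M"
  shows "N +>\<^bsub>M\<^esub> x = N +>\<^bsub>M\<^esub> y \<longleftrightarrow> x \<ominus>\<^bsub>M\<^esub> y \<in> N"
proof -
  interpret N: abelian_subgroup N M by (rule submodule_abelian_subgroup[OF N])
  have "x \<ominus>\<^bsub>M\<^esub> y \<in> N" if "N +>\<^bsub>M\<^esub> x = N +>\<^bsub>M\<^esub> y"
  proof -
    have "x \<in> N +>\<^bsub>M\<^esub> y" using N.a_rcos_self[OF x(1)] that by simp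
    then obtain h where "h \<in> N" "x = h \<oplus>\<^bsub>M\<^esub> y" by (auto simp: a_r_coset_def')
    moreover from this have "x \<ominus>\<^bsub>M\<^esub> y = h"
      using x N.a_Hcarr by (simp add: M.minus_eq M.a_assoc M.r_neg)
    ultimately show ?thesis by simp
  qed
  moreover have "N +>\<^bsub>M\<^esub> x = N +>\<^bsub>M\<^esub> y" if "x \<ominus>\<^bsub>M\<^esub> y \<in> N"
  proof -
    have "(x \<ominus>\<^bsub>M\<^esub> y) \<oplus>\<^bsub>M\<^esub> y = x" using x by (simp add: M.minus_eq M.a_assoc M.l_neg)
    then have "x \<in> N +>\<^bsub>M\<^esub> y" using that unfolding a_r_coset_def' by force
    then show ?thesis using M.a_repr_independence[OF _ x(2) N.a_subgroup] by simp
  qed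
  ultimately show ?thesis by blast
qed

lemma fact_mod_carrier: "carrier (fact_mod M N) = (\<lambda>x. N +>\<^bsub>M\<^esub> x) ` carrier M"
  by (auto simp: fact_mod_def A_RCOSETS_def')

lemma fact_mod_zero: "\<zero>\<^bsub>fact_mod M N\<^esub> = N"
  by (simp add: fact_mod_def)

lemma fact_mod_simps:
  fixes M :: "('a, 'b) module"
  assumes "module R M" and N: "submodule N R M" and x: "x \<in> carrier M"
  shows "y \<in> carrier M \<Longrightarrow>
      (N +>\<^bsub>M\<^esub> x) \<oplus>\<^bsub>fact_mod M N\<^esub> (N +>\<^bsub>M\<^esub> y) = N +>\<^bsub>M\<^esub> (x \<oplus>\<^bsub>M\<^esub> y)"
    and "r \<in> carrier R \<Longrightarrow>
      r \<odot>\<^bsub>fact_mod M N\<^esub> (N +>\<^bsub>M\<^esub> x) = N +>\<^bsub>M\<^esub> (r \<odot>\<^bsub>M\<^esub> x)"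
    and "N +>\<^bsub>M\<^esub> x = N \<longleftrightarrow> x \<in> N"
proof -
  interpret module R M by fact
  interpret N: abelian_subgroup N M by (rule submodule_abelian_subgroup[OF N])
  show "(N +>\<^bsub>M\<^esub> x) \<oplus>\<^bsub>fact_mod M N\<^esub> (N +>\<^bsub>M\<^esub> y) = N +>\<^bsub>M\<^esub> (x \<oplus>\<^bsub>M\<^esub> y)" if "y \<in> carrier M"
    using N.a_rcos_sum[OF x that] by (simp add: fact_mod_def)
  have N0: "N +>\<^bsub>M\<^esub> \<zero>\<^bsub>M\<^esub> = N" using N.a_subset by simp
  then show "N +>\<^bsub>M\<^esub> x = N \<longleftrightarrow> x \<in> N"
    using coset_eq_iff[OF N x M.zero_closed] x by (simp add: M.minus_eq M.minus_equality[of "\<zero>\<^bsub>M\<^esub>" "\<zero>\<^bsub>M\<^esub>"])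
  show "r \<odot>\<^bsub>fact_mod M N\<^esub> (N +>\<^bsub>M\<^esub> x) = N +>\<^bsub>M\<^esub> (r \<odot>\<^bsub>M\<^esub> x)" if r: "r \<in> carrier R"
  proof -
    \<comment> \<open>The scalar action on cosets is a union over representatives; it collapses to
      one coset because all representatives give the same one.\<close>
    have "N +>\<^bsub>M\<^esub> (r \<odot>\<^bsub>M\<^esub> z) = N +>\<^bsub>M\<^esub> (r \<odot>\<^bsub>M\<^esub> x)" if z: "z \<in> N +>\<^bsub>M\<^esub> x" for z
    proof -
      obtain h where h: "h \<in> N" "z = h \<oplus>\<^bsub>M\<^esub> x" using z unfolding a_r_coset_def' by blast
      then have "r \<odot>\<^bsub>M\<^esub> z \<ominus>\<^bsub>M\<^esub> r \<odot>\<^bsub>M\<^esub> x = r \<odot>\<^bsub>M\<^esub> h"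
        using x N.a_Hcarr r by (simp add: M.minus_eq smult_r_distr M.a_assoc M.r_neg)
      then show ?thesis
        using coset_eq_iff[OF N, of "r \<odot>\<^bsub>M\<^esub> z" "r \<odot>\<^bsub>M\<^esub> x"] h x r N.a_Hcarr submoduleE(4)[OF N r h(1)] by simp
    qed
    then have "(\<Union>z\<in>N +>\<^bsub>M\<^esub> x. N +>\<^bsub>M\<^esub> (r \<odot>\<^bsub>M\<^esub> z)) = N +>\<^bsub>M\<^esub> (r \<odot>\<^bsub>M\<^esub> x)"
      by (intro UN_constant_eq[OF N.a_rcos_self[OF x]]) simp
    then show ?thesis by (simp add: fact_mod_def)
  qed
qed

lemma fact_mod_module:
  fixes M :: "('a, 'b) module"
  assumes M: "module R M" and N: "submodule N R M"
  shows "module R (fact_mod M N)"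
proof -
  interpret module R M by fact
  note simps = fact_mod_simps[OF M N]
  have N0: "\<zero>\<^bsub>fact_mod M N\<^esub> = N +>\<^bsub>M\<^esub> \<zero>\<^bsub>M\<^esub>"
    using submoduleE(1)[OF N] by (simp add: fact_mod_zero)
  show ?thesis
  proof (rule moduleI)
    show "abelian_group (fact_mod M N)"
    proof (rule abelian_groupI)
      show "\<exists>D\<in>carrier (fact_mod M N). D \<oplus>\<^bsub>fact_mod M N\<^esub> C = \<zero>\<^bsub>fact_mod M N\<^esub>"
        if C: "C \<in> carrier (fact_mod M N)" for C
      proof -
        obtain x where x: "x \<in> carrier M" "C = N +>\<^bsub>M\<^esub> x" using C unfolding fact_mod_carrier by blast
        then have "(N +>\<^bsub>M\<^esub> (\<ominus>\<^bsub>M\<^esub> x)) \<oplus>\<^bsub>fact_mod M N\<^esub> C = \<zero>\<^bsub>fact_mod M N\<^esub>"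
          by (simp add: simps N0 M.l_neg)
        then show ?thesis using x(1) by (auto simp: fact_mod_carrier)
      qed
    qed (auto simp: fact_mod_carrier simps N0 M.a_ac)
  qed (auto simp: fact_mod_carrier simps is_cring smult_l_distr smult_r_distr smult_assoc1)
qed

lemma fact_mod_proj:
  fixes M :: "('a, 'b) module"
  assumes "module R M" "submodule N R M"
  shows "(\<lambda>x. N +>\<^bsub>M\<^esub> x) \<in> mod_hom R M (fact_mod M N)"
  by (rule mod_homI) (auto simp: fact_mod_carrier fact_mod_simps[OF assms])

lemma zero_mod_fact_iff:
  fixes M :: "('a, 'b) module"
  assumes "module R M" "submodule N R M"
  shows "zero_mod (fact_mod M N) \<longleftrightarrow> carrier M \<subseteq> N"
proof -
  interpret module R M by fact
  show ?thesis
  proof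
    assume "zero_mod (fact_mod M N)"
    then have "N +>\<^bsub>M\<^esub> x = N" if "x \<in> carrier M" for x
      using that unfolding zero_mod_def fact_mod_zero fact_mod_carrier by blast
    then show "carrier M \<subseteq> N" using fact_mod_simps(3)[OF assms] by blast
  next
    assume "carrier M \<subseteq> N"
    then have "N +>\<^bsub>M\<^esub> x = N" if "x \<in> carrier M" for x
      using fact_mod_simps(3)[OF assms that] that by blast
    then show "zero_mod (fact_mod M N)"
      unfolding zero_mod_def fact_mod_zero fact_mod_carrier using M.zero_closed by auto
  qed
qed

lemma submodule_image:
  assumes "module R M" "module R C" "h \<in> mod_hom R M C" "submodule N R M"
  shows "submodule (h ` N) R C"
proof -
  interpret M: module R M by fact
  interpret C: module R C by fact
  have "h n \<oplus>\<^bsub>C\<^esub> \<zero>\<^bsub>C\<^esub> = h n" if "n \<in> N" for n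
    using M.submoduleE(1)[OF assms(4)] mod_homD(1)[OF assms(3)] that by auto
  then have "{h n \<oplus>\<^bsub>C\<^esub> c |n c. n \<in> N \<and> c \<in> {\<zero>\<^bsub>C\<^esub>}} = h ` N"
    unfolding image_def by (simp cong: conj_cong) metis
  then show ?thesis
    using submodule_image_add[OF assms C.submodule_zero_set] by simp
qed

text \<open>Homology is a quotient of the record whose carrier is cut down to the cycles, so
  submodules of the ambient module have to be reread in that record.\<close>

lemma submodule_carrier_update:
  assumes "module R M" "submodule Z R M" "submodule L R M" "L \<subseteq> Z"
  shows "submodule L R (M\<lparr>carrier := Z\<rparr>)"
proof -
  interpret module R M by fact
  interpret Z: module R "M\<lparr>carrier := Z\<rparr>" by (rule submodule.submodule_is_module[OF assms(2,1)])
  show ?thesis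
    by (rule Z.submoduleI') (use assms(4) submoduleE[OF assms(3)] submodule_zero[OF assms(3)] in auto)
qed

section \<open>Direct sums\<close>

lemma dsum_carrier_iff:
  "f \<in> carrier (dsum I M) \<longleftrightarrow>
     f \<in> (\<Pi>\<^sub>E i\<in>I. carrier (M i)) \<and> finite {i \<in> I. f i \<noteq> \<zero>\<^bsub>M i\<^esub>}"
  by (simp add: dsum_def)

lemma dsum_simps [simp]:
  "\<zero>\<^bsub>dsum I M\<^esub> = (\<lambda>i\<in>I. \<zero>\<^bsub>M i\<^esub>)" "f \<oplus>\<^bsub>dsum I M\<^esub> g = (\<lambda>i\<in>I. f i \<oplus>\<^bsub>M i\<^esub> g i)"
  "r \<odot>\<^bsub>dsum I M\<^esub> f = (\<lambda>i\<in>I. r \<odot>\<^bsub>M i\<^esub> f i)"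
  by (simp_all add: dsum_def)

lemma dsum_eqI:
  "\<lbrakk>f \<in> carrier (dsum I M); g \<in> carrier (dsum I M); \<And>i. i \<in> I \<Longrightarrow> f i = g i\<rbrakk> \<Longrightarrow> f = g"
  unfolding dsum_carrier_iff by (meson PiE_ext)

lemma dsum_component: "\<lbrakk>f \<in> carrier (dsum I M); i \<in> I\<rbrakk> \<Longrightarrow> f i \<in> carrier (M i)"
  by (auto simp: dsum_carrier_iff)

lemma dsum_module:
  assumes "cring R" and M: "\<And>i. i \<in> I \<Longrightarrow> module R (M i)"
  shows "module R (dsum I M)"
proof -
  let ?D = "dsum I M"
  have ag: "abelian_group (M i)" if "i \<in> I" for i using M[OF that] by (simp add: module_def)
  have am: "abelian_monoid (M i)" if "i \<in> I" for i using ag[OF that] by (simp add: abelian_group_def)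
  note mo = abelian_monoid.a_closed[OF am] abelian_monoid.zero_closed[OF am] abelian_monoid.l_zero[OF am]
  have add: "f \<oplus>\<^bsub>?D\<^esub> g \<in> carrier ?D" if fg: "f \<in> carrier ?D" "g \<in> carrier ?D" for f g
    unfolding dsum_carrier_iff
  proof
    show "f \<oplus>\<^bsub>?D\<^esub> g \<in> (\<Pi>\<^sub>E i\<in>I. carrier (M i))"
      using dsum_component[OF fg(1)] dsum_component[OF fg(2)] by (auto simp: mo)
    have "{i \<in> I. (f \<oplus>\<^bsub>?D\<^esub> g) i \<noteq> \<zero>\<^bsub>M i\<^esub>} \<subseteq> {i \<in> I. f i \<noteq> \<zero>\<^bsub>M i\<^esub>} \<union> {i \<in> I. g i \<noteq> \<zero>\<^bsub>M i\<^esub>}"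
      by (auto simp: mo)
    then show "finite {i \<in> I. (f \<oplus>\<^bsub>?D\<^esub> g) i \<noteq> \<zero>\<^bsub>M i\<^esub>}"
      by (rule finite_subset) (use fg in \<open>simp add: dsum_carrier_iff\<close>)
  qed
  have smult: "r \<odot>\<^bsub>?D\<^esub> f \<in> carrier ?D" if rf: "r \<in> carrier R" "f \<in> carrier ?D" for r f
    unfolding dsum_carrier_iff
  proof
    show "r \<odot>\<^bsub>?D\<^esub> f \<in> (\<Pi>\<^sub>E i\<in>I. carrier (M i))"
      using rf(1) dsum_component[OF rf(2)] module.smult_closed[OF M] by auto
    have "{i \<in> I. (r \<odot>\<^bsub>?D\<^esub> f) i \<noteq> \<zero>\<^bsub>M i\<^esub>} \<subseteq> {i \<in> I. f i \<noteq> \<zero>\<^bsub>M i\<^esub>}"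
      using module.smult_r_null[OF M rf(1)] by auto
    then show "finite {i \<in> I. (r \<odot>\<^bsub>?D\<^esub> f) i \<noteq> \<zero>\<^bsub>M i\<^esub>}"
      by (rule finite_subset) (use rf in \<open>simp add: dsum_carrier_iff\<close>)
  qed
  have zero: "\<zero>\<^bsub>?D\<^esub> \<in> carrier ?D" by (auto simp: dsum_carrier_iff mo)
  note cmp = dsum_component
  show ?thesis
  proof (rule moduleI[OF assms(1)])
    show "abelian_group ?D"
    proof (rule abelian_groupI)
      fix f g h assume f: "f \<in> carrier ?D"
      have "(\<ominus>\<^bsub>R\<^esub> \<one>\<^bsub>R\<^esub>) \<odot>\<^bsub>?D\<^esub> f \<oplus>\<^bsub>?D\<^esub> f = \<zero>\<^bsub>?D\<^esub>"
      proof -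
        interpret cring R by fact
        have "(\<ominus>\<^bsub>R\<^esub> \<one>\<^bsub>R\<^esub>) \<odot>\<^bsub>M i\<^esub> f i \<oplus>\<^bsub>M i\<^esub> f i = \<zero>\<^bsub>M i\<^esub>" if i: "i \<in> I" for i
          using cmp[OF f i] module.minus_eq_smult[OF M[OF i], of "f i"] abelian_group.l_neg[OF ag[OF i], of "f i"]
          by simp
        then show ?thesis by auto
      qed
      moreover have "(\<ominus>\<^bsub>R\<^esub> \<one>\<^bsub>R\<^esub>) \<odot>\<^bsub>?D\<^esub> f \<in> carrier ?D"
      proof -
        interpret cring R by fact
        show ?thesis by (rule smult[OF _ f]) simp
      qed
      ultimately show "\<exists>g\<in>carrier ?D. g \<oplus>\<^bsub>?D\<^esub> f = \<zero>\<^bsub>?D\<^esub>" by blast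
      show "\<zero>\<^bsub>?D\<^esub> \<oplus>\<^bsub>?D\<^esub> f = f"
        by (rule dsum_eqI[OF add[OF zero f] f]) (simp add: mo cmp[OF f])
      assume g: "g \<in> carrier ?D"
      show "f \<oplus>\<^bsub>?D\<^esub> g = g \<oplus>\<^bsub>?D\<^esub> f"
        using cmp[OF f] cmp[OF g] by (auto simp: abelian_monoid.a_comm[OF am])
      assume h: "h \<in> carrier ?D"
      show "f \<oplus>\<^bsub>?D\<^esub> g \<oplus>\<^bsub>?D\<^esub> h = f \<oplus>\<^bsub>?D\<^esub> (g \<oplus>\<^bsub>?D\<^esub> h)"
        using cmp[OF f] cmp[OF g] cmp[OF h] by (auto simp: abelian_monoid.a_assoc[OF am])
    qed (use add zero in auto)
    show "a \<odot>\<^bsub>?D\<^esub> f \<in> carrier ?D" if "a \<in> carrier R" "f \<in> carrier ?D" for a f by (rule smult[OF that])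
    show "\<one>\<^bsub>R\<^esub> \<odot>\<^bsub>?D\<^esub> f = f" if f: "f \<in> carrier ?D" for f
    proof -
      interpret cring R by fact
      show ?thesis
        by (rule dsum_eqI[OF smult[OF _ f] f]) (auto simp: module.smult_one[OF M] cmp[OF f])
    qed
  qed (auto simp: module.smult_l_distr[OF M] module.smult_r_distr[OF M] module.smult_assoc1[OF M]
      dsum_component)
qed

lemma dsum_component_hom: "i \<in> I \<Longrightarrow> (\<lambda>f. f i) \<in> mod_hom R (dsum I M) (M i)"
  by (rule mod_homI) (auto simp: dsum_component)

lemma dsum_finite_carrier_iff:
  "finite I \<Longrightarrow> f \<in> carrier (dsum I M) \<longleftrightarrow> f \<in> (\<Pi>\<^sub>E i\<in>I. carrier (M i))"
  by (simp add: dsum_carrier_iff)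

lemma submod_gen_carrierD:
  "\<lbrakk>submod_gen R M S = carrier M; submodule L R M; S \<subseteq> L\<rbrakk> \<Longrightarrow> carrier M \<subseteq> L"
  unfolding submod_gen_def by blast

section \<open>Cycles, boundaries and homology\<close>

context ring_complex
begin

sublocale obj: module R "obj X i" for i by (rule obj_module)

lemma bd_closed: "x \<in> carrier (obj X i) \<Longrightarrow> bd X i x \<in> carrier (obj X (i - 1))"
  by (rule mod_homD(1)[OF bd_hom])

lemma cycles_iff: "z \<in> cycles X i \<longleftrightarrow> z \<in> carrier (obj X i) \<and> bd X i z = \<zero>\<^bsub>obj X (i - 1)\<^esub>"
  by (simp add: cycles_def a_kernel_def kernel_def)

lemma submodule_cycles: "submodule (cycles X i) R (obj X i)"
proof -
  have "cycles X i = {z \<in> carrier (obj X i). bd X i z \<in> {\<zero>\<^bsub>obj X (i - 1)\<^esub>}}"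
    by (auto simp: cycles_iff)
  then show ?thesis
    using submodule_vimage[OF obj_module obj_module bd_hom obj.submodule_zero_set] by simp
qed

lemma submodule_boundaries: "submodule (boundaries X i) R (obj X i)"
  unfolding boundaries_def
  using submodule_image[OF obj_module obj_module bd_hom obj.carrier_is_submodule, of "i + 1"] by simp

lemma boundaries_le_cycles: "boundaries X i \<subseteq> cycles X i"
  using bd_bd[of _ "i + 1"] bd_closed[of _ "i + 1"] by (auto simp: boundaries_def cycles_iff)

lemma cycles_module: "module R ((obj X i)\<lparr>carrier := cycles X i\<rparr>)"
  by (rule submodule.submodule_is_module[OF submodule_cycles obj_module])

lemma submodule_boundaries_cycles: "submodule (boundaries X i) R ((obj X i)\<lparr>carrier := cycles X i\<rparr>)"
  by (rule submodule_carrier_update[OF obj_module submodule_cycles submodule_boundaries boundaries_le_cycles])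

lemma homology_module: "module R (homology X i)"
  unfolding homology_def by (rule fact_mod_module[OF cycles_module submodule_boundaries_cycles])

lemma zero_homology_iff: "zero_mod (homology X i) \<longleftrightarrow> cycles X i \<subseteq> boundaries X i"
  unfolding homology_def using zero_mod_fact_iff[OF cycles_module submodule_boundaries_cycles] by simp

abbreviation hclass :: "int \<Rightarrow> 'b \<Rightarrow> 'b set"
  where "hclass i z \<equiv> boundaries X i +>\<^bsub>(obj X i)\<lparr>carrier := cycles X i\<rparr>\<^esub> z"

lemma homology_carrier: "carrier (homology X i) = hclass i ` cycles X i"
  by (simp add: homology_def fact_mod_carrier)

lemma hclass_hom: "hclass i \<in> mod_hom R ((obj X i)\<lparr>carrier := cycles X i\<rparr>) (homology X i)"
  unfolding homology_def by (rule fact_mod_proj[OF cycles_module submodule_boundaries_cycles])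

lemma hclass_smult_zero_iff:
  assumes "r \<in> carrier R" "z \<in> cycles X i"
  shows "r \<odot>\<^bsub>homology X i\<^esub> hclass i z = \<zero>\<^bsub>homology X i\<^esub> \<longleftrightarrow> r \<odot>\<^bsub>obj X i\<^esub> z \<in> boundaries X i"
proof -
  have "r \<odot>\<^bsub>obj X i\<^esub> z \<in> cycles X i" using obj.submoduleE(4)[OF submodule_cycles assms] .
  then show ?thesis
    using fact_mod_simps(2,3)[OF cycles_module submodule_boundaries_cycles, of _ i] assms
    by (simp add: homology_def fact_mod_zero)
qed

text \<open>The relative generators of the cycles are representatives of the \<open>i\<close>-th components of
  generators of the total homology.\<close>

lemma homologically_finite_noeth:
  assumes "noetherian_ring R" "homologically_finite R X"
  shows "noeth_between R (obj X i) (boundaries X i) (cycles X i)"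
proof -
  let ?D = "dsum UNIV (homology X)"
  interpret D: module R ?D by (rule dsum_module[OF is_cring homology_module])
  obtain S where S: "finite S" "S \<subseteq> carrier ?D" "submod_gen R ?D S = carrier ?D"
    using assms(2) unfolding homologically_finite_def fin_gen_def by blast
  have "(\<lambda>f. f i) ` S \<subseteq> hclass i ` cycles X i"
    using S(2) dsum_component[of _ UNIV "homology X" i] homology_carrier by auto
  then obtain T where T: "T \<subseteq> cycles X i" "finite T" "(\<lambda>f. f i) ` S = hclass i ` T"
    using finite_subset_image[OF finite_imageI[OF S(1)]] by metis
  show ?thesis
  proof (rule obj.noeth_between_finite[OF assms(1) T(2) submodule_boundaries submodule_cycles
        boundaries_le_cycles T(1)])
    fix L assume L: "submodule L R (obj X i)" "boundaries X i \<subseteq> L" "T \<subseteq> L"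
    let ?L = "L \<inter> cycles X i"
    have sL: "submodule ?L R ((obj X i)\<lparr>carrier := cycles X i\<rparr>)"
      by (rule submodule_carrier_update[OF obj_module submodule_cycles
            obj.submodule_Int[OF L(1) submodule_cycles]]) simp
    \<comment> \<open>A submodule \<open>L\<close> containing the representatives yields a submodule
      of the total homology: the elements whose component in degree \<open>i\<close> is the class of
      a cycle in \<open>L\<close>. It contains the generators, hence everything.\<close>
    have "submodule {f \<in> carrier ?D. f i \<in> hclass i ` ?L} R ?D"
      by (rule submodule_vimage[OF D.module_axioms homology_module dsum_component_hom
            submodule_image[OF cycles_module homology_module hclass_hom sL]]) simp
    moreover have "S \<subseteq> {f \<in> carrier ?D. f i \<in> hclass i ` ?L}"
    proof -
      have "hclass i ` T \<subseteq> hclass i ` ?L" using T(1) L(3) by (intro image_mono) simp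
      then have "f i \<in> hclass i ` ?L" if "f \<in> S" for f
        using imageI[OF that, of "\<lambda>f. f i"] unfolding T(3) by (rule subsetD)
      then show ?thesis using S(2) by blast
    qed
    ultimately have all: "carrier ?D \<subseteq> {f \<in> carrier ?D. f i \<in> hclass i ` ?L}"
      by (rule submod_gen_carrierD[OF S(3)])
    show "cycles X i \<subseteq> L"
    proof
      fix z assume z: "z \<in> cycles X i"
      let ?f = "\<lambda>j. if j = i then hclass i z else \<zero>\<^bsub>homology X j\<^esub>"
      have "?f \<in> carrier ?D"
        unfolding dsum_carrier_iff
      proof
        show "?f \<in> (\<Pi>\<^sub>E j\<in>UNIV. carrier (homology X j))"
          using z abelian_monoid.zero_closed[OF abelian_group.axioms(1)[OF module.axioms(2)[OF homology_module]]]
          by (auto simp: homology_carrier)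
        show "finite {j \<in> UNIV. ?f j \<noteq> \<zero>\<^bsub>homology X j\<^esub>}"
          by (rule finite_subset[of _ "{i}"]) auto
      qed
      then have "?f i \<in> hclass i ` ?L" using all by blast
      then obtain l where l: "l \<in> L" "l \<in> cycles X i" "hclass i z = hclass i l" by auto
      have zc: "z \<in> carrier (obj X i)" "l \<in> carrier (obj X i)" using z l by (simp_all add: cycles_iff)
      interpret Z: module R "(obj X i)\<lparr>carrier := cycles X i\<rparr>" by (rule cycles_module)
      have "z \<ominus>\<^bsub>(obj X i)\<lparr>carrier := cycles X i\<rparr>\<^esub> l \<in> boundaries X i"
        using Z.coset_eq_iff[OF submodule_boundaries_cycles, of z l] z l by simp
      then have "z \<ominus>\<^bsub>(obj X i)\<lparr>carrier := cycles X i\<rparr>\<^esub> l \<in> L" using L(2) by blast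
      then have "(z \<ominus>\<^bsub>(obj X i)\<lparr>carrier := cycles X i\<rparr>\<^esub> l) \<oplus>\<^bsub>obj X i\<^esub> l \<in> L"
        using obj.submoduleE(5)[OF L(1) _ l(1)] by simp
      moreover have "(z \<ominus>\<^bsub>(obj X i)\<lparr>carrier := cycles X i\<rparr>\<^esub> l) \<oplus>\<^bsub>(obj X i)\<lparr>carrier := cycles X i\<rparr>\<^esub> l = z"
        using z l Z.M.a_assoc[of z "\<ominus>\<^bsub>(obj X i)\<lparr>carrier := cycles X i\<rparr>\<^esub> l" l] Z.M.l_neg[of l]
          Z.M.r_zero[of z] Z.M.a_inv_closed[of l]
        unfolding Z.M.minus_eq by simp
      ultimately show "z \<in> L" by simp
    qed
  qed
qed

text \<open>Each of the finitely many generators of the total homology has finite support, and the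
  elements vanishing outside the union \<open>F\<close> of these supports form a submodule. The
  bound is what later keeps the infimum of the Koszul complex above minus infinity, as anchor primes
  demand.\<close>

lemma homologically_finite_bounded:
  assumes "homologically_finite R X"
  shows "\<exists>lo. \<forall>i<lo. cycles X i \<subseteq> boundaries X i"
proof -
  let ?D = "dsum UNIV (homology X)"
  interpret D: module R ?D by (rule dsum_module[OF is_cring homology_module])
  interpret H: module R "homology X i" for i by (rule homology_module)
  obtain S where S: "finite S" "S \<subseteq> carrier ?D" "submod_gen R ?D S = carrier ?D"
    using assms unfolding homologically_finite_def fin_gen_def by blast
  define F where "F = (\<Union>f\<in>S. {i. f i \<noteq> \<zero>\<^bsub>homology X i\<^esub>})"
  have "finite F" unfolding F_def using S(1,2) by (auto simp: dsum_carrier_iff)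
  then obtain lo where lo: "\<And>i. i \<in> F \<Longrightarrow> lo \<le> i"
    using bdd_below_finite[of F] by (auto simp: bdd_below_def)
  have "submodule {f \<in> carrier ?D. \<forall>i. i \<notin> F \<longrightarrow> f i = \<zero>\<^bsub>homology X i\<^esub>} R ?D"
    by (rule D.submoduleI')
      (use D.M.zero_closed D.M.a_closed D.smult_closed in \<open>simp_all del: D.M.zero_closed D.M.a_closed D.smult_closed\<close>)
  moreover have "S \<subseteq> {f \<in> carrier ?D. \<forall>i. i \<notin> F \<longrightarrow> f i = \<zero>\<^bsub>homology X i\<^esub>}"
    using S(2) unfolding F_def by blast
  ultimately have all: "carrier ?D \<subseteq> {f \<in> carrier ?D. \<forall>i. i \<notin> F \<longrightarrow> f i = \<zero>\<^bsub>homology X i\<^esub>}"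
    by (rule submod_gen_carrierD[OF S(3)])
  have "zero_mod (homology X i)" if i: "i < lo" for i
  proof -
    have "h = \<zero>\<^bsub>homology X i\<^esub>" if h: "h \<in> carrier (homology X i)" for h
    proof -
      let ?f = "\<lambda>j. if j = i then h else \<zero>\<^bsub>homology X j\<^esub>"
      have "?f \<in> carrier ?D"
        unfolding dsum_carrier_iff
      proof
        show "?f \<in> (\<Pi>\<^sub>E j\<in>UNIV. carrier (homology X j))" using h by auto
        show "finite {j \<in> UNIV. ?f j \<noteq> \<zero>\<^bsub>homology X j\<^esub>}"
          by (rule finite_subset[of _ "{i}"]) auto
      qed
      then have "\<forall>j. j \<notin> F \<longrightarrow> ?f j = \<zero>\<^bsub>homology X j\<^esub>" using all by blast
      moreover have "i \<notin> F" using lo i by force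
      ultimately show ?thesis by (metis (full_types))
    qed
    then show ?thesis using H.M.zero_closed[of i] unfolding zero_mod_def by blast
  qed
  then show ?thesis using zero_homology_iff by blast
qed

lemma cx_inf_ge:
  assumes "\<And>i. i < lo \<Longrightarrow> cycles X i \<subseteq> boundaries X i"
  shows "ereal (of_int lo) \<le> cx_inf X"
  unfolding cx_inf_def
proof (rule Inf_greatest, clarify)
  fix i assume "\<not> zero_mod (homology X i)"
  then have "lo \<le> i" using assms[of i] zero_homology_iff by force
  then show "ereal (of_int lo) \<le> ereal (of_int i)" by simp
qed

end

text \<open>The maximal ideal annihilates the simple quotients of a composition series.\<close>

lemma finite_length_power:
  fixes H :: "('a, 'b) module"
  assumes prime: "ideal \<mm> R" "\<And>u. u \<in> carrier R - \<mm> \<Longrightarrow> u \<in> Units R" "\<one>\<^bsub>R\<^esub> \<notin> \<mm>"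
    and H: "module R H" "finite_length R H" and a: "a \<in> \<mm>"
  shows "\<exists>k::nat. \<forall>h\<in>carrier H. (a [^]\<^bsub>R\<^esub> k) \<odot>\<^bsub>H\<^esub> h = \<zero>\<^bsub>H\<^esub>"
proof -
  interpret H: module R H by fact
  interpret m: ideal \<mm> R by fact
  have aR: "a \<in> carrier R" using a m.Icarr by simp
  obtain n N where comp: "N 0 = {\<zero>\<^bsub>H\<^esub>} \<and> N n = carrier H \<and> (\<forall>i\<le>n. submodule (N i) R H) \<and>
     (\<forall>i<n. N i \<subset> N (Suc i) \<and>
        (\<forall>L. submodule L R H \<and> N i \<subseteq> L \<and> L \<subseteq> N (Suc i) \<longrightarrow> L = N i \<or> L = N (Suc i)))"
    using H(2) unfolding finite_length_def by (elim exE)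
  then have N: "N 0 = {\<zero>\<^bsub>H\<^esub>}" "N n = carrier H" "\<And>i. i \<le> n \<Longrightarrow> submodule (N i) R H"
      "\<And>i. i < n \<Longrightarrow> N i \<subset> N (Suc i)"
      "\<And>i L. \<lbrakk>i < n; submodule L R H; N i \<subseteq> L; L \<subseteq> N (Suc i)\<rbrakk> \<Longrightarrow> L = N i \<or> L = N (Suc i)"
    by simp_all
  have step: "a \<odot>\<^bsub>H\<^esub> y \<in> N i" if i: "i < n" and y: "y \<in> N (Suc i)" for i y
  proof -
    have sub: "submodule (N i) R H" "submodule (N (Suc i)) R H" using N(3) i by auto
    have yH: "y \<in> carrier H" using y H.submoduleE(1)[OF sub(2)] by blast
    have ayH: "a \<odot>\<^bsub>H\<^esub> y \<in> carrier H" using aR yH by simp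
    note ad = H.submodule_adjoin[OF sub(1) ayH]
    have "adjoin R H (N i) (a \<odot>\<^bsub>H\<^esub> y) \<subseteq> N (Suc i)"
      using N(4)[OF i] H.submoduleE(4)[OF sub(2) aR y] by (intro ad(4)[OF sub(2)]) auto
    then consider "adjoin R H (N i) (a \<odot>\<^bsub>H\<^esub> y) = N i" | "adjoin R H (N i) (a \<odot>\<^bsub>H\<^esub> y) = N (Suc i)"
      using N(5)[OF i ad(1,2)] by blast
    then show ?thesis
    proof cases
      case 1
      then show ?thesis using ad(3) by simp
    next
      case 2
      then have "y \<in> adjoin R H (N i) (a \<odot>\<^bsub>H\<^esub> y)" using y by simp
      then obtain r b where rb: "r \<in> carrier R" "b \<in> N i" "y = r \<odot>\<^bsub>H\<^esub> (a \<odot>\<^bsub>H\<^esub> y) \<oplus>\<^bsub>H\<^esub> b"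
        unfolding adjoin_def by blast
      have bH: "b \<in> carrier H" using rb H.submoduleE(1)[OF sub(1)] by blast
      define u where "u = \<one>\<^bsub>R\<^esub> \<ominus>\<^bsub>R\<^esub> r \<otimes>\<^bsub>R\<^esub> a"
      have uR: "u \<in> carrier R" using rb(1) aR by (simp add: u_def)
      have "u \<notin> \<mm>"
      proof
        assume "u \<in> \<mm>"
        then have "u \<oplus>\<^bsub>R\<^esub> r \<otimes>\<^bsub>R\<^esub> a \<in> \<mm>" using m.I_l_closed[OF a rb(1)] by simp
        moreover have "u \<oplus>\<^bsub>R\<^esub> r \<otimes>\<^bsub>R\<^esub> a = \<one>\<^bsub>R\<^esub>"
          using rb(1) aR by (simp add: u_def H.R.minus_eq H.R.a_assoc H.R.l_neg)
        ultimately show False using prime(3) by simp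
      qed
      then have unit: "u \<in> Units R" using prime(2) uR by simp
      have "u \<odot>\<^bsub>H\<^esub> y = y \<oplus>\<^bsub>H\<^esub> \<ominus>\<^bsub>H\<^esub> (r \<odot>\<^bsub>H\<^esub> (a \<odot>\<^bsub>H\<^esub> y))"
        using rb(1) aR yH by (simp add: u_def H.R.minus_eq H.smult_l_distr H.smult_l_minus H.smult_assoc1)
      also have "\<dots> = b"
        by (subst (1) rb(3)) (use rb(1) aR yH bH in \<open>simp add: H.M.a_comm[of "r \<odot>\<^bsub>H\<^esub> (a \<odot>\<^bsub>H\<^esub> y)" b] H.M.a_assoc H.M.r_neg\<close>)
      finally have "inv\<^bsub>R\<^esub> u \<odot>\<^bsub>H\<^esub> (u \<odot>\<^bsub>H\<^esub> y) \<in> N i"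
        using H.submoduleE(4)[OF sub(1)] rb(2) unit by simp
      then have "y \<in> N i" using unit yH uR by (simp add: H.smult_assoc1[symmetric])
      then show ?thesis using H.submoduleE(4)[OF sub(1) aR] by simp
    qed
  qed
  have "(a [^]\<^bsub>R\<^esub> i) \<odot>\<^bsub>H\<^esub> y = \<zero>\<^bsub>H\<^esub>" if "i \<le> n" "y \<in> N i" for i y
    using that
  proof (induction i arbitrary: y)
    case 0
    then show ?case using N(1) by simp
  next
    case (Suc i)
    have "y \<in> carrier H" using Suc.prems H.submoduleE(1)[OF N(3)] by blast
    then have "(a [^]\<^bsub>R\<^esub> Suc i) \<odot>\<^bsub>H\<^esub> y = (a [^]\<^bsub>R\<^esub> i) \<odot>\<^bsub>H\<^esub> (a \<odot>\<^bsub>H\<^esub> y)"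
      using aR by (simp add: H.smult_assoc1)
    then show ?case using Suc.IH[OF _ step[of i y]] Suc.prems by simp
  qed
  then show ?thesis using N(2) by auto
qed

section \<open>Localization\<close>

locale mult_set = cring R for R :: "('a, 'r) ring_scheme" (structure) +
  fixes S :: "'a set"
  assumes S_subset: "S \<subseteq> carrier R" and S_one: "\<one> \<in> S"
    and S_mult: "\<lbrakk>s \<in> S; t \<in> S\<rbrakk> \<Longrightarrow> s \<otimes> t \<in> S"
begin

lemma S_carrier [simp, intro]: "s \<in> S \<Longrightarrow> s \<in> carrier R"
  using S_subset by blast

end

locale loc_module = mult_set R S + M: module R M
  for R :: "('a, 'r) ring_scheme" (structure) and S and M :: "('a, 'b) module"
begin

lemma frac_rel_iff:
  "((x, s), (y, t)) \<in> frac_rel R S M \<longleftrightarrow> x \<in> carrier M \<and> s \<in> S \<and> y \<in> carrier M \<and> t \<in> S \<and>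
     (\<exists>u\<in>S. (u \<otimes> t) \<odot>\<^bsub>M\<^esub> x = (u \<otimes> s) \<odot>\<^bsub>M\<^esub> y)"
  by (auto simp: frac_rel_def M.smult_assoc1)

lemma smult_eq_mult:
  assumes "a \<odot>\<^bsub>M\<^esub> x = b \<odot>\<^bsub>M\<^esub> y" "c \<in> carrier R" "a \<in> carrier R" "b \<in> carrier R"
    "x \<in> carrier M" "y \<in> carrier M"
  shows "(c \<otimes> a) \<odot>\<^bsub>M\<^esub> x = (c \<otimes> b) \<odot>\<^bsub>M\<^esub> y"
  using assms by (simp add: M.smult_assoc1)

lemma equiv_frac_rel: "equiv (carrier M \<times> S) (frac_rel R S M)"
proof (rule equivI)
  show "frac_rel R S M \<subseteq> (carrier M \<times> S) \<times> (carrier M \<times> S)" by (auto simp: frac_rel_def)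
  show "refl_on (carrier M \<times> S) (frac_rel R S M)"
    using S_one by (auto simp: refl_on_def frac_rel_def)
  show "sym (frac_rel R S M)"
    unfolding sym_def frac_rel_def by (auto dest: sym)
  show "trans (frac_rel R S M)"
  proof (rule transI, clarify)
    fix x s y t z w
    assume "((x, s), (y, t)) \<in> frac_rel R S M" "((y, t), (z, w)) \<in> frac_rel R S M"
    then obtain u v where *: "x \<in> carrier M" "y \<in> carrier M" "z \<in> carrier M" "s \<in> S" "t \<in> S" "w \<in> S" "u \<in> S" "v \<in> S"
        "(u \<otimes> t) \<odot>\<^bsub>M\<^esub> x = (u \<otimes> s) \<odot>\<^bsub>M\<^esub> y" "(v \<otimes> w) \<odot>\<^bsub>M\<^esub> y = (v \<otimes> t) \<odot>\<^bsub>M\<^esub> z"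
      by (auto simp: frac_rel_iff)
    \<comment> \<open>If \<open>u\<close> witnesses the first relation and \<open>v\<close> the
      second, then \<open>u v t\<close> witnesses the relation between the outer fractions.\<close>
    have "((v \<otimes> w) \<otimes> (u \<otimes> t)) \<odot>\<^bsub>M\<^esub> x = ((v \<otimes> w) \<otimes> (u \<otimes> s)) \<odot>\<^bsub>M\<^esub> y"
      by (rule smult_eq_mult) (use * in auto)
    also have "\<dots> = ((u \<otimes> s) \<otimes> (v \<otimes> w)) \<odot>\<^bsub>M\<^esub> y" using * by (simp add: m_comm)
    also have "\<dots> = ((u \<otimes> s) \<otimes> (v \<otimes> t)) \<odot>\<^bsub>M\<^esub> z"
      by (rule smult_eq_mult) (use * in auto)
    finally have "((u \<otimes> v \<otimes> t) \<otimes> w) \<odot>\<^bsub>M\<^esub> x = ((u \<otimes> v \<otimes> t) \<otimes> s) \<odot>\<^bsub>M\<^esub> z"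
      using * by (simp add: m_ac)
    then show "((x, s), (z, w)) \<in> frac_rel R S M"
      using * S_mult unfolding frac_rel_iff by blast
  qed
qed

abbreviation frac :: "'b \<Rightarrow> 'a \<Rightarrow> ('b \<times> 'a) set"
  where "frac x s \<equiv> fraction R S M x s"

lemma frac_eq_iff:
  assumes "x \<in> carrier M" "s \<in> S" "y \<in> carrier M" "t \<in> S"
  shows "frac x s = frac y t \<longleftrightarrow> (\<exists>u\<in>S. (u \<otimes> t) \<odot>\<^bsub>M\<^esub> x = (u \<otimes> s) \<odot>\<^bsub>M\<^esub> y)"
  unfolding fraction_def
  using eq_equiv_class_iff[OF equiv_frac_rel, of "(x, s)" "(y, t)"] assms by (simp add: frac_rel_iff)

lemma frac_eqI:
  assumes "x \<in> carrier M" "s \<in> S" "y \<in> carrier M" "t \<in> S" "t \<odot>\<^bsub>M\<^esub> x = s \<odot>\<^bsub>M\<^esub> y"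
  shows "frac x s = frac y t"
  using assms S_one by (auto simp: frac_eq_iff intro!: bexI[of _ \<one>])

lemma frac_self: "\<lbrakk>x \<in> carrier M; s \<in> S\<rbrakk> \<Longrightarrow> (x, s) \<in> frac x s"
  unfolding fraction_def using equiv_class_self[OF equiv_frac_rel] by auto

lemma frac_memD:
  "(y, t) \<in> frac x s \<Longrightarrow>
     y \<in> carrier M \<and> t \<in> S \<and> (\<exists>u\<in>S. (u \<otimes> t) \<odot>\<^bsub>M\<^esub> x = (u \<otimes> s) \<odot>\<^bsub>M\<^esub> y)"
  unfolding fraction_def by (auto simp: frac_rel_iff)

text \<open>The operations of \<open>loc_mod\<close> are unions over all representatives of a
  fraction. Such a union collapses to one term once the terms agree on equivalent pairs.\<close>

lemma frac_UN:
  assumes "x \<in> carrier M" "s \<in> S"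
    and "\<And>y t. \<lbrakk>y \<in> carrier M; t \<in> S; \<exists>u\<in>S. (u \<otimes> t) \<odot>\<^bsub>M\<^esub> x = (u \<otimes> s) \<odot>\<^bsub>M\<^esub> y\<rbrakk> \<Longrightarrow> F y t = F x s"
  shows "(\<Union>(y, t)\<in>frac x s. F y t) = F x s"
proof -
  have "(case p of (y, t) \<Rightarrow> F y t) = F x s" if "p \<in> frac x s" for p
    using frac_memD[of "fst p" "snd p" x s] that assms(3)[of "fst p" "snd p"] by (simp add: case_prod_beta)
  then show ?thesis by (intro UN_constant_eq[OF frac_self[OF assms(1,2)]]) simp
qed

lemma loc_carrier: "carrier (loc_mod R S M) = {frac x s |x s. x \<in> carrier M \<and> s \<in> S}"
  by (auto simp: loc_mod_def quotient_def fraction_def)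

lemma frac_closed: "\<lbrakk>x \<in> carrier M; s \<in> S\<rbrakk> \<Longrightarrow> frac x s \<in> carrier (loc_mod R S M)"
  unfolding loc_carrier by blast

lemma locE:
  assumes "\<xi> \<in> carrier (loc_mod R S M)"
  obtains x s where "x \<in> carrier M" "s \<in> S" "\<xi> = frac x s"
  using assms unfolding loc_carrier by blast

lemma loc_zero: "\<zero>\<^bsub>loc_mod R S M\<^esub> = frac \<zero>\<^bsub>M\<^esub> \<one>"
  by (simp add: loc_mod_def)

lemma loc_add:
  assumes x: "x \<in> carrier M" "s \<in> S" and y: "y \<in> carrier M" "t \<in> S"
  shows "frac x s \<oplus>\<^bsub>loc_mod R S M\<^esub> frac y t = frac (t \<odot>\<^bsub>M\<^esub> x \<oplus>\<^bsub>M\<^esub> s \<odot>\<^bsub>M\<^esub> y) (s \<otimes> t)"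
proof -
  \<comment> \<open>Independence of representatives is checked one argument at a time. Scaling the
    given relation by \<open>s s\<close> makes it match the coefficients of \<open>y\<close> and
    \<open>y'\<close> after cross-multiplication.\<close>
  have right: "frac (t' \<odot>\<^bsub>M\<^esub> x \<oplus>\<^bsub>M\<^esub> s \<odot>\<^bsub>M\<^esub> y') (s \<otimes> t') = frac (t \<odot>\<^bsub>M\<^esub> x \<oplus>\<^bsub>M\<^esub> s \<odot>\<^bsub>M\<^esub> y) (s \<otimes> t)"
    if *: "x \<in> carrier M" "s \<in> S" "y' \<in> carrier M" "t' \<in> S" "\<exists>u\<in>S. (u \<otimes> t') \<odot>\<^bsub>M\<^esub> y = (u \<otimes> t) \<odot>\<^bsub>M\<^esub> y'" for x s y' t'
  proof -
    obtain u where u: "u \<in> S" "(u \<otimes> t') \<odot>\<^bsub>M\<^esub> y = (u \<otimes> t) \<odot>\<^bsub>M\<^esub> y'" using *(5) by blast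
    have e: "((s \<otimes> s) \<otimes> (u \<otimes> t')) \<odot>\<^bsub>M\<^esub> y = ((s \<otimes> s) \<otimes> (u \<otimes> t)) \<odot>\<^bsub>M\<^esub> y'"
      by (rule smult_eq_mult) (use u * y in auto)
    have "(u \<otimes> (s \<otimes> t)) \<odot>\<^bsub>M\<^esub> (t' \<odot>\<^bsub>M\<^esub> x \<oplus>\<^bsub>M\<^esub> s \<odot>\<^bsub>M\<^esub> y')
        = (u \<otimes> s \<otimes> t \<otimes> t') \<odot>\<^bsub>M\<^esub> x \<oplus>\<^bsub>M\<^esub> ((s \<otimes> s) \<otimes> (u \<otimes> t)) \<odot>\<^bsub>M\<^esub> y'"
      using u * y by (simp add: M.smult_r_distr M.smult_assoc1[symmetric] m_ac)
    also have "\<dots> = (u \<otimes> s \<otimes> t \<otimes> t') \<odot>\<^bsub>M\<^esub> x \<oplus>\<^bsub>M\<^esub> ((s \<otimes> s) \<otimes> (u \<otimes> t')) \<odot>\<^bsub>M\<^esub> y"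
      by (simp add: e)
    also have "\<dots> = (u \<otimes> (s \<otimes> t')) \<odot>\<^bsub>M\<^esub> (t \<odot>\<^bsub>M\<^esub> x \<oplus>\<^bsub>M\<^esub> s \<odot>\<^bsub>M\<^esub> y)"
      using u * y by (simp add: M.smult_r_distr M.smult_assoc1[symmetric] m_ac)
    finally show ?thesis
      using u * y S_mult by (subst frac_eq_iff) auto
  qed
  have left: "frac (t \<odot>\<^bsub>M\<^esub> x' \<oplus>\<^bsub>M\<^esub> s' \<odot>\<^bsub>M\<^esub> y) (s' \<otimes> t) = frac (t \<odot>\<^bsub>M\<^esub> x \<oplus>\<^bsub>M\<^esub> s \<odot>\<^bsub>M\<^esub> y) (s \<otimes> t)"
    if *: "x' \<in> carrier M" "s' \<in> S" "\<exists>u\<in>S. (u \<otimes> s') \<odot>\<^bsub>M\<^esub> x = (u \<otimes> s) \<odot>\<^bsub>M\<^esub> x'" for x' s'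
  proof -
    obtain u where u: "u \<in> S" "(u \<otimes> s') \<odot>\<^bsub>M\<^esub> x = (u \<otimes> s) \<odot>\<^bsub>M\<^esub> x'" using *(3) by blast
    have e: "((t \<otimes> t) \<otimes> (u \<otimes> s')) \<odot>\<^bsub>M\<^esub> x = ((t \<otimes> t) \<otimes> (u \<otimes> s)) \<odot>\<^bsub>M\<^esub> x'"
      by (rule smult_eq_mult) (use u * x y in auto)
    have "(u \<otimes> (s \<otimes> t)) \<odot>\<^bsub>M\<^esub> (t \<odot>\<^bsub>M\<^esub> x' \<oplus>\<^bsub>M\<^esub> s' \<odot>\<^bsub>M\<^esub> y)
        = ((t \<otimes> t) \<otimes> (u \<otimes> s)) \<odot>\<^bsub>M\<^esub> x' \<oplus>\<^bsub>M\<^esub> (u \<otimes> s \<otimes> t \<otimes> s') \<odot>\<^bsub>M\<^esub> y"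
      using u * x y by (simp add: M.smult_r_distr M.smult_assoc1[symmetric] m_ac)
    also have "\<dots> = ((t \<otimes> t) \<otimes> (u \<otimes> s')) \<odot>\<^bsub>M\<^esub> x \<oplus>\<^bsub>M\<^esub> (u \<otimes> s \<otimes> t \<otimes> s') \<odot>\<^bsub>M\<^esub> y"
      by (simp add: e)
    also have "\<dots> = (u \<otimes> (s' \<otimes> t)) \<odot>\<^bsub>M\<^esub> (t \<odot>\<^bsub>M\<^esub> x \<oplus>\<^bsub>M\<^esub> s \<odot>\<^bsub>M\<^esub> y)"
      using u * x y by (simp add: M.smult_r_distr M.smult_assoc1[symmetric] m_ac)
    finally show ?thesis
      using u * x y S_mult by (subst frac_eq_iff) auto
  qed
  have inner: "(\<Union>(y', t')\<in>frac y t. frac (t' \<odot>\<^bsub>M\<^esub> x' \<oplus>\<^bsub>M\<^esub> s' \<odot>\<^bsub>M\<^esub> y') (s' \<otimes> t')) =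
      frac (t \<odot>\<^bsub>M\<^esub> x' \<oplus>\<^bsub>M\<^esub> s' \<odot>\<^bsub>M\<^esub> y) (s' \<otimes> t)" if "x' \<in> carrier M" "s' \<in> S" for x' s'
    using right[OF that] by (intro frac_UN y) auto
  have "frac x s \<oplus>\<^bsub>loc_mod R S M\<^esub> frac y t =
      (\<Union>(x', s')\<in>frac x s. (\<Union>(y', t')\<in>frac y t. frac (t' \<odot>\<^bsub>M\<^esub> x' \<oplus>\<^bsub>M\<^esub> s' \<odot>\<^bsub>M\<^esub> y') (s' \<otimes> t')))"
    by (simp add: loc_mod_def)
  also have "\<dots> = frac (t \<odot>\<^bsub>M\<^esub> x \<oplus>\<^bsub>M\<^esub> s \<odot>\<^bsub>M\<^esub> y) (s \<otimes> t)"
    by (subst frac_UN[OF x]) (simp_all add: inner x left)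
  finally show ?thesis .
qed

lemma self_loc_module: "loc_module R S (self_mod R)"
  using self_mod_module by (simp add: loc_module_def mult_set_axioms)

lemma loc_smult:
  assumes a: "a \<in> carrier R" "s \<in> S" and x: "x \<in> carrier M" "t \<in> S"
  shows "fraction R S (self_mod R) a s \<odot>\<^bsub>loc_mod R S M\<^esub> frac x t = frac (a \<odot>\<^bsub>M\<^esub> x) (s \<otimes> t)"
proof -
  interpret self: loc_module R S "self_mod R" by (rule self_loc_module)
  have right: "frac (a \<odot>\<^bsub>M\<^esub> x') (s \<otimes> t') = frac (a \<odot>\<^bsub>M\<^esub> x) (s \<otimes> t)"
    if *: "a \<in> carrier R" "s \<in> S" "x' \<in> carrier M" "t' \<in> S" "\<exists>u\<in>S. (u \<otimes> t') \<odot>\<^bsub>M\<^esub> x = (u \<otimes> t) \<odot>\<^bsub>M\<^esub> x'" for a s x' t'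
  proof -
    obtain u where u: "u \<in> S" "(u \<otimes> t') \<odot>\<^bsub>M\<^esub> x = (u \<otimes> t) \<odot>\<^bsub>M\<^esub> x'" using *(5) by blast
    have "((a \<otimes> s) \<otimes> (u \<otimes> t')) \<odot>\<^bsub>M\<^esub> x = ((a \<otimes> s) \<otimes> (u \<otimes> t)) \<odot>\<^bsub>M\<^esub> x'"
      by (rule smult_eq_mult) (use u * x in auto)
    then have "(u \<otimes> (s \<otimes> t)) \<odot>\<^bsub>M\<^esub> (a \<odot>\<^bsub>M\<^esub> x') = (u \<otimes> (s \<otimes> t')) \<odot>\<^bsub>M\<^esub> (a \<odot>\<^bsub>M\<^esub> x)"
      using u * x by (simp add: M.smult_assoc1[symmetric] m_ac)
    then show ?thesis
      using u * x S_mult by (subst frac_eq_iff) auto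
  qed
  have left: "frac (a' \<odot>\<^bsub>M\<^esub> x) (s' \<otimes> t) = frac (a \<odot>\<^bsub>M\<^esub> x) (s \<otimes> t)"
    if *: "a' \<in> carrier R" "s' \<in> S" "\<exists>u\<in>S. (u \<otimes> s') \<otimes> a = (u \<otimes> s) \<otimes> a'" for a' s'
  proof -
    obtain u where u: "u \<in> S" "(u \<otimes> s') \<otimes> a = (u \<otimes> s) \<otimes> a'" using *(3) by blast
    have "(u \<otimes> (s \<otimes> t)) \<odot>\<^bsub>M\<^esub> (a' \<odot>\<^bsub>M\<^esub> x) = (t \<otimes> ((u \<otimes> s) \<otimes> a')) \<odot>\<^bsub>M\<^esub> x"
      using u * x a by (simp add: M.smult_assoc1[symmetric] m_ac)
    also have "\<dots> = (u \<otimes> (s' \<otimes> t)) \<odot>\<^bsub>M\<^esub> (a \<odot>\<^bsub>M\<^esub> x)"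
      unfolding u(2)[symmetric] using u(1) * x a by (simp add: M.smult_assoc1[symmetric] m_ac)
    finally show ?thesis
      using u * x a S_mult by (subst frac_eq_iff) auto
  qed
  have inner: "(\<Union>(x', t')\<in>frac x t. frac (a' \<odot>\<^bsub>M\<^esub> x') (s' \<otimes> t')) = frac (a' \<odot>\<^bsub>M\<^esub> x) (s' \<otimes> t)"
    if "a' \<in> carrier R" "s' \<in> S" for a' s'
    using right[OF that] by (intro frac_UN x) auto
  have "fraction R S (self_mod R) a s \<odot>\<^bsub>loc_mod R S M\<^esub> frac x t =
      (\<Union>(a', s')\<in>fraction R S (self_mod R) a s. (\<Union>(x', t')\<in>frac x t. frac (a' \<odot>\<^bsub>M\<^esub> x') (s' \<otimes> t')))"
    by (simp add: loc_mod_def)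
  also have "\<dots> = frac (a \<odot>\<^bsub>M\<^esub> x) (s \<otimes> t)"
    by (subst self.frac_UN) (simp_all add: inner a left)
  finally show ?thesis .
qed

lemma loc_abelian_group: "abelian_group (loc_mod R S M)"
proof (rule abelian_groupI)
  show "\<exists>D\<in>carrier (loc_mod R S M). D \<oplus>\<^bsub>loc_mod R S M\<^esub> C = \<zero>\<^bsub>loc_mod R S M\<^esub>"
    if C: "C \<in> carrier (loc_mod R S M)" for C
  proof -
    obtain x s where x: "x \<in> carrier M" "s \<in> S" "C = frac x s" using C unfolding loc_carrier by blast
    have "frac (\<ominus>\<^bsub>M\<^esub> x) s \<oplus>\<^bsub>loc_mod R S M\<^esub> C = frac \<zero>\<^bsub>M\<^esub> (s \<otimes> s)"
      using x by (simp add: loc_add M.smult_r_minus M.M.l_neg)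
    also have "\<dots> = frac \<zero>\<^bsub>M\<^esub> \<one>" using x S_one S_mult by (intro frac_eqI) auto
    finally show ?thesis using x unfolding loc_zero loc_carrier by blast
  qed
qed (auto elim!: locE simp: frac_closed loc_zero loc_add S_one S_mult M.smult_r_distr
    M.smult_assoc1[symmetric] m_ac M.M.a_ac)

end

section \<open>The localized ring\<close>

context mult_set
begin

text \<open>Multiplication in \<open>loc_ring\<close> is the scalar action of \<open>loc_mod\<close>
  on the ring itself, so the computations with fractions in modules serve for the ring as
  well.\<close>

sublocale self: loc_module R S "self_mod R"
  using self_mod_module by (simp add: loc_module_def mult_set_axioms)

lemma loc_ring_simps:
  "carrier (loc_ring R S) = carrier (loc_mod R S (self_mod R))"
  "x \<oplus>\<^bsub>loc_ring R S\<^esub> y = x \<oplus>\<^bsub>loc_mod R S (self_mod R)\<^esub> y"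
  "x \<otimes>\<^bsub>loc_ring R S\<^esub> y = x \<odot>\<^bsub>loc_mod R S (self_mod R)\<^esub> y"
  "\<zero>\<^bsub>loc_ring R S\<^esub> = \<zero>\<^bsub>loc_mod R S (self_mod R)\<^esub>"
  "\<one>\<^bsub>loc_ring R S\<^esub> = self.frac \<one> \<one>"
  by (simp_all add: loc_ring_def Let_def)

lemma loc_ring_carrier: "carrier (loc_ring R S) = {self.frac a s |a s. a \<in> carrier R \<and> s \<in> S}"
  by (simp add: loc_ring_simps self.loc_carrier)

lemma loc_ring_zero: "\<zero>\<^bsub>loc_ring R S\<^esub> = self.frac \<zero> \<one>"
  by (simp add: loc_ring_simps self.loc_zero)

lemma loc_ring_add:
  "\<lbrakk>a \<in> carrier R; s \<in> S; b \<in> carrier R; t \<in> S\<rbrakk> \<Longrightarrow>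
     self.frac a s \<oplus>\<^bsub>loc_ring R S\<^esub> self.frac b t = self.frac (t \<otimes> a \<oplus> s \<otimes> b) (s \<otimes> t)"
  by (simp add: loc_ring_simps self.loc_add)

lemma loc_ring_mult:
  "\<lbrakk>a \<in> carrier R; s \<in> S; b \<in> carrier R; t \<in> S\<rbrakk> \<Longrightarrow>
     self.frac a s \<otimes>\<^bsub>loc_ring R S\<^esub> self.frac b t = self.frac (a \<otimes> b) (s \<otimes> t)"
  by (simp add: loc_ring_simps self.loc_smult)

lemma loc_ring_abelian_group: "abelian_group (loc_ring R S)"
proof -
  interpret L: abelian_group "loc_mod R S (self_mod R)" by (rule self.loc_abelian_group)
  show ?thesis
  proof (rule abelian_groupI)
    show "\<exists>y\<in>carrier (loc_ring R S). y \<oplus>\<^bsub>loc_ring R S\<^esub> x = \<zero>\<^bsub>loc_ring R S\<^esub>"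
      if "x \<in> carrier (loc_ring R S)" for x
      using that L.l_neg L.a_inv_closed unfolding loc_ring_simps by blast
  qed (auto simp: loc_ring_simps L.a_ac)
qed

lemma loc_ring_cring: "cring (loc_ring R S)"
proof (rule cringI[OF loc_ring_abelian_group])
  show "comm_monoid (loc_ring R S)"
    by (rule comm_monoidI)
      (auto elim!: self.locE simp: loc_ring_simps self.loc_smult self.frac_closed S_one S_mult m_ac)
  show "(x \<oplus>\<^bsub>loc_ring R S\<^esub> y) \<otimes>\<^bsub>loc_ring R S\<^esub> z =
      x \<otimes>\<^bsub>loc_ring R S\<^esub> z \<oplus>\<^bsub>loc_ring R S\<^esub> y \<otimes>\<^bsub>loc_ring R S\<^esub> z"
    if xyz: "x \<in> carrier (loc_ring R S)" "y \<in> carrier (loc_ring R S)" "z \<in> carrier (loc_ring R S)" for x y z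
  proof -
    obtain a s b t c u where *: "a \<in> carrier R" "b \<in> carrier R" "c \<in> carrier R" "s \<in> S" "t \<in> S" "u \<in> S"
        "x = self.frac a s" "y = self.frac b t" "z = self.frac c u"
      using xyz unfolding loc_ring_carrier by blast
    have "self.frac ((t \<otimes> a \<oplus> s \<otimes> b) \<otimes> c) ((s \<otimes> t) \<otimes> u) =
        self.frac ((t \<otimes> u) \<otimes> (a \<otimes> c) \<oplus> (s \<otimes> u) \<otimes> (b \<otimes> c)) ((s \<otimes> u) \<otimes> (t \<otimes> u))"
      by (rule self.frac_eqI) (use * S_mult in \<open>auto simp: l_distr r_distr m_ac\<close>)
    then show ?thesis using * S_mult by (simp add: loc_ring_add loc_ring_mult)
  qed
qed

end

lemma (in loc_module) loc_module: "module (loc_ring R S) (loc_mod R S M)"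
proof (rule moduleI[OF loc_ring_cring loc_abelian_group])
  fix \<alpha> \<beta> \<xi> assume "\<alpha> \<in> carrier (loc_ring R S)" "\<beta> \<in> carrier (loc_ring R S)" "\<xi> \<in> carrier (loc_mod R S M)"
  then obtain a s b t x u where *: "a \<in> carrier R" "b \<in> carrier R" "x \<in> carrier M" "s \<in> S" "t \<in> S" "u \<in> S"
      "\<alpha> = self.frac a s" "\<beta> = self.frac b t" "\<xi> = frac x u"
    unfolding loc_ring_carrier loc_carrier by blast
  have "frac ((t \<otimes> a \<oplus> s \<otimes> b) \<odot>\<^bsub>M\<^esub> x) ((s \<otimes> t) \<otimes> u) =
      frac ((t \<otimes> u) \<odot>\<^bsub>M\<^esub> (a \<odot>\<^bsub>M\<^esub> x) \<oplus>\<^bsub>M\<^esub> (s \<otimes> u) \<odot>\<^bsub>M\<^esub> (b \<odot>\<^bsub>M\<^esub> x)) ((s \<otimes> u) \<otimes> (t \<otimes> u))"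
    by (rule frac_eqI)
      (use * S_mult in \<open>auto simp: M.smult_l_distr M.smult_r_distr M.smult_assoc1[symmetric] m_ac\<close>)
  then show "(\<alpha> \<oplus>\<^bsub>loc_ring R S\<^esub> \<beta>) \<odot>\<^bsub>loc_mod R S M\<^esub> \<xi> =
      \<alpha> \<odot>\<^bsub>loc_mod R S M\<^esub> \<xi> \<oplus>\<^bsub>loc_mod R S M\<^esub> \<beta> \<odot>\<^bsub>loc_mod R S M\<^esub> \<xi>"
    using * S_mult by (simp add: loc_ring_add loc_smult loc_add)
  show "(\<alpha> \<otimes>\<^bsub>loc_ring R S\<^esub> \<beta>) \<odot>\<^bsub>loc_mod R S M\<^esub> \<xi> = \<alpha> \<odot>\<^bsub>loc_mod R S M\<^esub> (\<beta> \<odot>\<^bsub>loc_mod R S M\<^esub> \<xi>)"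
    using * S_mult by (simp add: loc_ring_mult loc_smult M.smult_assoc1 m_assoc)
next
  fix \<alpha> \<xi> assume "\<alpha> \<in> carrier (loc_ring R S)" "\<xi> \<in> carrier (loc_mod R S M)"
  then show "\<alpha> \<odot>\<^bsub>loc_mod R S M\<^esub> \<xi> \<in> carrier (loc_mod R S M)"
    unfolding loc_ring_simps
    by (elim locE self.locE) (simp add: loc_smult frac_closed S_mult)
next
  fix \<alpha> \<xi> \<eta> assume "\<alpha> \<in> carrier (loc_ring R S)" "\<xi> \<in> carrier (loc_mod R S M)" "\<eta> \<in> carrier (loc_mod R S M)"
  then obtain a s x t y u where *: "a \<in> carrier R" "x \<in> carrier M" "y \<in> carrier M" "s \<in> S" "t \<in> S" "u \<in> S"
      "\<alpha> = self.frac a s" "\<xi> = frac x t" "\<eta> = frac y u"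
    unfolding loc_ring_carrier loc_carrier by blast
  have "frac (a \<odot>\<^bsub>M\<^esub> (u \<odot>\<^bsub>M\<^esub> x \<oplus>\<^bsub>M\<^esub> t \<odot>\<^bsub>M\<^esub> y)) (s \<otimes> (t \<otimes> u)) =
      frac ((s \<otimes> u) \<odot>\<^bsub>M\<^esub> (a \<odot>\<^bsub>M\<^esub> x) \<oplus>\<^bsub>M\<^esub> (s \<otimes> t) \<odot>\<^bsub>M\<^esub> (a \<odot>\<^bsub>M\<^esub> y)) ((s \<otimes> t) \<otimes> (s \<otimes> u))"
    by (rule frac_eqI)
      (use * S_mult in \<open>auto simp: M.smult_r_distr M.smult_assoc1[symmetric] m_ac\<close>)
  then show "\<alpha> \<odot>\<^bsub>loc_mod R S M\<^esub> (\<xi> \<oplus>\<^bsub>loc_mod R S M\<^esub> \<eta>) =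
      \<alpha> \<odot>\<^bsub>loc_mod R S M\<^esub> \<xi> \<oplus>\<^bsub>loc_mod R S M\<^esub> \<alpha> \<odot>\<^bsub>loc_mod R S M\<^esub> \<eta>"
    using * S_mult by (simp add: loc_smult loc_add)
next
  fix \<xi> assume "\<xi> \<in> carrier (loc_mod R S M)"
  then show "\<one>\<^bsub>loc_ring R S\<^esub> \<odot>\<^bsub>loc_mod R S M\<^esub> \<xi> = \<xi>"
    unfolding loc_carrier loc_ring_simps(5) by (auto simp: loc_smult S_one)
qed

lemma (in loc_module) frac_zero_iff:
  assumes "x \<in> carrier M" "s \<in> S"
  shows "frac x s = \<zero>\<^bsub>loc_mod R S M\<^esub> \<longleftrightarrow> (\<exists>u\<in>S. u \<odot>\<^bsub>M\<^esub> x = \<zero>\<^bsub>M\<^esub>)"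
  using assms S_one by (auto simp: loc_zero frac_eq_iff)

lemma (in loc_module) zero_mod_loc_iff:
  "zero_mod (loc_mod R S M) \<longleftrightarrow> (\<forall>x\<in>carrier M. \<exists>u\<in>S. u \<odot>\<^bsub>M\<^esub> x = \<zero>\<^bsub>M\<^esub>)"
proof
  assume zero: "zero_mod (loc_mod R S M)"
  show "\<forall>x\<in>carrier M. \<exists>u\<in>S. u \<odot>\<^bsub>M\<^esub> x = \<zero>\<^bsub>M\<^esub>"
  proof
    fix x assume x: "x \<in> carrier M"
    then have "frac x \<one> \<in> carrier (loc_mod R S M)" unfolding loc_carrier using S_one by blast
    then have "frac x \<one> = \<zero>\<^bsub>loc_mod R S M\<^esub>" using zero by (simp add: zero_mod_def)
    then show "\<exists>u\<in>S. u \<odot>\<^bsub>M\<^esub> x = \<zero>\<^bsub>M\<^esub>" using frac_zero_iff[OF x S_one] by simp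
  qed
next
  assume ann: "\<forall>x\<in>carrier M. \<exists>u\<in>S. u \<odot>\<^bsub>M\<^esub> x = \<zero>\<^bsub>M\<^esub>"
  have "C = \<zero>\<^bsub>loc_mod R S M\<^esub>" if C: "C \<in> carrier (loc_mod R S M)" for C
  proof -
    obtain x s where "x \<in> carrier M" "s \<in> S" "C = frac x s" using C unfolding loc_carrier by blast
    then show ?thesis using frac_zero_iff ann by simp
  qed
  moreover have "\<zero>\<^bsub>loc_mod R S M\<^esub> \<in> carrier (loc_mod R S M)"
    unfolding loc_carrier loc_zero using S_one by blast
  ultimately show "zero_mod (loc_mod R S M)" unfolding zero_mod_def by blast
qed

section \<open>Localization at a prime ideal\<close>

lemma mult_set_prime:
  assumes "primeideal P R"
  shows "mult_set R (carrier R - P)"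
proof -
  interpret primeideal P R by fact
  show ?thesis
    by unfold_locales (use prime_one_notin[OF assms] prime_mult_notin[OF assms] in auto)
qed

text \<open>For a prime \<open>P\<close> this is the extension of \<open>P\<close> to the local ring
  at \<open>P\<close>, that is, its maximal ideal.\<close>

definition loc_max :: "('a, 'r) ring_scheme \<Rightarrow> 'a set \<Rightarrow> ('a \<times> 'a) set set"
  where "loc_max R P = {fraction R (carrier R - P) (self_mod R) a s |a s. a \<in> P \<and> s \<in> carrier R - P}"

text \<open>Locality of the localization is recorded as invertibility of everything outside this
  ideal, the form in which \<open>local_cx_dim\<close> takes it.\<close>

lemma prime_loc_max:
  fixes R (structure)
  assumes P: "primeideal P R"
  shows "primeideal (loc_max R P) (prime_loc_ring R P)"
    and "\<And>\<alpha>. \<alpha> \<in> carrier (prime_loc_ring R P) - loc_max R P \<Longrightarrow> \<alpha> \<in> Units (prime_loc_ring R P)"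
proof -
  interpret P: primeideal P R by fact
  interpret mult_set R "carrier R - P" by (rule mult_set_prime[OF P])
  let ?S = "carrier R - P" and ?A = "prime_loc_ring R P"
  have A: "?A = loc_ring R ?S" by (simp add: prime_loc_ring_def)
  interpret A: cring ?A unfolding A by (rule loc_ring_cring)
  interpret AA: module ?A "self_mod ?A" by (rule A.self_mod_module)
  \<comment> \<open>Membership can be read off the numerator of any representative, because
    \<open>P\<close> is prime and denominators lie outside it.\<close>
  have mem: "self.frac a s \<in> loc_max R P \<longleftrightarrow> a \<in> P" if a: "a \<in> carrier R" "s \<in> ?S" for a s
  proof
    assume "self.frac a s \<in> loc_max R P"
    then obtain b t where b: "b \<in> P" "t \<in> ?S" "self.frac a s = self.frac b t" unfolding loc_max_def by blast
    then obtain u where u: "u \<in> ?S" "u \<otimes> t \<otimes> a = u \<otimes> s \<otimes> b"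
      using self.frac_eq_iff[of a s b t] a P.Icarr by auto
    have "u \<otimes> s \<otimes> b \<in> P" using b u a by (intro P.I_l_closed) auto
    then have "(u \<otimes> t) \<otimes> a \<in> P" using u by simp
    then show "a \<in> P" using P.I_prime[of "u \<otimes> t" a] prime_mult_notin[OF P u(1) b(2)] a by auto
  qed (use that in \<open>auto simp: loc_max_def\<close>)
  have memI: "self.frac a s \<in> loc_max R P" if "a \<in> P" "s \<in> ?S" for a s
    using that unfolding loc_max_def by blast
  have sub: "loc_max R P \<subseteq> carrier ?A" unfolding A loc_ring_carrier loc_max_def using P.Icarr by blast
  have ideal: "ideal (loc_max R P) ?A"
    unfolding A.submodule_self_mod_iff[symmetric]
  proof (rule AA.submoduleI')
    show "\<zero>\<^bsub>self_mod ?A\<^esub> \<in> loc_max R P" unfolding A self_mod_simps loc_ring_zero using mem[of \<zero> \<one>] S_one by simp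
  next
    fix \<alpha> \<beta> assume "\<alpha> \<in> loc_max R P" "\<beta> \<in> loc_max R P"
    then obtain a s b t where *: "a \<in> P" "s \<in> ?S" "b \<in> P" "t \<in> ?S" "\<alpha> = self.frac a s" "\<beta> = self.frac b t"
      unfolding loc_max_def by blast
    then have "\<alpha> \<oplus>\<^bsub>?A\<^esub> \<beta> = self.frac (t \<otimes> a \<oplus> s \<otimes> b) (s \<otimes> t)" unfolding A using P.Icarr by (simp add: loc_ring_add)
    moreover have "t \<otimes> a \<oplus> s \<otimes> b \<in> P" using * by (simp add: P.I_l_closed)
    ultimately show "\<alpha> \<oplus>\<^bsub>self_mod ?A\<^esub> \<beta> \<in> loc_max R P" using memI S_mult[OF *(2,4)] by simp
  next
    fix \<alpha> \<beta> assume "\<alpha> \<in> carrier ?A" "\<beta> \<in> loc_max R P"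
    then obtain a s b t where *: "a \<in> carrier R" "s \<in> ?S" "b \<in> P" "t \<in> ?S" "\<alpha> = self.frac a s" "\<beta> = self.frac b t"
      unfolding loc_max_def A loc_ring_carrier by blast
    then have "\<alpha> \<otimes>\<^bsub>?A\<^esub> \<beta> = self.frac (a \<otimes> b) (s \<otimes> t)" unfolding A using P.Icarr by (simp add: loc_ring_mult)
    moreover have "a \<otimes> b \<in> P" using * by (simp add: P.I_l_closed)
    ultimately show "\<alpha> \<odot>\<^bsub>self_mod ?A\<^esub> \<beta> \<in> loc_max R P" using memI S_mult[OF *(2,4)] by simp
  qed (use sub in simp)
  show "primeideal (loc_max R P) ?A"
  proof (rule primeidealI[OF ideal A.is_cring])
    have "\<one>\<^bsub>?A\<^esub> \<notin> loc_max R P" unfolding A loc_ring_simps(5) using mem[of \<one> \<one>] S_one by simp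
    then show "carrier ?A \<noteq> loc_max R P" by auto
    fix \<alpha> \<beta> assume "\<alpha> \<in> carrier ?A" "\<beta> \<in> carrier ?A" and ab: "\<alpha> \<otimes>\<^bsub>?A\<^esub> \<beta> \<in> loc_max R P"
    then obtain a s b t where *: "a \<in> carrier R" "s \<in> ?S" "b \<in> carrier R" "t \<in> ?S" "\<alpha> = self.frac a s" "\<beta> = self.frac b t"
      unfolding A loc_ring_carrier by blast
    have "\<alpha> \<otimes>\<^bsub>?A\<^esub> \<beta> = self.frac (a \<otimes> b) (s \<otimes> t)" unfolding A *(5,6) by (rule loc_ring_mult[OF *(1-4)])
    then have "a \<otimes> b \<in> P" using ab mem[of "a \<otimes> b" "s \<otimes> t"] S_mult[OF *(2,4)] *(1,3) by simp
    then show "\<alpha> \<in> loc_max R P \<or> \<beta> \<in> loc_max R P" using P.I_prime[OF *(1,3)] mem * by auto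
  qed
  fix \<alpha> assume \<alpha>: "\<alpha> \<in> carrier ?A - loc_max R P"
  then obtain a s where a: "a \<in> carrier R" "s \<in> ?S" "\<alpha> = self.frac a s" unfolding A loc_ring_carrier by blast
  then have aS: "a \<in> ?S" using \<alpha> mem by blast
  have one: "self.frac c c = \<one>\<^bsub>?A\<^esub>" if "c \<in> ?S" for c
    unfolding A loc_ring_simps(5) using that S_one by (intro self.frac_eqI) auto
  have "\<alpha> \<otimes>\<^bsub>?A\<^esub> self.frac s a = self.frac (a \<otimes> s) (s \<otimes> a)"
    unfolding A a(3) by (rule loc_ring_mult) (use a(1,2) aS in auto)
  also have "\<dots> = \<one>\<^bsub>?A\<^esub>" using one[OF S_mult[OF aS a(2)]] a by (simp add: P.m_comm)
  finally have inv: "\<alpha> \<otimes>\<^bsub>?A\<^esub> self.frac s a = \<one>\<^bsub>?A\<^esub>" .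
  have car: "self.frac s a \<in> carrier ?A" unfolding A loc_ring_carrier using a(2) aS by blast
  then have "self.frac s a \<otimes>\<^bsub>?A\<^esub> \<alpha> = \<one>\<^bsub>?A\<^esub>" using inv A.m_comm[of \<alpha> "self.frac s a"] \<alpha> by simp
  then show "\<alpha> \<in> Units ?A" using inv car \<alpha> unfolding Units_def by blast
qed

section \<open>Localization of complexes\<close>

locale prime_loc_complex = ring_complex R X + P: primeideal P R
  for R :: "('a, 'r) ring_scheme" (structure) and X :: "('a, 'b) cx" and P
begin

abbreviation "S \<equiv> carrier R - P"
abbreviation "W \<equiv> prime_loc_cx R P X"
abbreviation "A \<equiv> prime_loc_ring R P"

sublocale mult_set R S by (rule mult_set_prime[OF P.primeideal])

sublocale loc: loc_module R S "obj X i" for i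
  by (simp add: loc_module_def mult_set_axioms obj_module)

lemma W_obj: "obj W i = loc_mod R S (obj X i)"
  by (simp add: prime_loc_cx_def Let_def)

lemma W_bd:
  assumes "x \<in> carrier (obj X i)" "s \<in> S"
  shows "bd W i (loc.frac i x s) = loc.frac (i - 1) (bd X i x) s"
proof -
  have "loc.frac (i - 1) (bd X i y) t = loc.frac (i - 1) (bd X i x) s"
    if *: "y \<in> carrier (obj X i)" "t \<in> S" "\<exists>u\<in>S. (u \<otimes> t) \<odot>\<^bsub>obj X i\<^esub> x = (u \<otimes> s) \<odot>\<^bsub>obj X i\<^esub> y" for y t
  proof -
    obtain u where u: "u \<in> S" "(u \<otimes> t) \<odot>\<^bsub>obj X i\<^esub> x = (u \<otimes> s) \<odot>\<^bsub>obj X i\<^esub> y" using *(3) by blast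
    have "bd X i ((u \<otimes> t) \<odot>\<^bsub>obj X i\<^esub> x) = bd X i ((u \<otimes> s) \<odot>\<^bsub>obj X i\<^esub> y)" using u(2) by simp
    then have "(u \<otimes> t) \<odot>\<^bsub>obj X (i - 1)\<^esub> bd X i x = (u \<otimes> s) \<odot>\<^bsub>obj X (i - 1)\<^esub> bd X i y"
      using mod_homD(3)[OF bd_hom] u(1) * assms by simp
    moreover have bdc: "bd X i x \<in> carrier (obj X (i - 1))" "bd X i y \<in> carrier (obj X (i - 1))"
      using bd_closed assms(1) *(1) by simp_all
    ultimately show ?thesis
      using loc.frac_eq_iff[OF bdc(1) assms(2) bdc(2) *(2)] u(1) by auto
  qed
  then have "(\<Union>(y, t)\<in>loc.frac i x s. loc.frac (i - 1) (bd X i y) t) = loc.frac (i - 1) (bd X i x) s"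
    by (intro loc.frac_UN assms) auto
  then show ?thesis by (simp add: prime_loc_cx_def Let_def)
qed

lemma W_carrierE:
  assumes "\<xi> \<in> carrier (obj W i)"
  obtains x s where "x \<in> carrier (obj X i)" "s \<in> S" "\<xi> = loc.frac i x s"
  using assms unfolding W_obj loc.loc_carrier by blast

lemma W_carrierI: "\<lbrakk>x \<in> carrier (obj X i); s \<in> S\<rbrakk> \<Longrightarrow> loc.frac i x s \<in> carrier (obj W i)"
  unfolding W_obj loc.loc_carrier by blast

lemma W_complex: "ring_complex A W"
proof -
  have A: "A = loc_ring R S" by (simp add: prime_loc_ring_def)
  have hom: "bd W i \<in> mod_hom A (obj W i) (obj W (i - 1))" for i
  proof (rule mod_homI)
    fix \<xi> assume "\<xi> \<in> carrier (obj W i)"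
    then show "bd W i \<xi> \<in> carrier (obj W (i - 1))"
      by (elim W_carrierE) (simp add: W_bd W_carrierI bd_closed)
  next
    fix \<xi> \<eta> assume "\<xi> \<in> carrier (obj W i)" "\<eta> \<in> carrier (obj W i)"
    then obtain x s y t where *: "x \<in> carrier (obj X i)" "s \<in> S" "\<xi> = loc.frac i x s"
        "y \<in> carrier (obj X i)" "t \<in> S" "\<eta> = loc.frac i y t"
      by (elim W_carrierE) blast
    have "\<xi> \<oplus>\<^bsub>obj W i\<^esub> \<eta> = loc.frac i (t \<odot>\<^bsub>obj X i\<^esub> x \<oplus>\<^bsub>obj X i\<^esub> s \<odot>\<^bsub>obj X i\<^esub> y) (s \<otimes> t)"
      unfolding W_obj *(3,6) by (rule loc.loc_add) (use * in auto)
    then have "bd W i (\<xi> \<oplus>\<^bsub>obj W i\<^esub> \<eta>) =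
        loc.frac (i - 1) (bd X i (t \<odot>\<^bsub>obj X i\<^esub> x \<oplus>\<^bsub>obj X i\<^esub> s \<odot>\<^bsub>obj X i\<^esub> y)) (s \<otimes> t)"
      using * S_mult by (simp add: W_bd)
    also have "\<dots> = loc.frac (i - 1) (t \<odot>\<^bsub>obj X (i - 1)\<^esub> bd X i x \<oplus>\<^bsub>obj X (i - 1)\<^esub> s \<odot>\<^bsub>obj X (i - 1)\<^esub> bd X i y) (s \<otimes> t)"
      using * by (simp add: mod_homD(2,3)[OF bd_hom])
    also have "\<dots> = loc.frac (i - 1) (bd X i x) s \<oplus>\<^bsub>obj W (i - 1)\<^esub> loc.frac (i - 1) (bd X i y) t"
      unfolding W_obj by (rule loc.loc_add[symmetric]) (use * bd_closed in auto)
    finally show "bd W i (\<xi> \<oplus>\<^bsub>obj W i\<^esub> \<eta>) = bd W i \<xi> \<oplus>\<^bsub>obj W (i - 1)\<^esub> bd W i \<eta>"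
      unfolding *(3,6) using * by (simp add: W_bd)
  next
    fix \<alpha> \<xi> assume "\<alpha> \<in> carrier A" "\<xi> \<in> carrier (obj W i)"
    then obtain a s x t where *: "a \<in> carrier R" "s \<in> S" "\<alpha> = self.frac a s"
        "x \<in> carrier (obj X i)" "t \<in> S" "\<xi> = loc.frac i x t"
      unfolding A loc_ring_carrier by (elim W_carrierE) blast
    have "\<alpha> \<odot>\<^bsub>obj W i\<^esub> \<xi> = loc.frac i (a \<odot>\<^bsub>obj X i\<^esub> x) (s \<otimes> t)"
      unfolding W_obj *(3,6) by (rule loc.loc_smult) (use * in auto)
    then have "bd W i (\<alpha> \<odot>\<^bsub>obj W i\<^esub> \<xi>) = loc.frac (i - 1) (bd X i (a \<odot>\<^bsub>obj X i\<^esub> x)) (s \<otimes> t)"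
      using * S_mult by (simp add: W_bd)
    also have "\<dots> = loc.frac (i - 1) (a \<odot>\<^bsub>obj X (i - 1)\<^esub> bd X i x) (s \<otimes> t)"
      using * by (simp add: mod_homD(3)[OF bd_hom])
    also have "\<dots> = \<alpha> \<odot>\<^bsub>obj W (i - 1)\<^esub> loc.frac (i - 1) (bd X i x) t"
      unfolding W_obj *(3) by (rule loc.loc_smult[symmetric]) (use * bd_closed in auto)
    finally show "bd W i (\<alpha> \<odot>\<^bsub>obj W i\<^esub> \<xi>) = \<alpha> \<odot>\<^bsub>obj W (i - 1)\<^esub> bd W i \<xi>"
      unfolding *(6) using * by (simp add: W_bd)
  qed
  show ?thesis
  proof (intro ring_complex.intro ring_complex_axioms.intro hom)
    show "cring A" unfolding A by (rule loc_ring_cring)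
    show "module A (obj W i)" for i unfolding A W_obj by (rule loc.loc_module)
    show "bd W (i - 1) (bd W i \<xi>) = \<zero>\<^bsub>obj W (i - 1 - 1)\<^esub>" if \<xi>: "\<xi> \<in> carrier (obj W i)" for \<xi> i
    proof -
      obtain x s where x: "x \<in> carrier (obj X i)" "s \<in> S" "\<xi> = loc.frac i x s" using \<xi> by (rule W_carrierE)
      have "bd W (i - 1) (bd W i \<xi>) = loc.frac (i - 1 - 1) \<zero>\<^bsub>obj X (i - 1 - 1)\<^esub> s"
        using x bd_closed[OF x(1)] by (simp add: W_bd bd_bd)
      also have "\<dots> = \<zero>\<^bsub>obj W (i - 1 - 1)\<^esub>"
        unfolding W_obj loc.loc_zero using x(2) S_one by (intro loc.frac_eqI) auto
      finally show ?thesis .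
    qed
  qed
qed

sublocale W: ring_complex A W by (rule W_complex)

text \<open>A fraction is zero when some element of \<open>S\<close> kills its numerator, so being a
  cycle becomes a condition on the numerator up to a factor in \<open>S\<close>. Together with
  \<open>W_boundaries_iff\<close> this carries the exactness of localization.\<close>

lemma W_cycles_iff:
  assumes "x \<in> carrier (obj X i)" "s \<in> S"
  shows "loc.frac i x s \<in> cycles W i \<longleftrightarrow> (\<exists>u\<in>S. u \<odot>\<^bsub>obj X i\<^esub> x \<in> cycles X i)"
proof -
  have "loc.frac i x s \<in> cycles W i \<longleftrightarrow> (\<exists>u\<in>S. u \<odot>\<^bsub>obj X (i - 1)\<^esub> bd X i x = \<zero>\<^bsub>obj X (i - 1)\<^esub>)"
    unfolding W.cycles_iff W_bd[OF assms] using W_carrierI[OF assms]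
    by (simp add: W_obj loc.frac_zero_iff[OF bd_closed[OF assms(1)] assms(2)])
  also have "\<dots> \<longleftrightarrow> (\<exists>u\<in>S. u \<odot>\<^bsub>obj X i\<^esub> x \<in> cycles X i)"
    using assms by (auto simp: cycles_iff mod_homD(3)[OF bd_hom])
  finally show ?thesis .
qed

lemma W_boundaries_iff:
  assumes x: "x \<in> carrier (obj X i)" "s \<in> S"
  shows "loc.frac i x s \<in> boundaries W i \<longleftrightarrow> (\<exists>u\<in>S. u \<odot>\<^bsub>obj X i\<^esub> x \<in> boundaries X i)"
proof
  assume "loc.frac i x s \<in> boundaries W i"
  then obtain \<eta> where \<eta>: "\<eta> \<in> carrier (obj W (i + 1))" "loc.frac i x s = bd W (i + 1) \<eta>"
    unfolding boundaries_def by blast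
  then obtain y t where y: "y \<in> carrier (obj X (i + 1))" "t \<in> S" "\<eta> = loc.frac (i + 1) y t"
    by (auto elim: W_carrierE)
  then have bdy: "bd X (i + 1) y \<in> carrier (obj X i)" using bd_closed[of y "i + 1"] by simp
  have "loc.frac i x s = loc.frac i (bd X (i + 1) y) t"
    using \<eta>(2) W_bd[OF y(1,2)] unfolding y(3) by simp
  then obtain u where u: "u \<in> S" "(u \<otimes> t) \<odot>\<^bsub>obj X i\<^esub> x = (u \<otimes> s) \<odot>\<^bsub>obj X i\<^esub> bd X (i + 1) y"
    using loc.frac_eq_iff[OF x bdy y(2)] by blast
  have "bd X (i + 1) y \<in> boundaries X i" using y(1) by (auto simp: boundaries_def)
  then have "(u \<otimes> t) \<odot>\<^bsub>obj X i\<^esub> x \<in> boundaries X i"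
    unfolding u(2) using u(1) x(2) by (intro obj.submoduleE(4)[OF submodule_boundaries]) auto
  then show "\<exists>u\<in>S. u \<odot>\<^bsub>obj X i\<^esub> x \<in> boundaries X i" using S_mult[OF u(1) y(2)] by blast
next
  assume "\<exists>u\<in>S. u \<odot>\<^bsub>obj X i\<^esub> x \<in> boundaries X i"
  then obtain u y where u: "u \<in> S" "y \<in> carrier (obj X (i + 1))" "u \<odot>\<^bsub>obj X i\<^esub> x = bd X (i + 1) y"
    unfolding boundaries_def by blast
  have bdy: "bd X (i + 1) y \<in> carrier (obj X i)" using bd_closed[OF u(2)] by simp
  have us: "u \<otimes> s \<in> S" using S_mult u(1) x(2) by blast
  have "loc.frac i x s = loc.frac i (bd X (i + 1) y) (u \<otimes> s)"
    using x u us by (intro loc.frac_eqI bdy)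
      (auto simp: u(3)[symmetric] obj.smult_assoc1[symmetric] m_comm)
  also have "\<dots> = bd W (i + 1) (loc.frac (i + 1) y (u \<otimes> s))"
    using W_bd[OF u(2) us] by simp
  finally show "loc.frac i x s \<in> boundaries W i"
    unfolding boundaries_def using W_carrierI[OF u(2) us] by blast
qed

lemma W_zero_homology_iff:
  "zero_mod (homology W i) \<longleftrightarrow> (\<forall>z\<in>cycles X i. \<exists>u\<in>S. u \<odot>\<^bsub>obj X i\<^esub> z \<in> boundaries X i)"
  unfolding W.zero_homology_iff
proof
  assume le: "cycles W i \<subseteq> boundaries W i"
  show "\<forall>z\<in>cycles X i. \<exists>u\<in>S. u \<odot>\<^bsub>obj X i\<^esub> z \<in> boundaries X i"
  proof
    fix z assume z: "z \<in> cycles X i"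
    then have zc: "z \<in> carrier (obj X i)" by (simp add: cycles_iff)
    have "\<one> \<odot>\<^bsub>obj X i\<^esub> z \<in> cycles X i" using z zc by simp
    then have "loc.frac i z \<one> \<in> cycles W i" using W_cycles_iff[OF zc S_one] S_one by blast
    then show "\<exists>u\<in>S. u \<odot>\<^bsub>obj X i\<^esub> z \<in> boundaries X i" using le W_boundaries_iff[OF zc S_one] by blast
  qed
next
  assume ann: "\<forall>z\<in>cycles X i. \<exists>u\<in>S. u \<odot>\<^bsub>obj X i\<^esub> z \<in> boundaries X i"
  show "cycles W i \<subseteq> boundaries W i"
  proof
    fix \<zeta> assume \<zeta>: "\<zeta> \<in> cycles W i"
    then have "\<zeta> \<in> carrier (obj W i)" by (simp add: W.cycles_iff)
    then obtain x s where x: "x \<in> carrier (obj X i)" "s \<in> S" "\<zeta> = loc.frac i x s" by (rule W_carrierE)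
    then obtain u where u: "u \<in> S" "u \<odot>\<^bsub>obj X i\<^esub> x \<in> cycles X i" using \<zeta> W_cycles_iff by blast
    then obtain v where v: "v \<in> S" "v \<odot>\<^bsub>obj X i\<^esub> (u \<odot>\<^bsub>obj X i\<^esub> x) \<in> boundaries X i" using ann by blast
    then have "(v \<otimes> u) \<odot>\<^bsub>obj X i\<^esub> x \<in> boundaries X i" using u(1) x(1) by (simp add: obj.smult_assoc1)
    then show "\<zeta> \<in> boundaries W i" using W_boundaries_iff[OF x(1,2)] x(3) S_mult[OF v(1) u(1)] by blast
  qed
qed

text \<open>The localized homology and the homology of the localized complex vanish under the same
  elementwise condition on cycles and boundaries. This links the support, defined by the former, to
  the infimum, defined by the latter.\<close>

lemma mod_Supp_homology_iff:
  "P \<in> mod_Supp R (homology X i) \<longleftrightarrow> \<not> zero_mod (homology W i)"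
proof -
  interpret H: loc_module R S "homology X i"
    by (simp add: loc_module_def mult_set_axioms homology_module)
  have "zero_mod (loc_mod R S (homology X i)) \<longleftrightarrow>
      (\<forall>z\<in>cycles X i. \<exists>u\<in>S. u \<odot>\<^bsub>homology X i\<^esub> hclass i z = \<zero>\<^bsub>homology X i\<^esub>)"
    unfolding H.zero_mod_loc_iff homology_carrier by blast
  also have "\<dots> \<longleftrightarrow> zero_mod (homology W i)"
    unfolding W_zero_homology_iff using hclass_smult_zero_iff by auto
  finally show ?thesis unfolding mod_Supp_def using P.primeideal by simp
qed

lemma cx_inf_loc_ge: "cx_inf X \<le> cx_inf W"
  unfolding cx_inf_def
proof (rule Inf_superset_mono, clarify)
  fix i assume nz: "\<not> zero_mod (homology W i)"
  have "\<not> zero_mod (homology X i)"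
  proof
    assume "zero_mod (homology X i)"
    then have "cycles X i \<subseteq> boundaries X i" by (simp add: zero_homology_iff)
    then have "\<forall>z\<in>cycles X i. \<exists>u\<in>S. u \<odot>\<^bsub>obj X i\<^esub> z \<in> boundaries X i"
      using S_one by (auto simp: cycles_iff intro!: bexI[of _ \<one>])
    then show False using nz W_zero_homology_iff by blast
  qed
  then show "\<exists>j. ereal (of_int i) = ereal (of_int j) \<and> \<not> zero_mod (homology X j)" by blast
qed

end

section \<open>Tensor products with free modules\<close>

lemma submod_gen_props:
  assumes "module R M" "S \<subseteq> carrier M"
  shows "submodule (submod_gen R M S) R M" "S \<subseteq> submod_gen R M S"
    "\<lbrakk>submodule L R M; S \<subseteq> L\<rbrakk> \<Longrightarrow> submod_gen R M S \<subseteq> L"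
proof -
  interpret module R M by fact
  show "S \<subseteq> submod_gen R M S" "\<lbrakk>submodule L R M; S \<subseteq> L\<rbrakk> \<Longrightarrow> submod_gen R M S \<subseteq> L"
    unfolding submod_gen_def by auto
  have car: "submodule (carrier M) R M" by (rule carrier_is_submodule)
  show "submodule (submod_gen R M S) R M"
  proof (rule submoduleI')
    show "submod_gen R M S \<subseteq> carrier M" unfolding submod_gen_def using car assms(2) by blast
  qed (auto simp: submod_gen_def submodule_zero submoduleE)
qed

text \<open>Since the locus of agreement is a submodule, two homomorphisms can be compared on
  generators. Identities on tensor products are proved in this way.\<close>

lemma mod_hom_eq_on_submodule:
  assumes "module R M" "module R N" "f \<in> mod_hom R M N" "g \<in> mod_hom R M N"
  shows "submodule {x \<in> carrier M. f x = g x} R M"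
proof -
  interpret M: module R M by fact
  interpret N: module R N by fact
  show ?thesis
    by (rule M.submoduleI') (auto simp: mod_homD[OF assms(3)] mod_homD[OF assms(4)]
        mod_hom_zero[OF assms(1,2,3)] mod_hom_zero[OF assms(1,2,4)])
qed

lemma mod_hom_finsum:
  assumes "module R M" "module R N" "h \<in> mod_hom R M N" "finite I" "f \<in> I \<rightarrow> carrier M"
  shows "h (\<Oplus>\<^bsub>M\<^esub>i\<in>I. f i) = (\<Oplus>\<^bsub>N\<^esub>i\<in>I. h (f i))"
proof -
  interpret M: module R M by fact
  interpret N: module R N by fact
  show ?thesis using assms(4,5)
  proof (induction I)
    case empty
    then show ?case by (simp add: mod_hom_zero[OF assms(1-3)])
  next
    case (insert i I)
    then have "f i \<in> carrier M" "f \<in> I \<rightarrow> carrier M" by auto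
    moreover from this have "(\<lambda>i. h (f i)) \<in> I \<rightarrow> carrier N" "h (f i) \<in> carrier N"
      using mod_homD(1)[OF assms(3)] by auto
    ultimately show ?case
      using insert by (simp add: mod_homD[OF assms(3)])
  qed
qed

lemma finsum_mod_hom:
  assumes "module R M" "module R N" "finite I" "\<And>i. i \<in> I \<Longrightarrow> h i \<in> mod_hom R M N"
  shows "(\<lambda>x. \<Oplus>\<^bsub>N\<^esub>i\<in>I. h i x) \<in> mod_hom R M N"
proof -
  interpret M: module R M by fact
  interpret N: module R N by fact
  note h = mod_homD[OF assms(4)]
  have cl: "(\<lambda>i. h i x) \<in> I \<rightarrow> carrier N" if "x \<in> carrier M" for x using h(1) that by auto
  show ?thesis
  proof (rule mod_homI)
    show "(\<Oplus>\<^bsub>N\<^esub>i\<in>I. h i x) \<in> carrier N" if "x \<in> carrier M" for x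
      using cl[OF that] by (rule N.M.finsum_closed)
  next
    fix x y assume xy: "x \<in> carrier M" "y \<in> carrier M"
    have "(\<Oplus>\<^bsub>N\<^esub>i\<in>I. h i (x \<oplus>\<^bsub>M\<^esub> y)) = (\<Oplus>\<^bsub>N\<^esub>i\<in>I. h i x \<oplus>\<^bsub>N\<^esub> h i y)"
      by (rule N.M.finsum_cong') (use h xy in auto)
    then show "(\<Oplus>\<^bsub>N\<^esub>i\<in>I. h i (x \<oplus>\<^bsub>M\<^esub> y)) = (\<Oplus>\<^bsub>N\<^esub>i\<in>I. h i x) \<oplus>\<^bsub>N\<^esub> (\<Oplus>\<^bsub>N\<^esub>i\<in>I. h i y)"
      using N.M.finsum_addf[OF cl cl] xy by simp
  next
    fix a x assume ax: "a \<in> carrier R" "x \<in> carrier M"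
    have "(\<Oplus>\<^bsub>N\<^esub>i\<in>I. h i (a \<odot>\<^bsub>M\<^esub> x)) = (\<Oplus>\<^bsub>N\<^esub>i\<in>I. a \<odot>\<^bsub>N\<^esub> h i x)"
      by (rule N.M.finsum_cong') (use h ax in auto)
    then show "(\<Oplus>\<^bsub>N\<^esub>i\<in>I. h i (a \<odot>\<^bsub>M\<^esub> x)) = a \<odot>\<^bsub>N\<^esub> (\<Oplus>\<^bsub>N\<^esub>i\<in>I. h i x)"
      using N.finsum_smult_ldistr[OF assms(3) ax(1) cl] ax by simp
  qed
qed

section \<open>Free modules\<close>

lemma (in cring) free_mod_module: "module R (free_mod R B)"
  unfolding free_mod_def by (rule dsum_module[OF is_cring self_mod_module])

lemma free_mod_carrier_iff:
  "\<phi> \<in> carrier (free_mod R B) \<longleftrightarrow> \<phi> \<in> (\<Pi>\<^sub>E b\<in>B. carrier R) \<and> finite {b \<in> B. \<phi> b \<noteq> \<zero>\<^bsub>R\<^esub>}"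
  by (simp add: free_mod_def dsum_carrier_iff)

lemma free_mod_simps [simp]:
  "\<zero>\<^bsub>free_mod R B\<^esub> = (\<lambda>b\<in>B. \<zero>\<^bsub>R\<^esub>)" "\<phi> \<oplus>\<^bsub>free_mod R B\<^esub> \<psi> = (\<lambda>b\<in>B. \<phi> b \<oplus>\<^bsub>R\<^esub> \<psi> b)"
  "r \<odot>\<^bsub>free_mod R B\<^esub> \<phi> = (\<lambda>b\<in>B. r \<otimes>\<^bsub>R\<^esub> \<phi> b)"
  by (simp_all add: free_mod_def)

lemma (in cring) free_basis_closed: "free_basis R B b \<in> carrier (free_mod R B)"
proof -
  have "finite {c \<in> B. free_basis R B b c \<noteq> \<zero>}"
    by (rule finite_subset[of _ "{b}"]) (auto simp: free_basis_def)
  then show ?thesis by (auto simp: free_mod_carrier_iff free_basis_def)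
qed

lemma (in cring) free_mod_generated:
  assumes L: "submodule L R (free_mod R B)" and basis: "\<And>b. b \<in> B \<Longrightarrow> free_basis R B b \<in> L"
  shows "carrier (free_mod R B) \<subseteq> L"
proof -
  interpret F: module R "free_mod R B" by (rule free_mod_module)
  \<comment> \<open>Induction on a finite set that contains the support, clearing one coordinate at
    a time.\<close>
  have "\<phi> \<in> L" if "\<phi> \<in> carrier (free_mod R B)" "{b \<in> B. \<phi> b \<noteq> \<zero>} \<subseteq> Q" "finite Q" "Q \<subseteq> B" for \<phi> Q
    using that(3,1,2,4)
  proof (induction Q arbitrary: \<phi>)
    case empty
    then have "\<phi> = \<zero>\<^bsub>free_mod R B\<^esub>" by (auto simp: free_mod_carrier_iff fun_eq_iff PiE_iff extensional_def)
    then show ?case using F.submodule_zero[OF L] by (simp only:)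
  next
    case (insert b Q)
    have b: "b \<in> B" "\<phi> b \<in> carrier R" using insert.prems by (auto simp: free_mod_carrier_iff)
    let ?\<psi> = "\<phi>(b := \<zero>)"
    have "{c \<in> B. ?\<psi> c \<noteq> \<zero>} \<subseteq> {c \<in> B. \<phi> c \<noteq> \<zero>}" by auto
    then have "finite {c \<in> B. ?\<psi> c \<noteq> \<zero>}"
      by (rule finite_subset) (use insert.prems in \<open>simp add: free_mod_carrier_iff\<close>)
    then have \<psi>: "?\<psi> \<in> carrier (free_mod R B)"
      using insert.prems(1) b by (auto simp: free_mod_carrier_iff PiE_iff extensional_def)
    have "?\<psi> \<in> L"
      by (rule insert.IH[OF \<psi>]) (use insert.prems in auto)
    moreover have "\<phi> b \<odot>\<^bsub>free_mod R B\<^esub> free_basis R B b \<in> L"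
      using F.submoduleE(4)[OF L b(2) basis[OF b(1)]] .
    ultimately have "?\<psi> \<oplus>\<^bsub>free_mod R B\<^esub> (\<phi> b \<odot>\<^bsub>free_mod R B\<^esub> free_basis R B b) \<in> L"
      by (rule F.submoduleE(5)[OF L])
    moreover have "?\<psi> \<oplus>\<^bsub>free_mod R B\<^esub> (\<phi> b \<odot>\<^bsub>free_mod R B\<^esub> free_basis R B b) = \<phi>"
      using insert.prems(1) b
      by (auto simp: free_basis_def fun_eq_iff free_mod_carrier_iff PiE_iff extensional_def)
    ultimately show ?case by simp
  qed
  from this[OF _ subset_refl] show ?thesis by (simp add: free_mod_carrier_iff subset_iff)
qed

text \<open>The linear extension of \<open>\<beta>\<close> from the basis. It is written as the sum
  inside \<open>tensor_map\<close>, so that the latter becomes an instance.\<close>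

definition free_lift :: "('a, 'r) ring_scheme \<Rightarrow> 'i set \<Rightarrow> ('a, 'c) module \<Rightarrow> ('i \<Rightarrow> 'c) \<Rightarrow> ('i \<Rightarrow> 'a) \<Rightarrow> 'c"
  where "free_lift R B T \<beta> \<phi> = (\<Oplus>\<^bsub>T\<^esub> p \<in> {p \<in> B. \<phi> p \<noteq> \<zero>\<^bsub>R\<^esub>}. \<phi> p \<odot>\<^bsub>T\<^esub> \<beta> p)"

text \<open>The index set of the sum varies with \<open>\<phi>\<close>. Additivity needs sums over a
  common finite set, and enlarging the support only adds zero terms.\<close>

lemma free_lift_superset:
  assumes "module R T" "\<beta> \<in> B \<rightarrow> carrier T" "\<phi> \<in> carrier (free_mod R B)"
    "finite Q" "{p \<in> B. \<phi> p \<noteq> \<zero>\<^bsub>R\<^esub>} \<subseteq> Q" "Q \<subseteq> B"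
  shows "free_lift R B T \<beta> \<phi> = (\<Oplus>\<^bsub>T\<^esub> p \<in> Q. \<phi> p \<odot>\<^bsub>T\<^esub> \<beta> p)"
proof -
  interpret T: module R T by fact
  have cl: "\<phi> p \<odot>\<^bsub>T\<^esub> \<beta> p \<in> carrier T" if "p \<in> Q" for p
    using assms(2,3,6) that by (auto simp: free_mod_carrier_iff)
  have z: "\<phi> p \<odot>\<^bsub>T\<^esub> \<beta> p = \<zero>\<^bsub>T\<^esub>" if "p \<in> Q - {p \<in> B. \<phi> p \<noteq> \<zero>\<^bsub>R\<^esub>}" for p
  proof -
    have "\<phi> p = \<zero>\<^bsub>R\<^esub>" "\<beta> p \<in> carrier T" using that assms(2,6) by auto
    then show ?thesis by simp
  qed
  show ?thesis
    unfolding free_lift_def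
    by (rule T.M.add.finprod_mono_neutral_cong_left) (use assms cl z in auto)
qed

lemma free_lift_hom:
  assumes T: "module R T" and \<beta>: "\<beta> \<in> B \<rightarrow> carrier T"
  shows "free_lift R B T \<beta> \<in> mod_hom R (free_mod R B) T"
proof -
  interpret T: module R T by fact
  interpret F: module R "free_mod R B" by (rule T.R.free_mod_module)
  note sup = free_lift_superset[OF T \<beta>]
  let ?supp = "\<lambda>\<phi>. {p \<in> B. \<phi> p \<noteq> \<zero>\<^bsub>R\<^esub>}"
  have fin: "finite (?supp \<phi>)" if "\<phi> \<in> carrier (free_mod R B)" for \<phi>
    using that by (simp add: free_mod_carrier_iff)
  have val: "\<phi> p \<in> carrier R" if "\<phi> \<in> carrier (free_mod R B)" "p \<in> B" for \<phi> p
    using that by (auto simp: free_mod_carrier_iff)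
  have \<beta>c: "\<beta> p \<in> carrier T" if "p \<in> B" for p using \<beta> that by auto
  show ?thesis
  proof (rule mod_homI)
    show "free_lift R B T \<beta> \<phi> \<in> carrier T" if "\<phi> \<in> carrier (free_mod R B)" for \<phi>
      unfolding free_lift_def by (rule T.M.finsum_closed) (use val[OF that] \<beta>c in auto)
  next
    fix \<phi> \<psi> assume \<phi>: "\<phi> \<in> carrier (free_mod R B)" and \<psi>: "\<psi> \<in> carrier (free_mod R B)"
    let ?Q = "?supp \<phi> \<union> ?supp \<psi>"
    have Q: "finite ?Q" "?Q \<subseteq> B" using fin[OF \<phi>] fin[OF \<psi>] by auto
    have "?supp (\<phi> \<oplus>\<^bsub>free_mod R B\<^esub> \<psi>) \<subseteq> ?Q" by auto
    then have "free_lift R B T \<beta> (\<phi> \<oplus>\<^bsub>free_mod R B\<^esub> \<psi>) = (\<Oplus>\<^bsub>T\<^esub>p\<in>?Q. (\<phi> \<oplus>\<^bsub>free_mod R B\<^esub> \<psi>) p \<odot>\<^bsub>T\<^esub> \<beta> p)"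
      using sup[OF F.M.a_closed[OF \<phi> \<psi>] Q(1)] Q(2) by blast
    also have "\<dots> = (\<Oplus>\<^bsub>T\<^esub>p\<in>?Q. \<phi> p \<odot>\<^bsub>T\<^esub> \<beta> p \<oplus>\<^bsub>T\<^esub> \<psi> p \<odot>\<^bsub>T\<^esub> \<beta> p)"
      by (rule T.M.finsum_cong') (use val[OF \<phi>] val[OF \<psi>] \<beta>c in \<open>auto simp: T.smult_l_distr\<close>)
    also have "\<dots> = (\<Oplus>\<^bsub>T\<^esub>p\<in>?Q. \<phi> p \<odot>\<^bsub>T\<^esub> \<beta> p) \<oplus>\<^bsub>T\<^esub> (\<Oplus>\<^bsub>T\<^esub>p\<in>?Q. \<psi> p \<odot>\<^bsub>T\<^esub> \<beta> p)"
      by (rule T.M.finsum_addf) (use val[OF \<phi>] val[OF \<psi>] \<beta>c in auto)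
    also have "\<dots> = free_lift R B T \<beta> \<phi> \<oplus>\<^bsub>T\<^esub> free_lift R B T \<beta> \<psi>"
      using sup[OF \<phi> Q(1) _ Q(2)] sup[OF \<psi> Q(1) _ Q(2)] by simp
    finally show "free_lift R B T \<beta> (\<phi> \<oplus>\<^bsub>free_mod R B\<^esub> \<psi>) = free_lift R B T \<beta> \<phi> \<oplus>\<^bsub>T\<^esub> free_lift R B T \<beta> \<psi>" .
  next
    fix a \<phi> assume a: "a \<in> carrier R" and \<phi>: "\<phi> \<in> carrier (free_mod R B)"
    have "?supp (a \<odot>\<^bsub>free_mod R B\<^esub> \<phi>) \<subseteq> ?supp \<phi>" using a by auto
    then have "free_lift R B T \<beta> (a \<odot>\<^bsub>free_mod R B\<^esub> \<phi>) = (\<Oplus>\<^bsub>T\<^esub>p\<in>?supp \<phi>. (a \<odot>\<^bsub>free_mod R B\<^esub> \<phi>) p \<odot>\<^bsub>T\<^esub> \<beta> p)"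
      using sup[OF F.smult_closed[OF a \<phi>] fin[OF \<phi>]] by blast
    also have "\<dots> = (\<Oplus>\<^bsub>T\<^esub>p\<in>?supp \<phi>. a \<odot>\<^bsub>T\<^esub> (\<phi> p \<odot>\<^bsub>T\<^esub> \<beta> p))"
      by (rule T.M.finsum_cong') (use val[OF \<phi>] \<beta>c a in \<open>auto simp: T.smult_assoc1\<close>)
    also have "\<dots> = a \<odot>\<^bsub>T\<^esub> free_lift R B T \<beta> \<phi>"
      unfolding free_lift_def
      by (rule T.finsum_smult_ldistr[symmetric, OF fin[OF \<phi>] a]) (use val[OF \<phi>] \<beta>c in auto)
    finally show "free_lift R B T \<beta> (a \<odot>\<^bsub>free_mod R B\<^esub> \<phi>) = a \<odot>\<^bsub>T\<^esub> free_lift R B T \<beta> \<phi>" .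
  qed
qed

lemma free_lift_basis:
  assumes T: "module R T" and \<beta>: "\<beta> \<in> B \<rightarrow> carrier T" and b: "b \<in> B"
  shows "free_lift R B T \<beta> (free_basis R B b) = \<beta> b"
proof -
  interpret T: module R T by fact
  have "free_lift R B T \<beta> (free_basis R B b) = (\<Oplus>\<^bsub>T\<^esub>p\<in>{b}. free_basis R B b p \<odot>\<^bsub>T\<^esub> \<beta> p)"
    by (rule free_lift_superset[OF T \<beta> T.R.free_basis_closed]) (use b in \<open>auto simp: free_basis_def\<close>)
  also have "\<dots> = free_basis R B b b \<odot>\<^bsub>T\<^esub> \<beta> b"
    using b \<beta> funcset_mem[OF \<beta> b] by (subst T.M.finsum_insert) (auto simp: free_basis_def)
  also have "\<dots> = \<beta> b" using b funcset_mem[OF \<beta> b] by (simp add: free_basis_def)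
  finally show ?thesis .
qed

section \<open>The universal property of the tensor product\<close>

definition bilinear ::
  "('a, 'r) ring_scheme \<Rightarrow> ('a, 'b) module \<Rightarrow> ('a, 'c) module \<Rightarrow> ('a, 'd) module \<Rightarrow> ('b \<times> 'c \<Rightarrow> 'd) \<Rightarrow> bool"
  where "bilinear R M N T \<beta> \<longleftrightarrow>
    (\<forall>y\<in>carrier N. (\<lambda>x. \<beta> (x, y)) \<in> mod_hom R M T) \<and> (\<forall>x\<in>carrier M. (\<lambda>y. \<beta> (x, y)) \<in> mod_hom R N T)"

text \<open>For bilinear \<open>\<beta>\<close> the linear extension is constant on each coset of
  \<open>tensor_ker\<close>, so \<open>the_elem\<close> picks its only value there.\<close>

definition tensor_lift ::
  "('a, 'r) ring_scheme \<Rightarrow> ('a, 'b) module \<Rightarrow> ('a, 'c) module \<Rightarrow> ('a, 'd) module \<Rightarrow> ('b \<times> 'c \<Rightarrow> 'd) \<Rightarrow>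
     ('b \<times> 'c \<Rightarrow> 'a) set \<Rightarrow> 'd"
  where "tensor_lift R M N T \<beta> C = the_elem (free_lift R (carrier M \<times> carrier N) T \<beta> ` C)"

lemma tensor_map_eq_lift:
  "tensor_map R M N M' N' f g =
     tensor_lift R M N (tensor_mod R M' N') (\<lambda>p. pure_tensor R M' N' (f (fst p)) (g (snd p)))"
  by (simp add: fun_eq_iff tensor_map_def tensor_lift_def free_lift_def[abs_def])

locale tensor_pair = M: module R M + N: module R N
  for R :: "('a, 'r) ring_scheme" and M :: "('a, 'b) module" and N :: "('a, 'c) module"
begin

abbreviation "F \<equiv> free_mod R (carrier M \<times> carrier N)"
abbreviation "e x y \<equiv> free_basis R (carrier M \<times> carrier N) (x, y)"
abbreviation "K \<equiv> tensor_ker R M N"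
abbreviation "pure \<equiv> pure_tensor R M N"
abbreviation "Ten \<equiv> tensor_mod R M N"

sublocale F: module R F by (rule M.R.free_mod_module)

lemma e_closed: "e x y \<in> carrier F"
  by (rule M.R.free_basis_closed)

lemma rels_closed: "tensor_rels R M N \<subseteq> carrier F"
  unfolding tensor_rels_def Let_def F.M.minus_eq using e_closed by blast

lemma submodule_K: "submodule K R F" "tensor_rels R M N \<subseteq> K"
  "\<lbrakk>submodule L R F; tensor_rels R M N \<subseteq> L\<rbrakk> \<Longrightarrow> K \<subseteq> L"
  unfolding tensor_ker_def using submod_gen_props[OF F.module_axioms rels_closed] by auto

sublocale Ten: module R Ten
  unfolding tensor_mod_def by (rule fact_mod_module[OF F.module_axioms submodule_K(1)])

lemma pure_closed: "pure x y \<in> carrier Ten"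
  unfolding pure_tensor_def tensor_mod_def fact_mod_carrier using e_closed by blast

lemma proj_hom: "(\<lambda>\<phi>. K +>\<^bsub>F\<^esub> \<phi>) \<in> mod_hom R F Ten"
  unfolding tensor_mod_def by (rule fact_mod_proj[OF F.module_axioms submodule_K(1)])

lemma proj_eqI: "\<lbrakk>\<phi> \<in> carrier F; \<psi> \<in> carrier F; \<phi> \<ominus>\<^bsub>F\<^esub> \<psi> \<in> tensor_rels R M N\<rbrakk> \<Longrightarrow> K +>\<^bsub>F\<^esub> \<phi> = K +>\<^bsub>F\<^esub> \<psi>"
  using F.coset_eq_iff[OF submodule_K(1)] submodule_K(2) by blast

lemma bilinear_pure: "bilinear R M N Ten (\<lambda>p. pure (fst p) (snd p))"
proof -
  note ph = mod_homD[OF proj_hom]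
  have "(\<lambda>x. pure x y) \<in> mod_hom R M Ten" if y: "y \<in> carrier N" for y
  proof (rule mod_homI)
    fix x x' assume x: "x \<in> carrier M" "x' \<in> carrier M"
    have "e (x \<oplus>\<^bsub>M\<^esub> x') y \<ominus>\<^bsub>F\<^esub> (e x y \<oplus>\<^bsub>F\<^esub> e x' y) \<in> tensor_rels R M N"
      unfolding tensor_rels_def Let_def using x y by blast
    then have "pure (x \<oplus>\<^bsub>M\<^esub> x') y = K +>\<^bsub>F\<^esub> (e x y \<oplus>\<^bsub>F\<^esub> e x' y)"
      unfolding pure_tensor_def by (intro proj_eqI e_closed F.M.a_closed)
    then show "pure (x \<oplus>\<^bsub>M\<^esub> x') y = pure x y \<oplus>\<^bsub>Ten\<^esub> pure x' y"
      unfolding ph(2)[OF e_closed e_closed] by (simp only: pure_tensor_def)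
  next
    fix r x assume x: "r \<in> carrier R" "x \<in> carrier M"
    have "e (r \<odot>\<^bsub>M\<^esub> x) y \<ominus>\<^bsub>F\<^esub> (r \<odot>\<^bsub>F\<^esub> e x y) \<in> tensor_rels R M N"
      unfolding tensor_rels_def Let_def using x y by blast
    then have "pure (r \<odot>\<^bsub>M\<^esub> x) y = K +>\<^bsub>F\<^esub> (r \<odot>\<^bsub>F\<^esub> e x y)"
      unfolding pure_tensor_def by (intro proj_eqI e_closed F.smult_closed x)
    then show "pure (r \<odot>\<^bsub>M\<^esub> x) y = r \<odot>\<^bsub>Ten\<^esub> pure x y"
      unfolding ph(3)[OF x(1) e_closed] by (simp only: pure_tensor_def)
  qed (rule pure_closed)
  moreover have "(\<lambda>y. pure x y) \<in> mod_hom R N Ten" if x: "x \<in> carrier M" for x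
  proof (rule mod_homI)
    fix y y' assume y: "y \<in> carrier N" "y' \<in> carrier N"
    have "e x (y \<oplus>\<^bsub>N\<^esub> y') \<ominus>\<^bsub>F\<^esub> (e x y \<oplus>\<^bsub>F\<^esub> e x y') \<in> tensor_rels R M N"
      unfolding tensor_rels_def Let_def using x y by blast
    then have "pure x (y \<oplus>\<^bsub>N\<^esub> y') = K +>\<^bsub>F\<^esub> (e x y \<oplus>\<^bsub>F\<^esub> e x y')"
      unfolding pure_tensor_def by (intro proj_eqI e_closed F.M.a_closed)
    then show "pure x (y \<oplus>\<^bsub>N\<^esub> y') = pure x y \<oplus>\<^bsub>Ten\<^esub> pure x y'"
      unfolding ph(2)[OF e_closed e_closed] by (simp only: pure_tensor_def)
  next
    fix r y assume y: "r \<in> carrier R" "y \<in> carrier N"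
    have "e x (r \<odot>\<^bsub>N\<^esub> y) \<ominus>\<^bsub>F\<^esub> (r \<odot>\<^bsub>F\<^esub> e x y) \<in> tensor_rels R M N"
      unfolding tensor_rels_def Let_def using x y by blast
    then have "pure x (r \<odot>\<^bsub>N\<^esub> y) = K +>\<^bsub>F\<^esub> (r \<odot>\<^bsub>F\<^esub> e x y)"
      unfolding pure_tensor_def by (intro proj_eqI e_closed F.smult_closed y)
    then show "pure x (r \<odot>\<^bsub>N\<^esub> y) = r \<odot>\<^bsub>Ten\<^esub> pure x y"
      unfolding ph(3)[OF y(1) e_closed] by (simp only: pure_tensor_def)
  qed (rule pure_closed)
  ultimately show ?thesis unfolding bilinear_def by simp
qed

lemma pure_hom:
  shows "y \<in> carrier N \<Longrightarrow> (\<lambda>x. pure x y) \<in> mod_hom R M Ten"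
    and "x \<in> carrier M \<Longrightarrow> (\<lambda>y. pure x y) \<in> mod_hom R N Ten"
  using bilinear_pure unfolding bilinear_def by simp_all

lemma tensor_generated:
  assumes L: "submodule L R Ten" and pure: "\<And>x y. \<lbrakk>x \<in> carrier M; y \<in> carrier N\<rbrakk> \<Longrightarrow> pure x y \<in> L"
  shows "carrier Ten \<subseteq> L"
proof -
  have "carrier F \<subseteq> {\<phi> \<in> carrier F. K +>\<^bsub>F\<^esub> \<phi> \<in> L}"
    by (rule M.R.free_mod_generated[OF submodule_vimage[OF F.module_axioms Ten.module_axioms proj_hom L]])
      (use pure e_closed in \<open>auto simp: pure_tensor_def\<close>)
  then show ?thesis unfolding tensor_mod_def fact_mod_carrier by blast
qed

lemma tensor_hom_eqI:
  assumes T: "module R T" and f: "f \<in> mod_hom R Ten T" and g: "g \<in> mod_hom R Ten T"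
    and eq: "\<And>x y. \<lbrakk>x \<in> carrier M; y \<in> carrier N\<rbrakk> \<Longrightarrow> f (pure x y) = g (pure x y)"
    and t: "t \<in> carrier Ten"
  shows "f t = g t"
  using tensor_generated[OF mod_hom_eq_on_submodule[OF Ten.module_axioms T f g]] eq pure_closed t by blast

context
  fixes T :: "('a, 'd) module" and \<beta> :: "'b \<times> 'c \<Rightarrow> 'd"
  assumes T: "module R T" and \<beta>: "bilinear R M N T \<beta>"
begin

interpretation T: module R T by (rule T)

lemma \<beta>_hom:
  shows "y \<in> carrier N \<Longrightarrow> (\<lambda>x. \<beta> (x, y)) \<in> mod_hom R M T"
    and "x \<in> carrier M \<Longrightarrow> (\<lambda>y. \<beta> (x, y)) \<in> mod_hom R N T"
  using \<beta> unfolding bilinear_def by simp_all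

lemma \<beta>_closed: "\<beta> \<in> carrier M \<times> carrier N \<rightarrow> carrier T"
  using mod_homD(1)[OF \<beta>_hom(2)] by auto

abbreviation "L\<beta> \<equiv> free_lift R (carrier M \<times> carrier N) T \<beta>"

lemma L\<beta>_hom: "L\<beta> \<in> mod_hom R F T"
  by (rule free_lift_hom[OF T \<beta>_closed])

lemma L\<beta>_e: "\<lbrakk>x \<in> carrier M; y \<in> carrier N\<rbrakk> \<Longrightarrow> L\<beta> (e x y) = \<beta> (x, y)"
  by (rule free_lift_basis[OF T \<beta>_closed]) simp

lemma L\<beta>_minus:
  assumes "\<phi> \<in> carrier F" "\<psi> \<in> carrier F" "L\<beta> \<phi> = L\<beta> \<psi>"
  shows "\<phi> \<ominus>\<^bsub>F\<^esub> \<psi> \<in> {\<phi> \<in> carrier F. L\<beta> \<phi> \<in> {\<zero>\<^bsub>T\<^esub>}}"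
proof -
  have "L\<beta> (\<phi> \<ominus>\<^bsub>F\<^esub> \<psi>) = \<zero>\<^bsub>T\<^esub>"
    using assms mod_homD(1)[OF L\<beta>_hom assms(2)]
    unfolding F.M.minus_eq mod_homD(2)[OF L\<beta>_hom assms(1) F.M.a_inv_closed[OF assms(2)]]
      mod_hom_a_inv[OF F.module_axioms T L\<beta>_hom assms(2)]
    by (simp add: T.M.r_neg)
  moreover have "\<phi> \<ominus>\<^bsub>F\<^esub> \<psi> \<in> carrier F" by (rule F.M.minus_closed[OF assms(1,2)])
  ultimately show ?thesis by blast
qed

text \<open>Bilinearity says precisely that the linear extension kills the four families of
  relations. Its kernel is a submodule, so it also contains the submodule they generate.\<close>

lemma K_kernel: "\<phi> \<in> K \<Longrightarrow> L\<beta> \<phi> = \<zero>\<^bsub>T\<^esub>"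
proof -
  note h1 = mod_homD[OF \<beta>_hom(1)] and h2 = mod_homD[OF \<beta>_hom(2)]
  note Fh = mod_homD(2)[OF L\<beta>_hom e_closed e_closed] mod_homD(3)[OF L\<beta>_hom _ e_closed]
  let ?ker = "{\<phi> \<in> carrier F. L\<beta> \<phi> \<in> {\<zero>\<^bsub>T\<^esub>}}"
  have "tensor_rels R M N \<subseteq> ?ker"
    unfolding tensor_rels_def Let_def
  proof (intro Un_least subsetI)
    fix \<phi> assume "\<phi> \<in> {e (x \<oplus>\<^bsub>M\<^esub> x') y \<ominus>\<^bsub>F\<^esub> (e x y \<oplus>\<^bsub>F\<^esub> e x' y) | x x' y.
           x \<in> carrier M \<and> x' \<in> carrier M \<and> y \<in> carrier N}"
    then obtain x x' y where *: "\<phi> = e (x \<oplus>\<^bsub>M\<^esub> x') y \<ominus>\<^bsub>F\<^esub> (e x y \<oplus>\<^bsub>F\<^esub> e x' y)"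
      "x \<in> carrier M" "x' \<in> carrier M" "y \<in> carrier N" by blast
    show "\<phi> \<in> ?ker" unfolding *(1)
      by (intro L\<beta>_minus e_closed F.M.a_closed) (use * in \<open>simp only: Fh L\<beta>_e h1 M.M.a_closed\<close>)
  next
    fix \<phi> assume "\<phi> \<in> {e x (y \<oplus>\<^bsub>N\<^esub> y') \<ominus>\<^bsub>F\<^esub> (e x y \<oplus>\<^bsub>F\<^esub> e x y') | x y y'.
           x \<in> carrier M \<and> y \<in> carrier N \<and> y' \<in> carrier N}"
    then obtain x y y' where *: "\<phi> = e x (y \<oplus>\<^bsub>N\<^esub> y') \<ominus>\<^bsub>F\<^esub> (e x y \<oplus>\<^bsub>F\<^esub> e x y')"
      "x \<in> carrier M" "y \<in> carrier N" "y' \<in> carrier N" by blast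
    show "\<phi> \<in> ?ker" unfolding *(1)
      by (intro L\<beta>_minus e_closed F.M.a_closed) (use * in \<open>simp only: Fh L\<beta>_e h2 N.M.a_closed\<close>)
  next
    fix \<phi> assume "\<phi> \<in> {e (r \<odot>\<^bsub>M\<^esub> x) y \<ominus>\<^bsub>F\<^esub> (r \<odot>\<^bsub>F\<^esub> e x y) | r x y.
           r \<in> carrier R \<and> x \<in> carrier M \<and> y \<in> carrier N}"
    then obtain r x y where *: "\<phi> = e (r \<odot>\<^bsub>M\<^esub> x) y \<ominus>\<^bsub>F\<^esub> (r \<odot>\<^bsub>F\<^esub> e x y)"
      "r \<in> carrier R" "x \<in> carrier M" "y \<in> carrier N" by blast
    show "\<phi> \<in> ?ker" unfolding *(1)
      by (intro L\<beta>_minus e_closed F.smult_closed) (use * in \<open>simp_all only: Fh L\<beta>_e h1 M.smult_closed\<close>)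
  next
    fix \<phi> assume "\<phi> \<in> {e x (r \<odot>\<^bsub>N\<^esub> y) \<ominus>\<^bsub>F\<^esub> (r \<odot>\<^bsub>F\<^esub> e x y) | r x y.
           r \<in> carrier R \<and> x \<in> carrier M \<and> y \<in> carrier N}"
    then obtain r x y where *: "\<phi> = e x (r \<odot>\<^bsub>N\<^esub> y) \<ominus>\<^bsub>F\<^esub> (r \<odot>\<^bsub>F\<^esub> e x y)"
      "r \<in> carrier R" "x \<in> carrier M" "y \<in> carrier N" by blast
    show "\<phi> \<in> ?ker" unfolding *(1)
      by (intro L\<beta>_minus e_closed F.smult_closed) (use * in \<open>simp_all only: Fh L\<beta>_e h2 N.smult_closed\<close>)
  qed
  then have "K \<subseteq> ?ker"
    by (rule submodule_K(3)[OF submodule_vimage[OF F.module_axioms T L\<beta>_hom T.submodule_zero_set]])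
  then show "\<phi> \<in> K \<Longrightarrow> L\<beta> \<phi> = \<zero>\<^bsub>T\<^esub>" by blast
qed

lemma tensor_lift_coset:
  assumes "\<phi> \<in> carrier F"
  shows "tensor_lift R M N T \<beta> (K +>\<^bsub>F\<^esub> \<phi>) = L\<beta> \<phi>"
proof -
  interpret K: abelian_subgroup K F by (rule F.submodule_abelian_subgroup[OF submodule_K(1)])
  have "L\<beta> \<psi> = L\<beta> \<phi>" if \<psi>: "\<psi> \<in> K +>\<^bsub>F\<^esub> \<phi>" for \<psi>
  proof -
    obtain k where k: "k \<in> K" "\<psi> = k \<oplus>\<^bsub>F\<^esub> \<phi>" using \<psi> unfolding a_r_coset_def' by blast
    have kF: "k \<in> carrier F" using k(1) by (rule K.a_Hcarr)
    show ?thesis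
      unfolding k(2) mod_homD(2)[OF L\<beta>_hom kF assms] K_kernel[OF k(1)]
      using mod_homD(1)[OF L\<beta>_hom assms] by simp
  qed
  then have "L\<beta> ` (K +>\<^bsub>F\<^esub> \<phi>) = {L\<beta> \<phi>}" using K.a_rcos_self[OF assms] by blast
  then show ?thesis by (simp add: tensor_lift_def)
qed

lemma tensor_lift_hom: "tensor_lift R M N T \<beta> \<in> mod_hom R Ten T"
proof (rule mod_homI)
  note ph = mod_homD[OF proj_hom] and Lh = mod_homD[OF L\<beta>_hom]
  have ex: "\<exists>\<phi>\<in>carrier F. t = K +>\<^bsub>F\<^esub> \<phi>" if "t \<in> carrier Ten" for t
    using that unfolding tensor_mod_def fact_mod_carrier by blast
  show "tensor_lift R M N T \<beta> t \<in> carrier T" if "t \<in> carrier Ten" for t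
    using ex[OF that] tensor_lift_coset Lh(1) by auto
  fix t assume "t \<in> carrier Ten"
  then obtain \<phi> where \<phi>: "\<phi> \<in> carrier F" "t = K +>\<^bsub>F\<^esub> \<phi>" using ex by blast
  show "tensor_lift R M N T \<beta> (t \<oplus>\<^bsub>Ten\<^esub> t') = tensor_lift R M N T \<beta> t \<oplus>\<^bsub>T\<^esub> tensor_lift R M N T \<beta> t'"
    if t': "t' \<in> carrier Ten" for t'
  proof -
    obtain \<psi> where \<psi>: "\<psi> \<in> carrier F" "t' = K +>\<^bsub>F\<^esub> \<psi>" using ex[OF t'] by blast
    show ?thesis
      unfolding \<phi>(2) \<psi>(2) ph(2)[OF \<phi>(1) \<psi>(1), symmetric] tensor_lift_coset[OF \<phi>(1)]
        tensor_lift_coset[OF \<psi>(1)] tensor_lift_coset[OF F.M.a_closed[OF \<phi>(1) \<psi>(1)]]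
      by (rule Lh(2)[OF \<phi>(1) \<psi>(1)])
  qed
  show "tensor_lift R M N T \<beta> (a \<odot>\<^bsub>Ten\<^esub> t) = a \<odot>\<^bsub>T\<^esub> tensor_lift R M N T \<beta> t"
    if a: "a \<in> carrier R" for a
    unfolding \<phi>(2) ph(3)[OF a \<phi>(1), symmetric] tensor_lift_coset[OF \<phi>(1)]
      tensor_lift_coset[OF F.smult_closed[OF a \<phi>(1)]]
    by (rule Lh(3)[OF a \<phi>(1)])
qed

lemma tensor_lift_pure:
  assumes "x \<in> carrier M" "y \<in> carrier N"
  shows "tensor_lift R M N T \<beta> (pure x y) = \<beta> (x, y)"
  unfolding pure_tensor_def tensor_lift_coset[OF e_closed] by (rule L\<beta>_e[OF assms])

end

end

lemma tensor_map_hom: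
  assumes M: "module R M" and N: "module R N" and M': "module R M'" and N': "module R N'"
    and f: "f \<in> mod_hom R M M'" and g: "g \<in> mod_hom R N N'"
  shows "tensor_map R M N M' N' f g \<in> mod_hom R (tensor_mod R M N) (tensor_mod R M' N')"
    and "\<lbrakk>x \<in> carrier M; y \<in> carrier N\<rbrakk> \<Longrightarrow>
      tensor_map R M N M' N' f g (pure_tensor R M N x y) = pure_tensor R M' N' (f x) (g y)"
proof -
  interpret T: tensor_pair R M N using M N by (simp add: tensor_pair_def)
  interpret T': tensor_pair R M' N' using M' N' by (simp add: tensor_pair_def)
  have bil: "bilinear R M N T'.Ten (\<lambda>p. T'.pure (f (fst p)) (g (snd p)))"
    unfolding bilinear_def
    using mod_hom_comp[OF f T'.pure_hom(1)] mod_hom_comp[OF g T'.pure_hom(2)] mod_homD(1)[OF f] mod_homD(1)[OF g]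
    by simp
  show "tensor_map R M N M' N' f g \<in> mod_hom R (tensor_mod R M N) (tensor_mod R M' N')"
    unfolding tensor_map_eq_lift by (rule T.tensor_lift_hom[OF T'.Ten.module_axioms bil])
  show "tensor_map R M N M' N' f g (T.pure x y) = T'.pure (f x) (g y)"
    if "x \<in> carrier M" "y \<in> carrier N"
    unfolding tensor_map_eq_lift using T.tensor_lift_pure[OF T'.Ten.module_axioms bil that] by simp
qed

section \<open>Coordinates on the tensor product with a finite free module\<close>

definition tensor_coord ::
  "('a, 'r) ring_scheme \<Rightarrow> 'i set \<Rightarrow> ('a, 'c) module \<Rightarrow> 'i \<Rightarrow> (('i \<Rightarrow> 'a) \<times> 'c \<Rightarrow> 'a) set \<Rightarrow> 'c"
  where "tensor_coord R B N b = tensor_lift R (free_mod R B) N N (\<lambda>p. fst p b \<odot>\<^bsub>N\<^esub> snd p)"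

lemma tensor_coord_hom:
  assumes N: "module R N" and b: "b \<in> B"
  shows "tensor_coord R B N b \<in> mod_hom R (tensor_mod R (free_mod R B) N) N"
    and "\<lbrakk>f \<in> carrier (free_mod R B); y \<in> carrier N\<rbrakk> \<Longrightarrow>
      tensor_coord R B N b (pure_tensor R (free_mod R B) N f y) = f b \<odot>\<^bsub>N\<^esub> y"
proof -
  interpret N: module R N by fact
  interpret tensor_pair R "free_mod R B" N
    using N N.R.free_mod_module by (simp add: tensor_pair_def)
  have val: "f b \<in> carrier R" if "f \<in> carrier (free_mod R B)" for f
    using that b by (auto simp: free_mod_carrier_iff)
  have bil: "bilinear R (free_mod R B) N N (\<lambda>p. fst p b \<odot>\<^bsub>N\<^esub> snd p)"
    unfolding bilinear_def
  proof (intro conjI ballI)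
    show "(\<lambda>f. fst (f, y) b \<odot>\<^bsub>N\<^esub> snd (f, y)) \<in> mod_hom R (free_mod R B) N" if "y \<in> carrier N" for y
      by (rule mod_homI) (use that val b in \<open>simp_all add: N.smult_l_distr N.smult_assoc1\<close>)
    show "(\<lambda>y. fst (f, y) b \<odot>\<^bsub>N\<^esub> snd (f, y)) \<in> mod_hom R N N" if "f \<in> carrier (free_mod R B)" for f
      by (rule mod_homI)
        (use val[OF that] in \<open>simp_all add: N.smult_r_distr N.smult_assoc1[symmetric] N.R.m_comm\<close>)
  qed
  show "tensor_coord R B N b \<in> mod_hom R (tensor_mod R (free_mod R B) N) N"
    unfolding tensor_coord_def by (rule tensor_lift_hom[OF N bil])
  show "tensor_coord R B N b (pure f y) = f b \<odot>\<^bsub>N\<^esub> y"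
    if "f \<in> carrier (free_mod R B)" "y \<in> carrier N"
    unfolding tensor_coord_def using tensor_lift_pure[OF N bil that] by simp
qed

text \<open>Both sides are homomorphisms in \<open>t\<close> and agree on tensors of a basis element
  with any \<open>y\<close>; these generate, first by linearity in the free factor and then over all
  pure tensors. Tensoring with a finite free module thus amounts to taking tuples.\<close>

lemma tensor_coord_expand:
  fixes N :: "('a, 'c) module"
  assumes N: "module R N" and B: "finite B" and t: "t \<in> carrier (tensor_mod R (free_mod R B) N)"
  shows "t = (\<Oplus>\<^bsub>tensor_mod R (free_mod R B) N\<^esub>b\<in>B.
      pure_tensor R (free_mod R B) N (free_basis R B b) (tensor_coord R B N b t))"
proof -
  interpret N: module R N by fact
  interpret tensor_pair R "free_mod R B" N
    using N N.R.free_mod_module by (simp add: tensor_pair_def)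
  let ?e = "free_basis R B"
  let ?g = "\<lambda>t. \<Oplus>\<^bsub>Ten\<^esub>b\<in>B. pure (?e b) (tensor_coord R B N b t)"
  note eb = N.R.free_basis_closed[of B]
  have hom: "?g \<in> mod_hom R Ten Ten"
    by (rule finsum_mod_hom[OF Ten.module_axioms Ten.module_axioms B])
      (rule mod_hom_comp[OF tensor_coord_hom(1)[OF N] pure_hom(2)[OF eb]])
  let ?E = "{t \<in> carrier Ten. id t = ?g t}"
  have sub: "submodule ?E R Ten"
    by (rule mod_hom_eq_on_submodule[OF Ten.module_axioms Ten.module_axioms mod_hom_id hom])
  have basis: "pure (?e b) y \<in> ?E" if b: "b \<in> B" and y: "y \<in> carrier N" for b y
  proof -
    have coord: "tensor_coord R B N c (pure (?e b) y) = (if c = b then y else \<zero>\<^bsub>N\<^esub>)" if "c \<in> B" for c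
      using tensor_coord_hom(2)[OF N that eb y] y that by (simp add: free_basis_def)
    have "?g (pure (?e b) y) = (\<Oplus>\<^bsub>Ten\<^esub>c\<in>B. if b = c then pure (?e c) y else \<zero>\<^bsub>Ten\<^esub>)"
      by (rule Ten.M.finsum_cong')
        (use coord pure_closed mod_hom_zero[OF N Ten.module_axioms pure_hom(2)[OF eb]] in auto)
    also have "\<dots> = pure (?e b) y"
      by (rule Ten.M.finsum_singleton[OF b B]) (use pure_closed in auto)
    finally show ?thesis using pure_closed by simp
  qed
  have "carrier Ten \<subseteq> ?E"
  proof (rule tensor_generated[OF sub])
    fix f y assume f: "f \<in> carrier (free_mod R B)" and y: "y \<in> carrier N"
    have "carrier (free_mod R B) \<subseteq> {f \<in> carrier (free_mod R B). pure f y \<in> ?E}"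
      by (rule N.R.free_mod_generated[OF submodule_vimage[OF M.module_axioms Ten.module_axioms
              pure_hom(1)[OF y] sub]]) (use basis[OF _ y] eb in blast)
    then show "pure f y \<in> ?E" using f by blast
  qed
  then show ?thesis using t by auto
qed

lemma tensor_coord_inj:
  assumes N: "module R N" and B: "finite B"
    and t: "t \<in> carrier (tensor_mod R (free_mod R B) N)" "t' \<in> carrier (tensor_mod R (free_mod R B) N)"
    and eq: "\<And>b. b \<in> B \<Longrightarrow> tensor_coord R B N b t = tensor_coord R B N b t'"
  shows "t = t'"
proof -
  interpret N: module R N by fact
  interpret tensor_pair R "free_mod R B" N
    using N N.R.free_mod_module by (simp add: tensor_pair_def)
  have "(\<Oplus>\<^bsub>Ten\<^esub>b\<in>B. pure (free_basis R B b) (tensor_coord R B N b t)) =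
      (\<Oplus>\<^bsub>Ten\<^esub>b\<in>B. pure (free_basis R B b) (tensor_coord R B N b t'))"
    by (rule Ten.M.finsum_cong') (use eq pure_closed in auto)
  then show ?thesis
    using tensor_coord_expand[OF N B t(1)] tensor_coord_expand[OF N B t(2)] by simp
qed

lemma tensor_coord_surj:
  assumes N: "module R N" and B: "finite B" and g: "g \<in> B \<rightarrow> carrier N"
  shows "\<exists>t\<in>carrier (tensor_mod R (free_mod R B) N). \<forall>b\<in>B. tensor_coord R B N b t = g b"
proof -
  interpret N: module R N by fact
  interpret tensor_pair R "free_mod R B" N
    using N N.R.free_mod_module by (simp add: tensor_pair_def)
  let ?t = "\<Oplus>\<^bsub>Ten\<^esub>b\<in>B. pure (free_basis R B b) (g b)"
  have t: "?t \<in> carrier Ten" by (rule Ten.M.finsum_closed) (use pure_closed in auto)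
  have "tensor_coord R B N c ?t = g c" if c: "c \<in> B" for c
  proof -
    have "tensor_coord R B N c ?t = (\<Oplus>\<^bsub>N\<^esub>b\<in>B. tensor_coord R B N c (pure (free_basis R B b) (g b)))"
      by (rule mod_hom_finsum[OF Ten.module_axioms N tensor_coord_hom(1)[OF N c] B]) (use pure_closed in auto)
    also have "\<dots> = (\<Oplus>\<^bsub>N\<^esub>b\<in>B. if c = b then g b else \<zero>\<^bsub>N\<^esub>)"
    proof (rule N.M.finsum_cong')
      show "tensor_coord R B N c (pure (free_basis R B b) (g b)) = (if c = b then g b else \<zero>\<^bsub>N\<^esub>)"
        if b: "b \<in> B" for b
        using tensor_coord_hom(2)[OF N c N.R.free_basis_closed funcset_mem[OF g b], of b]
          funcset_mem[OF g b] c
        by (auto simp: free_basis_def)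
    qed (use g in auto)
    also have "\<dots> = g c" by (rule N.M.finsum_singleton[OF c B]) (use g in auto)
    finally show ?thesis .
  qed
  then show ?thesis using t by blast
qed

section \<open>Cones and isomorphisms of complexes\<close>

lemma (in module) a_inv_eq_zeroD: "\<lbrakk>x \<in> carrier M; \<ominus>\<^bsub>M\<^esub> x = \<zero>\<^bsub>M\<^esub>\<rbrakk> \<Longrightarrow> x = \<zero>\<^bsub>M\<^esub>"
  using M.r_neg[of x] by simp

text \<open>The degrees are variables here because the simplifier rewrites \<open>i - 1 - 1\<close> to \<open>i - 2\<close>.\<close>

lemma (in ring_complex) bd_closed_deg:
  "\<lbrakk>x \<in> carrier (obj X i); j = i - 1\<rbrakk> \<Longrightarrow> bd X i x \<in> carrier (obj X j)"
  using bd_closed by simp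

lemma (in ring_complex) bd_bd_deg:
  "\<lbrakk>x \<in> carrier (obj X i); j = i - 1\<rbrakk> \<Longrightarrow> bd X j (bd X i x) = \<zero>\<^bsub>obj X (i - 2)\<^esub>"
  using bd_bd[of x i] by simp

lemma ring_complexI:
  assumes "cring R" "\<And>i. module R (obj X i)" "\<And>i. bd X i \<in> mod_hom R (obj X i) (obj X (i - 1))"
    "\<And>i x. x \<in> carrier (obj X i) \<Longrightarrow> bd X (i - 1) (bd X i x) = \<zero>\<^bsub>obj X (i - 1 - 1)\<^esub>"
  shows "ring_complex R X"
  using assms by (simp add: ring_complex_def ring_complex_axioms_def)

text \<open>Only \<open>C\<close> is assumed to be a complex. \<open>T\<close> has modules and
  degree-lowering maps, and the laws of a complex are pulled back to it along the bijections
  \<open>\<Phi>\<close>; this is how the tensor complex is shown to be one.\<close>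

locale chain_iso = C: ring_complex R C
  for R :: "('a, 'r) ring_scheme" and C :: "('a, 'b) cx" +
  fixes T :: "('a, 'c) cx" and \<Phi> :: "int \<Rightarrow> 'c \<Rightarrow> 'b"
  assumes T_module: "module R (obj T i)"
    and \<Phi>_hom: "\<Phi> i \<in> mod_hom R (obj T i) (obj C i)"
    and \<Phi>_inj: "\<lbrakk>u \<in> carrier (obj T i); v \<in> carrier (obj T i); \<Phi> i u = \<Phi> i v\<rbrakk> \<Longrightarrow> u = v"
    and \<Phi>_surj: "c \<in> carrier (obj C i) \<Longrightarrow> \<exists>u\<in>carrier (obj T i). \<Phi> i u = c"
    and T_bd_closed: "u \<in> carrier (obj T i) \<Longrightarrow> bd T i u \<in> carrier (obj T (i - 1))"
    and \<Phi>_bd: "u \<in> carrier (obj T i) \<Longrightarrow> \<Phi> (i - 1) (bd T i u) = bd C i (\<Phi> i u)"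
begin

sublocale Tm: module R "obj T i" for i by (rule T_module)

lemma T_bd_closed_deg: "\<lbrakk>u \<in> carrier (obj T i); j = i - 1\<rbrakk> \<Longrightarrow> bd T i u \<in> carrier (obj T j)"
  using T_bd_closed by simp

lemma \<Phi>_bd_deg: "\<lbrakk>u \<in> carrier (obj T i); j = i - 1\<rbrakk> \<Longrightarrow> \<Phi> j (bd T i u) = bd C i (\<Phi> i u)"
  using \<Phi>_bd by simp

lemmas \<Phi>_simps = mod_homD[OF \<Phi>_hom]

lemma \<Phi>_zero: "\<Phi> i \<zero>\<^bsub>obj T i\<^esub> = \<zero>\<^bsub>obj C i\<^esub>"
  by (rule mod_hom_zero[OF T_module C.obj_module \<Phi>_hom])

lemma T_complex: "ring_complex R T"
proof (rule ring_complexI[OF C.is_cring T_module])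
  show "bd T i \<in> mod_hom R (obj T i) (obj T (i - 1))" for i
  proof (rule mod_homI[OF T_bd_closed])
    show "bd T i (u \<oplus>\<^bsub>obj T i\<^esub> v) = bd T i u \<oplus>\<^bsub>obj T (i - 1)\<^esub> bd T i v"
      if "u \<in> carrier (obj T i)" "v \<in> carrier (obj T i)" for u v
      by (rule \<Phi>_inj[of _ "i - 1"])
        (use that in \<open>simp_all add: T_bd_closed \<Phi>_bd \<Phi>_simps mod_homD(2)[OF C.bd_hom]\<close>)
    show "bd T i (a \<odot>\<^bsub>obj T i\<^esub> u) = a \<odot>\<^bsub>obj T (i - 1)\<^esub> bd T i u"
      if "a \<in> carrier R" "u \<in> carrier (obj T i)" for a u
      by (rule \<Phi>_inj[of _ "i - 1"])
        (use that in \<open>simp_all add: T_bd_closed \<Phi>_bd \<Phi>_simps mod_homD(3)[OF C.bd_hom]\<close>)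
  qed
  show "bd T (i - 1) (bd T i u) = \<zero>\<^bsub>obj T (i - 1 - 1)\<^esub>" if "u \<in> carrier (obj T i)" for i u
    by (rule \<Phi>_inj[of _ "i - 1 - 1"])
      (use that in \<open>simp_all add: T_bd_closed_deg \<Phi>_bd_deg \<Phi>_simps \<Phi>_zero C.bd_bd_deg\<close>)
qed

sublocale T: ring_complex R T by (rule T_complex)

lemma cycles_iso: "u \<in> carrier (obj T i) \<Longrightarrow> \<Phi> i u \<in> cycles C i \<longleftrightarrow> u \<in> cycles T i"
  using \<Phi>_bd[of u i] \<Phi>_inj[of "bd T i u" "i - 1" "\<zero>\<^bsub>obj T (i - 1)\<^esub>"] \<Phi>_zero[of "i - 1"] \<Phi>_simps(1)
  by (auto simp: C.cycles_iff T.cycles_iff T_bd_closed)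

lemma boundaries_iso:
  assumes u: "u \<in> carrier (obj T i)"
  shows "\<Phi> i u \<in> boundaries C i \<longleftrightarrow> u \<in> boundaries T i"
proof
  assume "\<Phi> i u \<in> boundaries C i"
  then obtain c where c: "c \<in> carrier (obj C (i + 1))" "\<Phi> i u = bd C (i + 1) c"
    unfolding boundaries_def by blast
  obtain v where v: "v \<in> carrier (obj T (i + 1))" "\<Phi> (i + 1) v = c" using \<Phi>_surj[OF c(1)] by blast
  have "u = bd T (i + 1) v"
    by (rule \<Phi>_inj[OF u]) (use T_bd_closed[OF v(1)] \<Phi>_bd[OF v(1)] v(2) c(2) in simp_all)
  then show "u \<in> boundaries T i" using v(1) unfolding boundaries_def by blast
next
  assume "u \<in> boundaries T i"
  then obtain v where v: "v \<in> carrier (obj T (i + 1))" "u = bd T (i + 1) v"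
    unfolding boundaries_def by blast
  then have "\<Phi> i u = bd C (i + 1) (\<Phi> (i + 1) v)" using \<Phi>_bd[OF v(1)] by simp
  then show "\<Phi> i u \<in> boundaries C i" using \<Phi>_simps(1)[OF v(1)] unfolding boundaries_def by blast
qed

lemma iso_bounded:
  assumes "cycles C i \<subseteq> boundaries C i"
  shows "cycles T i \<subseteq> boundaries T i"
proof
  fix u assume u: "u \<in> cycles T i"
  then have uc: "u \<in> carrier (obj T i)" by (simp add: T.cycles_iff)
  then show "u \<in> boundaries T i" using u cycles_iso boundaries_iso assms by blast
qed

text \<open>The extension lemma with a zero left-hand term: a cycle whose image is a boundary is
  itself a boundary.\<close>

lemma iso_noeth:
  assumes "noeth_between R (obj C i) (boundaries C i) (cycles C i)"
  shows "noeth_between R (obj T i) (boundaries T i) (cycles T i)"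
proof (rule noeth_between_extension[OF T_module T_module C.obj_module mod_hom_id \<Phi>_hom
      T.submodule_boundaries T.submodule_boundaries C.submodule_boundaries subset_refl _
      C.boundaries_le_cycles T.submodule_cycles _ C.submodule_cycles _ _ assms])
  have car: "z \<in> carrier (obj T i)" if "z \<in> cycles T i" for z using that by (simp add: T.cycles_iff)
  show "\<Phi> i z \<in> cycles C i" if "z \<in> cycles T i" for z using that cycles_iso[OF car[OF that]] by simp
  show "\<exists>a\<in>boundaries T i. \<exists>b\<in>boundaries T i. z = id a \<oplus>\<^bsub>obj T i\<^esub> b"
    if z: "z \<in> cycles T i" "\<Phi> i z \<in> boundaries C i" for z
  proof -
    have "z \<in> boundaries T i" using boundaries_iso[OF car[OF z(1)]] z(2) by simp
    moreover have "\<zero>\<^bsub>obj T i\<^esub> \<in> boundaries T i" by (rule Tm.submodule_zero[OF T.submodule_boundaries])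
    ultimately show ?thesis using car[OF z(1)] by force
  qed
qed (auto intro: noeth_between_refl)

lemma iso_torsion_iff:
  "cycles T i \<subseteq> saturation R q (obj T i) (boundaries T i) \<longleftrightarrow>
   cycles C i \<subseteq> saturation R q (obj C i) (boundaries C i)"
proof -
  have sat: "u \<in> saturation R q (obj T i) (boundaries T i) \<longleftrightarrow> \<Phi> i u \<in> saturation R q (obj C i) (boundaries C i)"
    if u: "u \<in> carrier (obj T i)" for u
  proof -
    have "\<Phi> i (s \<odot>\<^bsub>obj T i\<^esub> u) \<in> boundaries C i \<longleftrightarrow> s \<odot>\<^bsub>obj T i\<^esub> u \<in> boundaries T i" if "s \<in> carrier R" for s
      using boundaries_iso that u by simp
    then show ?thesis using u \<Phi>_simps(1,3) by (auto simp: saturation_def)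
  qed
  show ?thesis
  proof
    assume le: "cycles T i \<subseteq> saturation R q (obj T i) (boundaries T i)"
    show "cycles C i \<subseteq> saturation R q (obj C i) (boundaries C i)"
    proof
      fix c assume c: "c \<in> cycles C i"
      then obtain u where u: "u \<in> carrier (obj T i)" "\<Phi> i u = c" using \<Phi>_surj by (auto simp: C.cycles_iff)
      then have "u \<in> cycles T i" using c cycles_iso by blast
      then show "c \<in> saturation R q (obj C i) (boundaries C i)" using sat[OF u(1)] u(2) le by blast
    qed
  next
    assume le: "cycles C i \<subseteq> saturation R q (obj C i) (boundaries C i)"
    show "cycles T i \<subseteq> saturation R q (obj T i) (boundaries T i)"
    proof
      fix u assume u: "u \<in> cycles T i"
      then have uc: "u \<in> carrier (obj T i)" by (simp add: T.cycles_iff)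
      then show "u \<in> saturation R q (obj T i) (boundaries T i)" using u cycles_iso sat le by blast
    qed
  qed
qed

end

text \<open>\<open>C\<close> is the cone of multiplication by \<open>x\<close> on \<open>Z\<close>, with the projections \<open>p0\<close> and
  \<open>p1\<close> to the two summands of its underlying graded module.\<close>

locale mult_cone = Z: ring_complex R Z
  for R :: "('a, 'r) ring_scheme" (structure) and Z :: "('a, 'b) cx" +
  fixes C :: "('a, 'c) cx" and x :: 'a and p0 p1 :: "int \<Rightarrow> 'c \<Rightarrow> 'b"
  assumes x: "x \<in> carrier R"
    and C_module: "module R (obj C i)"
    and p0_hom: "p0 i \<in> mod_hom R (obj C i) (obj Z i)"
    and p1_hom: "p1 i \<in> mod_hom R (obj C i) (obj Z (i - 1))"
    and p_inj: "\<lbrakk>f \<in> carrier (obj C i); g \<in> carrier (obj C i); p0 i f = p0 i g; p1 i f = p1 i g\<rbrakk> \<Longrightarrow> f = g"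
    and p_surj: "\<lbrakk>a \<in> carrier (obj Z i); b \<in> carrier (obj Z (i - 1))\<rbrakk> \<Longrightarrow>
      \<exists>f\<in>carrier (obj C i). p0 i f = a \<and> p1 i f = b"
    and C_bd_closed: "f \<in> carrier (obj C i) \<Longrightarrow> bd C i f \<in> carrier (obj C (i - 1))"
    and p0_bd: "f \<in> carrier (obj C i) \<Longrightarrow>
      p0 (i - 1) (bd C i f) = bd Z i (p0 i f) \<oplus>\<^bsub>obj Z (i - 1)\<^esub> x \<odot>\<^bsub>obj Z (i - 1)\<^esub> p1 i f"
    and p1_bd: "f \<in> carrier (obj C i) \<Longrightarrow>
      p1 (i - 1) (bd C i f) = (\<ominus> \<one>) \<odot>\<^bsub>obj Z (i - 1 - 1)\<^esub> bd Z (i - 1) (p1 i f)"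
begin

sublocale Cm: module R "obj C i" for i by (rule C_module)

lemmas p0 = mod_homD[OF p0_hom]
lemmas p1 = mod_homD[OF p1_hom]
lemmas dZ = mod_homD[OF Z.bd_hom]

lemma C_bd_closed_deg: "\<lbrakk>f \<in> carrier (obj C i); j = i - 1\<rbrakk> \<Longrightarrow> bd C i f \<in> carrier (obj C j)"
  using C_bd_closed by simp

lemma p1_closed_deg: "\<lbrakk>f \<in> carrier (obj C i); j = i - 1\<rbrakk> \<Longrightarrow> p1 i f \<in> carrier (obj Z j)"
  using p1(1) by simp

lemma p0_bd_deg: "\<lbrakk>f \<in> carrier (obj C i); j = i - 1\<rbrakk> \<Longrightarrow>
    p0 j (bd C i f) = bd Z i (p0 i f) \<oplus>\<^bsub>obj Z (i - 1)\<^esub> x \<odot>\<^bsub>obj Z (i - 1)\<^esub> p1 i f"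
  using p0_bd by simp

lemma p1_bd_deg: "\<lbrakk>f \<in> carrier (obj C i); j = i - 1\<rbrakk> \<Longrightarrow>
    p1 j (bd C i f) = (\<ominus> \<one>) \<odot>\<^bsub>obj Z (i - 2)\<^esub> bd Z (i - 1) (p1 i f)"
  using p1_bd[of f i] by simp

lemmas deg_simps = C_bd_closed_deg p1_closed_deg p0_bd_deg p1_bd_deg Z.bd_closed_deg Z.bd_bd_deg

lemma p0_zero: "p0 i \<zero>\<^bsub>obj C i\<^esub> = \<zero>\<^bsub>obj Z i\<^esub>"
  by (rule mod_hom_zero[OF C_module Z.obj_module p0_hom])

lemma p1_zero: "p1 i \<zero>\<^bsub>obj C i\<^esub> = \<zero>\<^bsub>obj Z (i - 1)\<^esub>"
  by (rule mod_hom_zero[OF C_module Z.obj_module p1_hom])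

lemma dZ_zero: "bd Z i \<zero>\<^bsub>obj Z i\<^esub> = \<zero>\<^bsub>obj Z (i - 1)\<^esub>"
  by (rule mod_hom_zero[OF Z.obj_module Z.obj_module Z.bd_hom])

lemma C_complex: "ring_complex R C"
proof (rule ring_complexI[OF Z.is_cring C_module])
  show "bd C i \<in> mod_hom R (obj C i) (obj C (i - 1))" for i
  proof (rule mod_homI[OF C_bd_closed])
    fix u v assume u: "u \<in> carrier (obj C i)" and v: "v \<in> carrier (obj C i)"
    show "bd C i (u \<oplus>\<^bsub>obj C i\<^esub> v) = bd C i u \<oplus>\<^bsub>obj C (i - 1)\<^esub> bd C i v"
    proof (rule p_inj[of _ "i - 1"])
      show "p0 (i - 1) (bd C i (u \<oplus>\<^bsub>obj C i\<^esub> v)) = p0 (i - 1) (bd C i u \<oplus>\<^bsub>obj C (i - 1)\<^esub> bd C i v)"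
        using u v by (simp add: p0 p1 dZ deg_simps Z.obj.smult_r_distr x Z.obj.M.a_ac)
      show "p1 (i - 1) (bd C i (u \<oplus>\<^bsub>obj C i\<^esub> v)) = p1 (i - 1) (bd C i u \<oplus>\<^bsub>obj C (i - 1)\<^esub> bd C i v)"
        using u v by (simp add: p1 dZ deg_simps Z.obj.smult_r_distr)
    qed (use u v C_bd_closed in auto)
  next
    fix a u assume a: "a \<in> carrier R" and u: "u \<in> carrier (obj C i)"
    show "bd C i (a \<odot>\<^bsub>obj C i\<^esub> u) = a \<odot>\<^bsub>obj C (i - 1)\<^esub> bd C i u"
    proof (rule p_inj[of _ "i - 1"])
      show "p0 (i - 1) (bd C i (a \<odot>\<^bsub>obj C i\<^esub> u)) = p0 (i - 1) (a \<odot>\<^bsub>obj C (i - 1)\<^esub> bd C i u)"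
        using a u by (simp add: p0 p1 dZ deg_simps Z.obj.smult_r_distr x
            Z.obj.smult_assoc1[symmetric] Z.m_comm)
      show "p1 (i - 1) (bd C i (a \<odot>\<^bsub>obj C i\<^esub> u)) = p1 (i - 1) (a \<odot>\<^bsub>obj C (i - 1)\<^esub> bd C i u)"
        using a u by (simp add: p1 dZ deg_simps Z.obj.smult_assoc1[symmetric] Z.m_comm)
    qed (use a u C_bd_closed in auto)
  qed
  fix i u assume u: "u \<in> carrier (obj C i)"
  have b: "bd Z (i - 1) (p1 i u) \<in> carrier (obj Z (i - 1 - 1))" by (rule Z.bd_closed[OF p1(1)[OF u]])
  \<comment> \<open>The two mixed terms in the square of the differential cancel because of the sign
    in \<open>p1_bd\<close>.\<close>
  have "x \<odot>\<^bsub>obj Z (i - 1 - 1)\<^esub> bd Z (i - 1) (p1 i u) \<oplus>\<^bsub>obj Z (i - 1 - 1)\<^esub>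
      x \<odot>\<^bsub>obj Z (i - 1 - 1)\<^esub> ((\<ominus> \<one>) \<odot>\<^bsub>obj Z (i - 1 - 1)\<^esub> bd Z (i - 1) (p1 i u)) = \<zero>\<^bsub>obj Z (i - 1 - 1)\<^esub>"
    using b x by (simp add: Z.obj.minus_eq_smult[symmetric] Z.obj.smult_r_minus Z.obj.M.r_neg)
  then have "p0 (i - 1 - 1) (bd C (i - 1) (bd C i u)) = \<zero>\<^bsub>obj Z (i - 1 - 1)\<^esub>"
    using u x by (simp add: deg_simps p0 p1 dZ)
  moreover have "p1 (i - 1 - 1) (bd C (i - 1) (bd C i u)) = \<zero>\<^bsub>obj Z (i - 1 - 1 - 1)\<^esub>"
    using u by (simp add: deg_simps p1 dZ)
  ultimately show "bd C (i - 1) (bd C i u) = \<zero>\<^bsub>obj C (i - 1 - 1)\<^esub>"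
    using u by (intro p_inj[of _ "i - 1 - 1"]) (simp_all add: deg_simps p0_zero p1_zero)
qed

sublocale C: ring_complex R C by (rule C_complex)

text \<open>The embedding of \<open>Z\<close> as the first summand. The choice is unique, because an
  element of the cone is determined by its two projections.\<close>

definition incl :: "int \<Rightarrow> 'b \<Rightarrow> 'c"
  where "incl i a = (SOME f. f \<in> carrier (obj C i) \<and> p0 i f = a \<and> p1 i f = \<zero>\<^bsub>obj Z (i - 1)\<^esub>)"

lemma incl:
  assumes "a \<in> carrier (obj Z i)"
  shows "incl i a \<in> carrier (obj C i)" "p0 i (incl i a) = a" "p1 i (incl i a) = \<zero>\<^bsub>obj Z (i - 1)\<^esub>"
proof -
  have "\<exists>f. f \<in> carrier (obj C i) \<and> p0 i f = a \<and> p1 i f = \<zero>\<^bsub>obj Z (i - 1)\<^esub>"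
    using p_surj[OF assms Z.obj.M.zero_closed] by blast
  from someI_ex[OF this]
  show "incl i a \<in> carrier (obj C i)" "p0 i (incl i a) = a" "p1 i (incl i a) = \<zero>\<^bsub>obj Z (i - 1)\<^esub>"
    unfolding incl_def by simp_all
qed

lemma incl_hom: "incl i \<in> mod_hom R (obj Z i) (obj C i)"
proof (rule mod_homI[OF incl(1)])
  show "incl i (a \<oplus>\<^bsub>obj Z i\<^esub> b) = incl i a \<oplus>\<^bsub>obj C i\<^esub> incl i b"
    if "a \<in> carrier (obj Z i)" "b \<in> carrier (obj Z i)" for a b
    by (rule p_inj[of _ i]) (use that in \<open>simp_all add: incl p0 p1\<close>)
  show "incl i (r \<odot>\<^bsub>obj Z i\<^esub> a) = r \<odot>\<^bsub>obj C i\<^esub> incl i a"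
    if "r \<in> carrier R" "a \<in> carrier (obj Z i)" for r a
    by (rule p_inj[of _ i]) (use that in \<open>simp_all add: incl p0 p1\<close>)
qed

lemma bd_incl:
  assumes a: "a \<in> carrier (obj Z i)"
  shows "bd C i (incl i a) = incl (i - 1) (bd Z i a)"
  by (rule p_inj[of _ "i - 1"])
    (use a dZ_zero[of "i - 1"] in \<open>simp_all add: incl deg_simps x\<close>)

lemma incl_cycles:
  assumes "z \<in> cycles Z i"
  shows "incl i z \<in> cycles C i"
proof -
  have "incl (i - 1) \<zero>\<^bsub>obj Z (i - 1)\<^esub> = \<zero>\<^bsub>obj C (i - 1)\<^esub>"
    by (rule mod_hom_zero[OF Z.obj_module C_module incl_hom])
  then show ?thesis using assms by (simp add: C.cycles_iff Z.cycles_iff incl bd_incl)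
qed

lemma incl_boundaries:
  assumes "z \<in> boundaries Z i"
  shows "incl i z \<in> boundaries C i"
proof -
  obtain w where "w \<in> carrier (obj Z (i + 1))" "z = bd Z (i + 1) w" using assms unfolding boundaries_def by blast
  then have "incl i z = bd C (i + 1) (incl (i + 1) w)" "incl (i + 1) w \<in> carrier (obj C (i + 1))"
    using bd_incl[of w "i + 1"] incl(1)[of w "i + 1"] by simp_all
  then show ?thesis unfolding boundaries_def by blast
qed

lemma p1_cycles:
  assumes "z \<in> cycles C i"
  shows "p1 i z \<in> cycles Z (i - 1)"
proof -
  have z: "z \<in> carrier (obj C i)" "bd C i z = \<zero>\<^bsub>obj C (i - 1)\<^esub>" using assms by (simp_all add: C.cycles_iff)
  have b: "bd Z (i - 1) (p1 i z) \<in> carrier (obj Z (i - 1 - 1))" by (rule Z.bd_closed[OF p1(1)[OF z(1)]])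
  have "\<ominus>\<^bsub>obj Z (i - 1 - 1)\<^esub> bd Z (i - 1) (p1 i z) = \<zero>\<^bsub>obj Z (i - 1 - 1)\<^esub>"
    using p1_bd[OF z(1)] unfolding z(2) p1_zero Z.obj.minus_eq_smult[OF b] by (rule sym)
  then have "bd Z (i - 1) (p1 i z) = \<zero>\<^bsub>obj Z (i - 1 - 1)\<^esub>"
    by (rule Z.obj.a_inv_eq_zeroD[OF b])
  then show ?thesis using p1(1)[OF z(1)] by (simp add: Z.cycles_iff)
qed

text \<open>Exactness of \<open>H\<^sub>i(Z) \<rightarrow> H\<^sub>i(C) \<rightarrow> H\<^sub>i\<^sub>-\<^sub>1(Z)\<close>.\<close>

lemma cone_exact:
  assumes z: "z \<in> cycles C i" and b: "p1 i z \<in> boundaries Z (i - 1)"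
  shows "\<exists>a\<in>cycles Z i. \<exists>b\<in>boundaries C i. z = incl i a \<oplus>\<^bsub>obj C i\<^esub> b"
proof -
  have zc: "z \<in> carrier (obj C i)" "bd C i z = \<zero>\<^bsub>obj C (i - 1)\<^esub>" using z by (simp_all add: C.cycles_iff)
  obtain h where h: "h \<in> carrier (obj Z i)" "p1 i z = bd Z i h" using b unfolding boundaries_def by auto
  \<comment> \<open>By the sign in \<open>p1_bd\<close>, the differential of \<open>g\<close> has
    second component \<open>- p1 i z\<close>. Adding it to \<open>z\<close> clears the second
    component, and an element with zero second component comes from \<open>Z\<close>.\<close>
  obtain g where g: "g \<in> carrier (obj C (i + 1))" "p0 (i + 1) g = \<zero>\<^bsub>obj Z (i + 1)\<^esub>" "p1 (i + 1) g = h"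
    using p_surj[of "\<zero>\<^bsub>obj Z (i + 1)\<^esub>" "i + 1" h] h(1) by auto
  have bg: "bd C (i + 1) g \<in> carrier (obj C i)" using C_bd_closed[OF g(1)] by simp
  have p1bg: "p1 i (bd C (i + 1) g) = \<ominus>\<^bsub>obj Z (i - 1)\<^esub> p1 i z"
    using p1_bd[OF g(1)] g(3) h Z.bd_closed[OF h(1)] by (simp add: Z.obj.minus_eq_smult)
  define y where "y = z \<oplus>\<^bsub>obj C i\<^esub> bd C (i + 1) g"
  have y: "y \<in> carrier (obj C i)" using zc bg by (simp add: y_def)
  have bgB: "bd C (i + 1) g \<in> boundaries C i" using g(1) unfolding boundaries_def by blast
  have yc: "y \<in> cycles C i"
    unfolding y_def using z bgB C.boundaries_le_cycles by (intro Cm.submoduleE(5)[OF C.submodule_cycles]) auto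
  have p1y: "p1 i y = \<zero>\<^bsub>obj Z (i - 1)\<^esub>"
    using zc bg p1bg p1(1)[OF zc(1)] by (simp add: y_def p1 Z.obj.M.r_neg)
  have yi: "y = incl i (p0 i y)"
    by (rule p_inj[of _ i]) (use y p1y p0(1)[OF y] in \<open>simp_all add: incl\<close>)
  have "p0 (i - 1) (bd C i y) = bd Z i (p0 i y)"
    using p0_bd[OF y] p1y x Z.bd_closed[OF p0(1)[OF y]] by simp
  then have "bd Z i (p0 i y) = \<zero>\<^bsub>obj Z (i - 1)\<^esub>" using yc by (simp add: C.cycles_iff p0_zero)
  then have "p0 i y \<in> cycles Z i" using p0(1)[OF y] by (simp add: Z.cycles_iff)
  moreover have "\<ominus>\<^bsub>obj C i\<^esub> bd C (i + 1) g \<in> boundaries C i"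
    using Cm.submoduleE(3)[OF C.submodule_boundaries bgB] .
  moreover have "z = incl i (p0 i y) \<oplus>\<^bsub>obj C i\<^esub> (\<ominus>\<^bsub>obj C i\<^esub> bd C (i + 1) g)"
    unfolding yi[symmetric] using zc bg by (simp add: y_def Cm.M.a_assoc Cm.M.r_neg)
  ultimately show ?thesis by blast
qed

lemma cone_noeth:
  assumes "\<And>i. noeth_between R (obj Z i) (boundaries Z i) (cycles Z i)"
  shows "noeth_between R (obj C i) (boundaries C i) (cycles C i)"
  by (rule noeth_between_extension[OF Z.obj_module C_module Z.obj_module incl_hom p1_hom
        Z.submodule_cycles C.submodule_boundaries Z.submodule_boundaries Z.boundaries_le_cycles incl_boundaries
        Z.boundaries_le_cycles C.submodule_cycles p1_cycles Z.submodule_cycles cone_exact assms assms])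

lemma cone_bounded:
  assumes "\<And>i. i < lo \<Longrightarrow> cycles Z i \<subseteq> boundaries Z i" "i < lo"
  shows "cycles C i \<subseteq> boundaries C i"
proof
  fix z assume z: "z \<in> cycles C i"
  \<comment> \<open>The second component lives in degree \<open>i - 1\<close>, which is still below
    \<open>lo\<close>; so the lower bound is not weakened by passing to the cone.\<close>
  have "p1 i z \<in> boundaries Z (i - 1)" using assms(1)[of "i - 1"] assms(2) p1_cycles[OF z] by auto
  then obtain a b where ab: "a \<in> cycles Z i" "b \<in> boundaries C i" "z = incl i a \<oplus>\<^bsub>obj C i\<^esub> b"
    using cone_exact[OF z] by blast
  then have "incl i a \<in> boundaries C i" using assms incl_boundaries by blast
  then show "z \<in> boundaries C i" unfolding ab(3) using ab(2) by (rule Cm.submoduleE(5)[OF C.submodule_boundaries])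
qed

text \<open>By exactness of \<open>H_i(Z) \<rightarrow> H_i(Z) \<rightarrow> H_i(C)\<close>, with
  multiplication by \<open>x\<close> on the left, vanishing of the right term at \<open>q\<close>
  makes this multiplication surjective at \<open>q\<close>, and Nakayama's lemma applies.
  Elementwise, if \<open>f\<close> bounds \<open>s\<close> times the inclusion of \<open>z\<close>,
  its first component gives \<open>s z = x w + b\<close>, where \<open>w\<close> is the second
  component of \<open>f\<close>, a cycle.\<close>

lemma cone_torsion:
  assumes q: "primeideal q R" "x \<in> q"
    and noeth: "noeth_between R (obj Z i) (boundaries Z i) (cycles Z i)"
    and tors: "cycles C i \<subseteq> saturation R q (obj C i) (boundaries C i)"
  shows "cycles Z i \<subseteq> saturation R q (obj Z i) (boundaries Z i)"
proof (rule Z.obj.nakayama[OF q Z.submodule_boundaries Z.boundaries_le_cycles Z.submodule_cycles noeth])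
  fix z assume z: "z \<in> cycles Z i"
  then have zc: "z \<in> carrier (obj Z i)" by (simp add: Z.cycles_iff)
  obtain s where s: "s \<in> carrier R - q" "s \<odot>\<^bsub>obj C i\<^esub> incl i z \<in> boundaries C i"
    using tors incl_cycles[OF z] unfolding saturation_def by blast
  then obtain f where f: "f \<in> carrier (obj C (i + 1))" "s \<odot>\<^bsub>obj C i\<^esub> incl i z = bd C (i + 1) f"
    unfolding boundaries_def by blast
  have pf: "p0 (i + 1) f \<in> carrier (obj Z (i + 1))" "p1 (i + 1) f \<in> carrier (obj Z i)"
    using p0(1)[OF f(1)] p1(1)[OF f(1)] by simp_all
  have sR: "s \<in> carrier R" using s by simp
  have "s \<odot>\<^bsub>obj Z i\<^esub> z = p0 i (bd C (i + 1) f)"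
    unfolding f(2)[symmetric] using sR zc by (simp add: p0 incl)
  also have "\<dots> = bd Z (i + 1) (p0 (i + 1) f) \<oplus>\<^bsub>obj Z i\<^esub> x \<odot>\<^bsub>obj Z i\<^esub> p1 (i + 1) f"
    using p0_bd[OF f(1)] by simp
  also have "\<dots> = x \<odot>\<^bsub>obj Z i\<^esub> p1 (i + 1) f \<oplus>\<^bsub>obj Z i\<^esub> bd Z (i + 1) (p0 (i + 1) f)"
    using pf x Z.bd_closed[OF pf(1)] by (simp add: Z.obj.M.a_comm)
  finally have eq: "s \<odot>\<^bsub>obj Z i\<^esub> z = \<dots>" .
  have dz: "bd Z i (p1 (i + 1) f) \<in> carrier (obj Z (i - 1))" by (rule Z.bd_closed[OF pf(2)])
  have "p1 i (s \<odot>\<^bsub>obj C i\<^esub> incl i z) = \<zero>\<^bsub>obj Z (i - 1)\<^esub>" using sR zc by (simp add: p1 incl)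
  then have "\<ominus>\<^bsub>obj Z (i - 1)\<^esub> bd Z i (p1 (i + 1) f) = \<zero>\<^bsub>obj Z (i - 1)\<^esub>"
    using p1_bd[OF f(1)] f(2) dz by (simp add: Z.obj.minus_eq_smult)
  then have "bd Z i (p1 (i + 1) f) = \<zero>\<^bsub>obj Z (i - 1)\<^esub>"
    by (rule Z.obj.a_inv_eq_zeroD[OF dz])
  then have "p1 (i + 1) f \<in> cycles Z i" using pf(2) by (simp add: Z.cycles_iff)
  moreover have "bd Z (i + 1) (p0 (i + 1) f) \<in> boundaries Z i" using pf(1) unfolding boundaries_def by blast
  ultimately show "\<exists>s\<in>carrier R - q. \<exists>w\<in>cycles Z i. \<exists>b\<in>boundaries Z i.
      s \<odot>\<^bsub>obj Z i\<^esub> z = x \<odot>\<^bsub>obj Z i\<^esub> w \<oplus>\<^bsub>obj Z i\<^esub> b"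
    using s(1) eq by blast
qed

end

section \<open>Koszul complexes with coefficients\<close>

lemma (in cring) alt_sign_closed [simp]: "alt_sign R i \<in> carrier R"
  by (simp add: alt_sign_def)

lemma (in cring) alt_sign_square: "alt_sign R i \<otimes> alt_sign R i = \<one>"
  by (simp add: alt_sign_def l_minus r_minus)

lemma (in cring) alt_sign_Suc: "alt_sign R (i + 1) = \<ominus> alt_sign R i"
  by (simp add: alt_sign_def)

lemma mod_hom_into_dsum:
  assumes "finite I" "\<And>i. i \<in> I \<Longrightarrow> h i \<in> mod_hom R M (N i)"
  shows "(\<lambda>x. \<lambda>i\<in>I. h i x) \<in> mod_hom R M (dsum I N)"
  by (rule mod_homI)
    (use mod_homD[OF assms(2)] assms(1) in \<open>auto simp: dsum_finite_carrier_iff\<close>)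

text \<open>The complex \<open>K(x\<^sub>0, \<dots>, x\<^bsub>n-1\<^esub>) \<otimes> X\<close> in coordinates: an element of degree \<open>k\<close> has, for every
  subset \<open>T\<close> of \<open>{..<n}\<close>, a component of degree \<open>k - card T\<close> in \<open>X\<close>.\<close>

definition koszul_model ::
  "('a, 'r) ring_scheme \<Rightarrow> (nat \<Rightarrow> 'a) \<Rightarrow> nat \<Rightarrow> ('a, 'b) cx \<Rightarrow> ('a, nat set \<Rightarrow> 'b) cx"
  where "koszul_model R x n X =
    \<lparr>obj = (\<lambda>k. dsum (Pow {..<n}) (\<lambda>T. obj X (k - int (card T)))),
     bd = (\<lambda>k f. \<lambda>T\<in>Pow {..<n}.
       (\<Oplus>\<^bsub>obj X (k - 1 - int (card T))\<^esub> j \<in> {..<n} - T.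
          (alt_sign R (int (card {i \<in> T. i < j})) \<otimes>\<^bsub>R\<^esub> x j) \<odot>\<^bsub>obj X (k - 1 - int (card T))\<^esub> f (insert j T))
       \<oplus>\<^bsub>obj X (k - 1 - int (card T))\<^esub>
       alt_sign R (int (card T)) \<odot>\<^bsub>obj X (k - 1 - int (card T))\<^esub> bd X (k - int (card T)) (f T))\<rparr>"

lemma card_insert_int: "\<lbrakk>T \<subseteq> {..<n::nat}; j \<notin> T\<rbrakk> \<Longrightarrow> int (card (insert j T)) = int (card T) + 1"
  using finite_subset[OF _ finite_lessThan, of T n] by simp

context ring_complex
begin

lemma model_carrier_iff:
  "f \<in> carrier (obj (koszul_model R x n X) k) \<longleftrightarrow>
     f \<in> (\<Pi>\<^sub>E T\<in>Pow {..<n}. carrier (obj X (k - int (card T))))"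
  by (simp add: koszul_model_def dsum_finite_carrier_iff)

lemma model_module: "module R (obj (koszul_model R x n X) k)"
  by (simp add: koszul_model_def dsum_module[OF is_cring obj_module])

lemma model_component:
  "\<lbrakk>f \<in> carrier (obj (koszul_model R x n X) k); T \<subseteq> {..<n}; int (card T) = c\<rbrakk> \<Longrightarrow> f T \<in> carrier (obj X (k - c))"
  by (auto simp: model_carrier_iff)

lemma model_component_insert:
  assumes "f \<in> carrier (obj (koszul_model R x n X) k)" "T \<subseteq> {..<n}" "j < n" "j \<notin> T"
  shows "f (insert j T) \<in> carrier (obj X (k - 1 - int (card T)))"
proof -
  have "k - (int (card T) + 1) = k - 1 - int (card T)" by simp
  moreover have "f (insert j T) \<in> carrier (obj X (k - (int (card T) + 1)))"
    by (rule model_component[OF assms(1) _ card_insert_int[OF assms(2,4)]]) (use assms(2,3) in simp)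
  ultimately show ?thesis by (simp only:)
qed

lemma model_bd:
  "T \<subseteq> {..<n} \<Longrightarrow> bd (koszul_model R x n X) k f T =
     (\<Oplus>\<^bsub>obj X (k - 1 - int (card T))\<^esub> j \<in> {..<n} - T.
          (alt_sign R (int (card {i \<in> T. i < j})) \<otimes> x j) \<odot>\<^bsub>obj X (k - 1 - int (card T))\<^esub> f (insert j T))
       \<oplus>\<^bsub>obj X (k - 1 - int (card T))\<^esub>
       alt_sign R (int (card T)) \<odot>\<^bsub>obj X (k - 1 - int (card T))\<^esub> bd X (k - int (card T)) (f T)"
  by (simp add: koszul_model_def)

lemma model_bd_X:
  assumes "f \<in> carrier (obj (koszul_model R x n X) k)" "T \<subseteq> {..<n}"
  shows "bd X (k - int (card T)) (f T) \<in> carrier (obj X (k - 1 - int (card T)))"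
  by (rule bd_closed_deg[OF model_component[OF assms refl]]) simp

lemma model_terms:
  assumes "f \<in> carrier (obj (koszul_model R x n X) k)" "T \<subseteq> {..<n}" "\<And>j. j < n \<Longrightarrow> x j \<in> carrier R"
  shows "(\<lambda>j. (alt_sign R (int (card {i \<in> T. i < j})) \<otimes> x j) \<odot>\<^bsub>obj X (k - 1 - int (card T))\<^esub> f (insert j T))
    \<in> {..<n} - T \<rightarrow> carrier (obj X (k - 1 - int (card T)))"
  using model_component_insert[OF assms(1,2)] assms(3) by auto

lemma model_bd_closed:
  assumes "f \<in> carrier (obj (koszul_model R x n X) k)" "\<And>j. j < n \<Longrightarrow> x j \<in> carrier R"
  shows "bd (koszul_model R x n X) k f \<in> carrier (obj (koszul_model R x n X) (k - 1))"
  unfolding model_carrier_iff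
proof (rule PiE_I)
  show "bd (koszul_model R x n X) k f T \<in> carrier (obj X (k - 1 - int (card T)))" if "T \<in> Pow {..<n}" for T
    using model_bd_X[OF assms(1)] obj.M.finsum_closed[OF model_terms[OF assms(1) _ assms(2)]] that
    by (simp add: model_bd)
qed (simp add: koszul_model_def)

lemma model_zero_iso: "chain_iso R X (koszul_model R x 0 X) (\<lambda>k f. f {})"
proof (intro chain_iso.intro chain_iso_axioms.intro)
  show "ring_complex R X" by (rule ring_complex_axioms)
  fix k
  have mb: "bd (koszul_model R x 0 X) k f {} = bd X k (f {})"
    if "f \<in> carrier (obj (koszul_model R x 0 X) k)" for f
  proof -
    have "bd X k (f {}) \<in> carrier (obj X (k - 1))"
      using bd_closed[OF model_component[OF that, of "{}" 0]] by simp
    then show ?thesis by (simp add: model_bd alt_sign_def)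
  qed
  show "module R (obj (koszul_model R x 0 X) k)" by (rule model_module)
  show "(\<lambda>f. f {}) \<in> mod_hom R (obj (koszul_model R x 0 X) k) (obj X k)"
    using dsum_component_hom[of "{}" "Pow {..<0::nat}" R "\<lambda>T. obj X (k - int (card T))"]
    by (simp add: koszul_model_def)
  show "f = g" if "f \<in> carrier (obj (koszul_model R x 0 X) k)" "g \<in> carrier (obj (koszul_model R x 0 X) k)"
    "f {} = g {}" for f g
    using that unfolding model_carrier_iff by (intro PiE_ext) auto
  show "\<exists>f\<in>carrier (obj (koszul_model R x 0 X) k). f {} = c" if "c \<in> carrier (obj X k)" for c
    by (rule bexI[of _ "\<lambda>T\<in>{{}}. c"]) (use that in \<open>auto simp: model_carrier_iff\<close>)
  show "bd (koszul_model R x 0 X) k f \<in> carrier (obj (koszul_model R x 0 X) (k - 1))"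
    if "f \<in> carrier (obj (koszul_model R x 0 X) k)" for f by (rule model_bd_closed[OF that]) simp
  show "bd (koszul_model R x 0 X) k f {} = bd X k (f {})"
    if "f \<in> carrier (obj (koszul_model R x 0 X) k)" for f by (rule mb[OF that])
qed

text \<open>The subsets of \<open>{..<Suc n}\<close> split by whether they contain \<open>n\<close>;
  deleting \<open>n\<close> turns the second kind into subsets of \<open>{..<n}\<close> and lowers
  the degree by one. The sign in the second projection cancels the sign of the term
  \<open>j = n\<close> in the differential, leaving plain multiplication by \<open>x n\<close>, and
  it produces the minus sign that a cone has on its shifted summand.\<close>

lemma model_cone:
  assumes Z: "ring_complex R (koszul_model R x n X)" and xc: "\<And>j. j < Suc n \<Longrightarrow> x j \<in> carrier R"
  shows "mult_cone R (koszul_model R x n X) (koszul_model R x (Suc n) X) (x n)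
    (\<lambda>k f. restrict f (Pow {..<n}))
    (\<lambda>k f. \<lambda>T\<in>Pow {..<n}. alt_sign R (int (card T)) \<odot>\<^bsub>obj X (k - 1 - int (card T))\<^esub> f (insert n T))"
    (is "mult_cone R ?Z ?C _ ?p0 ?p1")
proof (intro mult_cone.intro mult_cone_axioms.intro)
  show "ring_complex R ?Z" by (rule Z)
  show "x n \<in> carrier R" using xc by simp
  have le: "T \<subseteq> {..<Suc n}" if "T \<subseteq> {..<n}" for T using that by (auto intro: less_SucI)
  have nT: "n \<notin> T" if "T \<subseteq> {..<n}" for T using that by auto
  have xc': "x j \<in> carrier R" if "j < n" for j using xc that by simp
  fix k
  show "module R (obj ?C k)" by (rule model_module)
  have ins: "f (insert n T) \<in> carrier (obj X (k - 1 - int (card T)))"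
    if "f \<in> carrier (obj ?C k)" "T \<subseteq> {..<n}" for f T k
    using model_component_insert[OF that(1) le[OF that(2)] _ nT[OF that(2)]] by simp
  have comp: "f T \<in> carrier (obj X (k - int (card T)))" if "f \<in> carrier (obj ?C k)" "T \<subseteq> {..<n}" for f T k
    using model_component[OF that(1) le[OF that(2)] refl] .
  have p0_hom: "?p0 k \<in> mod_hom R (obj ?C k) (obj ?Z k)" for k
  proof -
    have "(\<lambda>f. \<lambda>T\<in>Pow {..<n}. f T) \<in> mod_hom R (obj ?C k) (dsum (Pow {..<n}) (\<lambda>T. obj X (k - int (card T))))"
    proof (rule mod_hom_into_dsum)
      show "(\<lambda>f. f T) \<in> mod_hom R (obj ?C k) (obj X (k - int (card T)))" if "T \<in> Pow {..<n}" for T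
        using dsum_component_hom[of T "Pow {..<Suc n}" R "\<lambda>T. obj X (k - int (card T))"] le that
        by (simp add: koszul_model_def)
    qed simp
    then show ?thesis by (simp add: koszul_model_def)
  qed
  then show "?p0 k \<in> mod_hom R (obj ?C k) (obj ?Z k)" .
  have p1_hom: "?p1 k \<in> mod_hom R (obj ?C k) (obj ?Z (k - 1))" for k
  proof -
    have "?p1 k \<in> mod_hom R (obj ?C k) (dsum (Pow {..<n}) (\<lambda>T. obj X (k - 1 - int (card T))))"
    proof (rule mod_hom_into_dsum)
      fix T assume T: "T \<in> Pow {..<n}"
      have "k - int (card (insert n T)) = k - 1 - int (card T)"
        using card_insert_int[of T n n] nT[of T] T by simp
      moreover have "(\<lambda>f. f (insert n T)) \<in> mod_hom R (obj ?C k) (obj X (k - int (card (insert n T))))"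
        using dsum_component_hom[of "insert n T" "Pow {..<Suc n}" R "\<lambda>T. obj X (k - int (card T))"] le[of T] T
        by (simp add: koszul_model_def)
      ultimately have "(\<lambda>f. f (insert n T)) \<in> mod_hom R (obj ?C k) (obj X (k - 1 - int (card T)))"
        by (simp only:)
      from mod_homD[OF this]
      show "(\<lambda>f. alt_sign R (int (card T)) \<odot>\<^bsub>obj X (k - 1 - int (card T))\<^esub> f (insert n T))
          \<in> mod_hom R (obj ?C k) (obj X (k - 1 - int (card T)))"
        by (intro mod_homI) (simp_all add: obj.smult_r_distr obj.smult_assoc1[symmetric] m_comm)
    qed simp
    then show ?thesis by (simp add: koszul_model_def)
  qed
  then show "?p1 k \<in> mod_hom R (obj ?C k) (obj ?Z (k - 1))" .
  \<comment> \<open>Signs square to one, so the twist in the second projection can be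
    undone.\<close>
  have sgn2: "alt_sign R c \<odot>\<^bsub>obj X d\<^esub> (alt_sign R c \<odot>\<^bsub>obj X d\<^esub> y) = y" if "y \<in> carrier (obj X d)" for c d y
    using that by (simp add: obj.smult_assoc1[symmetric] alt_sign_square)
  show "f = g" if f: "f \<in> carrier (obj ?C k)" and g: "g \<in> carrier (obj ?C k)"
    and eq: "?p0 k f = ?p0 k g" "?p1 k f = ?p1 k g" for f g
  proof (rule PiE_ext)
    show "f \<in> (\<Pi>\<^sub>E T\<in>Pow {..<Suc n}. carrier (obj X (k - int (card T))))" using f by (simp only: model_carrier_iff)
    show "g \<in> (\<Pi>\<^sub>E T\<in>Pow {..<Suc n}. carrier (obj X (k - int (card T))))" using g by (simp only: model_carrier_iff)
    fix T assume T: "T \<in> Pow {..<Suc n}"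
    show "f T = g T"
    proof (cases "n \<in> T")
      case False
      then have "T \<in> Pow {..<n}" using T by (auto simp: less_Suc_eq)
      then show ?thesis using fun_cong[OF eq(1), of T] by simp
    next
      case True
      define T' where "T' = T - {n}"
      have T': "T' \<subseteq> {..<n}" "T = insert n T'" using T True by (auto simp: less_Suc_eq T'_def)
      let ?c = "int (card T')"
      have "alt_sign R ?c \<odot>\<^bsub>obj X (k - 1 - ?c)\<^esub> f (insert n T') =
          alt_sign R ?c \<odot>\<^bsub>obj X (k - 1 - ?c)\<^esub> g (insert n T')"
        using fun_cong[OF eq(2), of T'] T'(1) by simp
      from arg_cong[OF this, of "\<lambda>y. alt_sign R ?c \<odot>\<^bsub>obj X (k - 1 - ?c)\<^esub> y"]
      show ?thesis
        unfolding sgn2[OF ins[OF f T'(1)]] sgn2[OF ins[OF g T'(1)]] T'(2) .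
    qed
  qed
  show "\<exists>f\<in>carrier (obj ?C k). ?p0 k f = a \<and> ?p1 k f = b"
    if a: "a \<in> carrier (obj ?Z k)" and b: "b \<in> carrier (obj ?Z (k - 1))" for a b
  proof
    let ?f = "\<lambda>T\<in>Pow {..<Suc n}. if n \<in> T
      then alt_sign R (int (card (T - {n}))) \<odot>\<^bsub>obj X (k - 1 - int (card (T - {n})))\<^esub> b (T - {n}) else a T"
    have bc: "b T \<in> carrier (obj X (k - 1 - int (card T)))" if "T \<subseteq> {..<n}" for T
      using model_component[OF b that refl] .
    show "?f \<in> carrier (obj ?C k)"
      unfolding model_carrier_iff
    proof (rule PiE_I)
      fix T assume T: "T \<in> Pow {..<Suc n}"
      show "?f T \<in> carrier (obj X (k - int (card T)))"
      proof (cases "n \<in> T")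
        case False
        then have "T \<subseteq> {..<n}" using T by (auto simp: less_Suc_eq)
        then show ?thesis using model_component[OF a _ refl] T False by simp
      next
        case True
        define T' where "T' = T - {n}"
        have T': "T' \<subseteq> {..<n}" "T = insert n T'" using T True by (auto simp: less_Suc_eq T'_def)
        have "int (card T) = int (card T') + 1" using card_insert_int[OF T'(1) nT[OF T'(1)]] T'(2) by simp
        then have deg: "k - int (card T) = k - 1 - int (card T')" by simp
        have "?f T = alt_sign R (int (card T')) \<odot>\<^bsub>obj X (k - 1 - int (card T'))\<^esub> b T'"
          unfolding restrict_apply'[OF T] T'_def using True by (simp only: if_True)
        moreover have "alt_sign R (int (card T')) \<odot>\<^bsub>obj X (k - 1 - int (card T'))\<^esub> b T' \<in>
            carrier (obj X (k - 1 - int (card T')))"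
          by (rule obj.smult_closed[OF alt_sign_closed bc[OF T'(1)]])
        ultimately show ?thesis unfolding deg by (simp only:)
      qed
    qed auto
    have "?p0 k ?f = a"
    proof (rule PiE_ext)
      show "a \<in> (\<Pi>\<^sub>E T\<in>Pow {..<n}. carrier (obj X (k - int (card T))))" using a by (simp only: model_carrier_iff)
      show "?p0 k ?f \<in> (\<Pi>\<^sub>E T\<in>Pow {..<n}. carrier (obj X (k - int (card T))))"
        using mod_homD(1)[OF p0_hom \<open>?f \<in> carrier (obj ?C k)\<close>] by (simp only: model_carrier_iff)
    qed (use le nT in auto)
    moreover have "?p1 k ?f = b"
    proof (rule PiE_ext)
      show "b \<in> (\<Pi>\<^sub>E T\<in>Pow {..<n}. carrier (obj X (k - 1 - int (card T))))" using b by (simp only: model_carrier_iff)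
      show "?p1 k ?f \<in> (\<Pi>\<^sub>E T\<in>Pow {..<n}. carrier (obj X (k - 1 - int (card T))))"
        using mod_homD(1)[OF p1_hom \<open>?f \<in> carrier (obj ?C k)\<close>] by (simp only: model_carrier_iff)
      fix T assume "T \<in> Pow {..<n}"
      then have T: "T \<subseteq> {..<n}" by simp
      have "insert n T \<subseteq> {..<Suc n}" "insert n T - {n} = T" using le[OF T] nT[OF T] by auto
      then show "?p1 k ?f T = b T" using T sgn2[OF bc[OF T]] by simp
    qed
    ultimately show "?p0 k ?f = a \<and> ?p1 k ?f = b" by blast
  qed
  fix f assume f: "f \<in> carrier (obj ?C k)"
  show bdf: "bd ?C k f \<in> carrier (obj ?C (k - 1))" by (rule model_bd_closed[OF f xc])
  note p0f = mod_homD(1)[OF p0_hom f] and p1f = mod_homD(1)[OF p1_hom f]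
  interpret Z: ring_complex R ?Z by (rule Z)
  have xn: "x n \<in> carrier R" using xc by simp
  show "?p0 (k - 1) (bd ?C k f) = bd ?Z k (?p0 k f) \<oplus>\<^bsub>obj ?Z (k - 1)\<^esub> x n \<odot>\<^bsub>obj ?Z (k - 1)\<^esub> ?p1 k f"
  proof (rule PiE_ext)
    show "?p0 (k - 1) (bd ?C k f) \<in> (\<Pi>\<^sub>E T\<in>Pow {..<n}. carrier (obj X (k - 1 - int (card T))))"
      using mod_homD(1)[OF p0_hom bdf] by (simp only: model_carrier_iff)
    show "bd ?Z k (?p0 k f) \<oplus>\<^bsub>obj ?Z (k - 1)\<^esub> x n \<odot>\<^bsub>obj ?Z (k - 1)\<^esub> ?p1 k f
        \<in> (\<Pi>\<^sub>E T\<in>Pow {..<n}. carrier (obj X (k - 1 - int (card T))))"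
      using Z.obj.M.a_closed[OF Z.bd_closed[OF p0f] Z.obj.smult_closed[OF xn p1f]] by (simp only: model_carrier_iff)
    fix T assume "T \<in> Pow {..<n}"
    then have T: "T \<subseteq> {..<n}" by simp
    let ?c = "int (card T)"
    let ?N = "obj X (k - 1 - ?c)"
    let ?t = "\<lambda>j. (alt_sign R (int (card {i \<in> T. i < j})) \<otimes> x j) \<odot>\<^bsub>?N\<^esub> f (insert j T)"
    have terms: "?t \<in> {..<Suc n} - T \<rightarrow> carrier ?N" by (rule model_terms[OF f le[OF T] xc])
    then have terms': "?t \<in> {..<n} - T \<rightarrow> carrier ?N" by (auto simp: Pi_iff less_Suc_eq)
    have tn: "?t n = x n \<odot>\<^bsub>?N\<^esub> (alt_sign R ?c \<odot>\<^bsub>?N\<^esub> f (insert n T))"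
    proof -
      have "{i \<in> T. i < n} = T" using T by auto
      then show ?thesis using ins[OF f T] xn by (simp add: obj.smult_assoc1[symmetric] m_comm)
    qed
    \<comment> \<open>The term \<open>j = n\<close> is the only one that leads to a subset
      containing \<open>n\<close>; it is the contribution of the map whose cone is formed.\<close>
    have split: "{..<Suc n} - T = insert n ({..<n} - T)" using nT[OF T] by auto
    have "(\<Oplus>\<^bsub>?N\<^esub>j\<in>{..<Suc n} - T. ?t j) = ?t n \<oplus>\<^bsub>?N\<^esub> (\<Oplus>\<^bsub>?N\<^esub>j\<in>{..<n} - T. ?t j)"
      unfolding split
      by (rule obj.M.finsum_insert) (use terms' ins[OF f T] xn in auto)
    then have L: "?p0 (k - 1) (bd ?C k f) T =
        ?t n \<oplus>\<^bsub>?N\<^esub> (\<Oplus>\<^bsub>?N\<^esub>j\<in>{..<n} - T. ?t j) \<oplus>\<^bsub>?N\<^esub> alt_sign R ?c \<odot>\<^bsub>?N\<^esub> bd X (k - ?c) (f T)"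
      using T model_bd[OF le[OF T], of x k f] by simp
    have "bd ?Z k (?p0 k f) T = (\<Oplus>\<^bsub>?N\<^esub>j\<in>{..<n} - T. (alt_sign R (int (card {i \<in> T. i < j})) \<otimes> x j) \<odot>\<^bsub>?N\<^esub> ?p0 k f (insert j T))
        \<oplus>\<^bsub>?N\<^esub> alt_sign R ?c \<odot>\<^bsub>?N\<^esub> bd X (k - ?c) (f T)"
      using T model_bd[OF T, of x k "?p0 k f"] by simp
    also have "(\<Oplus>\<^bsub>?N\<^esub>j\<in>{..<n} - T. (alt_sign R (int (card {i \<in> T. i < j})) \<otimes> x j) \<odot>\<^bsub>?N\<^esub> ?p0 k f (insert j T)) =
        (\<Oplus>\<^bsub>?N\<^esub>j\<in>{..<n} - T. ?t j)"
      by (rule obj.M.finsum_cong'[OF refl terms']) (use T in auto)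
    finally have Rr: "(bd ?Z k (?p0 k f) \<oplus>\<^bsub>obj ?Z (k - 1)\<^esub> x n \<odot>\<^bsub>obj ?Z (k - 1)\<^esub> ?p1 k f) T =
        ((\<Oplus>\<^bsub>?N\<^esub>j\<in>{..<n} - T. ?t j) \<oplus>\<^bsub>?N\<^esub> alt_sign R ?c \<odot>\<^bsub>?N\<^esub> bd X (k - ?c) (f T)) \<oplus>\<^bsub>?N\<^esub> ?t n"
      using T unfolding tn by (simp add: koszul_model_def)
    show "?p0 (k - 1) (bd ?C k f) T =
        (bd ?Z k (?p0 k f) \<oplus>\<^bsub>obj ?Z (k - 1)\<^esub> x n \<odot>\<^bsub>obj ?Z (k - 1)\<^esub> ?p1 k f) T"
      unfolding L Rr
      using obj.M.finsum_closed[OF terms'] model_bd_X[OF f le[OF T]] ins[OF f T] xn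
      by (simp add: obj.M.a_ac)
  qed
  show "?p1 (k - 1) (bd ?C k f) = (\<ominus> \<one>) \<odot>\<^bsub>obj ?Z (k - 1 - 1)\<^esub> bd ?Z (k - 1) (?p1 k f)"
  proof (rule PiE_ext)
    show "?p1 (k - 1) (bd ?C k f) \<in> (\<Pi>\<^sub>E T\<in>Pow {..<n}. carrier (obj X (k - 1 - 1 - int (card T))))"
      using mod_homD(1)[OF p1_hom bdf] by (simp only: model_carrier_iff)
    show "(\<ominus> \<one>) \<odot>\<^bsub>obj ?Z (k - 1 - 1)\<^esub> bd ?Z (k - 1) (?p1 k f)
        \<in> (\<Pi>\<^sub>E T\<in>Pow {..<n}. carrier (obj X (k - 1 - 1 - int (card T))))"
      using Z.obj.smult_closed[OF a_inv_closed[OF one_closed] Z.bd_closed[OF p1f]] by (simp only: model_carrier_iff)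
    fix T assume "T \<in> Pow {..<n}"
    then have T: "T \<subseteq> {..<n}" by simp
    let ?c = "int (card T)"
    let ?N = "obj X (k - 1 - 1 - ?c)"
    let ?a = "\<lambda>j. alt_sign R (int (card {i \<in> T. i < j})) \<otimes> x j"
    let ?g = "\<lambda>j. f (insert n (insert j T))"
    let ?D = "bd X (k - 1 - ?c) (f (insert n T))"
    have cn: "int (card (insert n T)) = ?c + 1" by (rule card_insert_int[OF T nT[OF T]])
    have deg: "k - 1 - (?c + 1) = k - 1 - 1 - ?c" "k - (?c + 1) = k - 1 - ?c" by simp_all
    have g: "?g j \<in> carrier ?N" if "j \<in> {..<n} - T" for j
    proof -
      have jT: "insert j T \<subseteq> {..<n}" "j \<notin> T" using that T by auto
      show ?thesis using ins[OF f jT(1)] card_insert_int[OF T jT(2)] deg by simp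
    qed
    have a: "?a j \<in> carrier R" if "j \<in> {..<n} - T" for j using that xc' by simp
    have terms: "(\<lambda>j. ?a j \<odot>\<^bsub>?N\<^esub> ?g j) \<in> {..<n} - T \<rightarrow> carrier ?N" using a g by auto
    have D: "?D \<in> carrier ?N"
      by (rule bd_closed_deg[OF ins[OF f T]]) simp
    have dom: "{..<Suc n} - insert n T = {..<n} - T" by auto
    have nT': "insert n T \<subseteq> {..<Suc n}" using le[OF T] by simp
    have "bd ?C k f (insert n T) = (\<Oplus>\<^bsub>?N\<^esub>j\<in>{..<n} - T.
          (alt_sign R (int (card {i \<in> insert n T. i < j})) \<otimes> x j) \<odot>\<^bsub>?N\<^esub> f (insert j (insert n T)))
        \<oplus>\<^bsub>?N\<^esub> alt_sign R (?c + 1) \<odot>\<^bsub>?N\<^esub> ?D"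
      using model_bd[OF nT', of x k f] unfolding cn deg dom by simp
    also have "(\<Oplus>\<^bsub>?N\<^esub>j\<in>{..<n} - T.
          (alt_sign R (int (card {i \<in> insert n T. i < j})) \<otimes> x j) \<odot>\<^bsub>?N\<^esub> f (insert j (insert n T))) =
        (\<Oplus>\<^bsub>?N\<^esub>j\<in>{..<n} - T. ?a j \<odot>\<^bsub>?N\<^esub> ?g j)"
    proof (rule obj.M.finsum_cong'[OF refl terms])
      fix j assume j: "j \<in> {..<n} - T"
      have "{i \<in> insert n T. i < j} = {i \<in> T. i < j}" using j by auto
      then show "(alt_sign R (int (card {i \<in> insert n T. i < j})) \<otimes> x j) \<odot>\<^bsub>?N\<^esub> f (insert j (insert n T)) =
          ?a j \<odot>\<^bsub>?N\<^esub> ?g j" by (simp add: insert_commute)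
    qed
    finally have L: "?p1 (k - 1) (bd ?C k f) T = alt_sign R ?c \<odot>\<^bsub>?N\<^esub>
        ((\<Oplus>\<^bsub>?N\<^esub>j\<in>{..<n} - T. ?a j \<odot>\<^bsub>?N\<^esub> ?g j) \<oplus>\<^bsub>?N\<^esub> alt_sign R (?c + 1) \<odot>\<^bsub>?N\<^esub> ?D)"
      using T by simp
    have dp: "bd X (k - 1 - ?c) (?p1 k f T) = alt_sign R ?c \<odot>\<^bsub>?N\<^esub> ?D"
    proof -
      have deg': "k - 1 - ?c - 1 = k - 1 - 1 - ?c" by simp
      show ?thesis
        using mod_homD(3)[OF bd_hom alt_sign_closed ins[OF f T], of ?c] T unfolding deg' by simp
    qed
    have "bd ?Z (k - 1) (?p1 k f) T = (\<Oplus>\<^bsub>?N\<^esub>j\<in>{..<n} - T. ?a j \<odot>\<^bsub>?N\<^esub> ?p1 k f (insert j T))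
        \<oplus>\<^bsub>?N\<^esub> alt_sign R ?c \<odot>\<^bsub>?N\<^esub> (alt_sign R ?c \<odot>\<^bsub>?N\<^esub> ?D)"
      unfolding model_bd[OF T, of x "k - 1" "?p1 k f"] dp ..
    \<comment> \<open>Inserting \<open>j\<close> raises the cardinality by one, so the sign in the
      second projection is opposite to that of \<open>T\<close>. Being the same for all
      \<open>j\<close>, it can be pulled out of the sum.\<close>
    also have "(\<Oplus>\<^bsub>?N\<^esub>j\<in>{..<n} - T. ?a j \<odot>\<^bsub>?N\<^esub> ?p1 k f (insert j T)) =
        (\<Oplus>\<^bsub>?N\<^esub>j\<in>{..<n} - T. alt_sign R (?c + 1) \<odot>\<^bsub>?N\<^esub> (?a j \<odot>\<^bsub>?N\<^esub> ?g j))"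
    proof (rule obj.M.finsum_cong'[OF refl])
      fix j assume j: "j \<in> {..<n} - T"
      then have jT: "insert j T \<in> Pow {..<n}" "int (card (insert j T)) = ?c + 1"
        using T card_insert_int[OF T, of j] by auto
      show "?a j \<odot>\<^bsub>?N\<^esub> ?p1 k f (insert j T) = alt_sign R (?c + 1) \<odot>\<^bsub>?N\<^esub> (?a j \<odot>\<^bsub>?N\<^esub> ?g j)"
        using jT a[OF j] g[OF j] unfolding restrict_apply'[OF jT(1)] jT(2) deg
        by (simp add: obj.smult_assoc1[symmetric] m_comm)
    qed (use terms in auto)
    also have "\<dots> = alt_sign R (?c + 1) \<odot>\<^bsub>?N\<^esub> (\<Oplus>\<^bsub>?N\<^esub>j\<in>{..<n} - T. ?a j \<odot>\<^bsub>?N\<^esub> ?g j)"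
      by (rule obj.finsum_smult_ldistr[symmetric, OF _ _ terms]) simp_all
    finally have bz: "bd ?Z (k - 1) (?p1 k f) T = alt_sign R (?c + 1) \<odot>\<^bsub>?N\<^esub> (\<Oplus>\<^bsub>?N\<^esub>j\<in>{..<n} - T. ?a j \<odot>\<^bsub>?N\<^esub> ?g j)
        \<oplus>\<^bsub>?N\<^esub> alt_sign R ?c \<odot>\<^bsub>?N\<^esub> (alt_sign R ?c \<odot>\<^bsub>?N\<^esub> ?D)" .
    have Rr: "((\<ominus> \<one>) \<odot>\<^bsub>obj ?Z (k - 1 - 1)\<^esub> bd ?Z (k - 1) (?p1 k f)) T =
        (\<ominus> \<one>) \<odot>\<^bsub>?N\<^esub> (bd ?Z (k - 1) (?p1 k f) T)"
      using T by (simp add: koszul_model_def)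
    show "?p1 (k - 1) (bd ?C k f) T = ((\<ominus> \<one>) \<odot>\<^bsub>obj ?Z (k - 1 - 1)\<^esub> bd ?Z (k - 1) (?p1 k f)) T"
      unfolding L Rr bz
      using obj.M.finsum_closed[OF terms] D
      by (simp add: obj.smult_r_distr obj.smult_assoc1[symmetric] alt_sign_square alt_sign_Suc l_minus r_minus)
  qed
qed

end

section \<open>The Koszul tensor product in coordinates\<close>

lemma finsum_self_mod: "finsum (self_mod R) = finsum R"
  by (simp add: finsum_def finprod_def fun_eq_iff self_mod_def)

lemma tensor_mod_module: "\<lbrakk>module R M; module R N\<rbrakk> \<Longrightarrow> module R (tensor_mod R M N)"
  using tensor_pair.intro[of R M N] by (metis fact_mod_module tensor_mod_def tensor_pair.submodule_K(1)
      cring.free_mod_module module.axioms(1))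

lemma koszul_basis_iff: "S \<in> koszul_basis n i \<longleftrightarrow> S \<subseteq> {..<n} \<and> int (card S) = i"
  by (simp add: koszul_basis_def)

lemma finite_koszul_basis: "finite (koszul_basis n i)"
  by (rule finite_subset[of _ "Pow {..<n}"]) (auto simp: koszul_basis_def)

lemma koszul_basis_insert:
  assumes "T \<in> koszul_basis n (i - 1)" "j \<in> {..<n} - T"
  shows "insert j T \<in> koszul_basis n i"
  using assms card_insert_int[of T n j] by (auto simp: koszul_basis_iff)

lemma koszul_obj: "obj (koszul R xs) i = free_mod R (koszul_basis (length xs) i)"
  by (simp add: koszul_def)

lemma koszul_bd:
  "T \<in> koszul_basis (length xs) (i - 1) \<Longrightarrow> bd (koszul R xs) i f T =
     (\<Oplus>\<^bsub>R\<^esub> j \<in> {..<length xs} - T.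
         alt_sign R (int (card {k \<in> T. k < j})) \<otimes>\<^bsub>R\<^esub> (xs ! j) \<otimes>\<^bsub>R\<^esub> f (insert j T))"
  by (simp add: koszul_def)

text \<open>With sums read in \<open>self_mod R\<close>, each component of the differential is a
  finite sum of module homomorphisms.\<close>

lemma (in cring) koszul_bd_hom:
  assumes xs: "set xs \<subseteq> carrier R"
  shows "bd (koszul R xs) i \<in> mod_hom R (obj (koszul R xs) i) (obj (koszul R xs) (i - 1))"
proof -
  let ?n = "length xs"
  let ?c = "\<lambda>T j. alt_sign R (int (card {k \<in> T. k < j})) \<otimes> (xs ! j)"
  interpret F: module R "free_mod R (koszul_basis ?n i)" by (rule free_mod_module)
  interpret S: module R "self_mod R" by (rule self_mod_module)
  have "(\<lambda>f. \<lambda>T\<in>koszul_basis ?n (i - 1). \<Oplus>\<^bsub>self_mod R\<^esub> j \<in> {..<?n} - T. ?c T j \<otimes> f (insert j T))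
      \<in> mod_hom R (free_mod R (koszul_basis ?n i)) (dsum (koszul_basis ?n (i - 1)) (\<lambda>_. self_mod R))"
  proof (rule mod_hom_into_dsum[OF finite_koszul_basis])
    fix T assume T: "T \<in> koszul_basis ?n (i - 1)"
    show "(\<lambda>f. \<Oplus>\<^bsub>self_mod R\<^esub> j \<in> {..<?n} - T. ?c T j \<otimes> f (insert j T))
        \<in> mod_hom R (free_mod R (koszul_basis ?n i)) (self_mod R)"
    proof (rule finsum_mod_hom[OF F.module_axioms S.module_axioms])
      fix j assume j: "j \<in> {..<?n} - T"
      note ins = koszul_basis_insert[OF T j]
      have c: "?c T j \<in> carrier R" using j xs by (auto simp: subset_iff)
      have val: "f (insert j T) \<in> carrier R" if "f \<in> carrier (free_mod R (koszul_basis ?n i))" for f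
        using that ins by (auto simp: free_mod_carrier_iff)
      show "(\<lambda>f. ?c T j \<otimes> f (insert j T)) \<in> mod_hom R (free_mod R (koszul_basis ?n i)) (self_mod R)"
        by (rule mod_homI)
          (use c val ins in \<open>simp_all add: r_distr m_lcomm del: F.M.a_closed F.smult_closed\<close>)
    qed simp
  qed
  then show ?thesis by (simp add: koszul_def free_mod_def finsum_self_mod)
qed

context ring_complex
begin

text \<open>Adding one element at a time through the cone, the vanishing of the squared differential
  is inherited from the cone, and the double sum over pairs of indices never appears.\<close>

lemma model_complex:
  "(\<And>j. j < n \<Longrightarrow> x j \<in> carrier R) \<Longrightarrow> ring_complex R (koszul_model R x n X)"
proof (induction n)
  case 0
  show ?case by (rule chain_iso.T_complex[OF model_zero_iso])
next
  case (Suc n)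
  then show ?case using mult_cone.C_complex[OF model_cone] by simp
qed

lemma model_bounded:
  assumes "\<And>j. j < n \<Longrightarrow> x j \<in> carrier R" "\<And>i. i < lo \<Longrightarrow> cycles X i \<subseteq> boundaries X i" "i < lo"
  shows "cycles (koszul_model R x n X) i \<subseteq> boundaries (koszul_model R x n X) i"
  using assms(1,3)
proof (induction n arbitrary: i)
  case 0
  show ?case by (rule chain_iso.iso_bounded[OF model_zero_iso assms(2)[OF 0(2)]])
next
  case (Suc n)
  note cone = model_cone[OF model_complex[OF Suc.prems(1)[OF less_SucI]] Suc.prems(1)]
  show ?case
  proof (rule mult_cone.cone_bounded[OF cone _ Suc.prems(2)])
    show "cycles (koszul_model R x n X) i \<subseteq> boundaries (koszul_model R x n X) i" if "i < lo" for i
      by (rule Suc.IH[OF Suc.prems(1)[OF less_SucI] that])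
  qed
qed

lemma model_noeth:
  assumes "\<And>j. j < n \<Longrightarrow> x j \<in> carrier R" "\<And>i. noeth_between R (obj X i) (boundaries X i) (cycles X i)"
  shows "noeth_between R (obj (koszul_model R x n X) i) (boundaries (koszul_model R x n X) i)
    (cycles (koszul_model R x n X) i)"
  using assms(1)
proof (induction n arbitrary: i)
  case 0
  show ?case by (rule chain_iso.iso_noeth[OF model_zero_iso assms(2)])
next
  case (Suc n)
  note cone = model_cone[OF model_complex[OF Suc.prems(1)[OF less_SucI]] Suc.prems(1)]
  show ?case
    by (rule mult_cone.cone_noeth[OF cone Suc.IH[OF Suc.prems[OF less_SucI]]])
qed

text \<open>Vanishing at \<open>q\<close> is handed down from the longest model to \<open>X\<close>,
  one cone at a time. Each step is one use of Nakayama's lemma, whose finiteness hypothesis is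
  \<open>model_noeth\<close> for the shorter model.\<close>

lemma model_torsion:
  assumes q: "primeideal q R" "\<And>j. j < n \<Longrightarrow> x j \<in> q"
    and noeth: "\<And>i. noeth_between R (obj X i) (boundaries X i) (cycles X i)"
    and tors: "\<And>i. cycles (koszul_model R x n X) i \<subseteq>
      saturation R q (obj (koszul_model R x n X) i) (boundaries (koszul_model R x n X) i)"
  shows "cycles X i \<subseteq> saturation R q (obj X i) (boundaries X i)"
  using q(2) tors
proof (induction n arbitrary: i)
  case 0
  show ?case using 0(2)[of i] chain_iso.iso_torsion_iff[OF model_zero_iso] by blast
next
  case (Suc n)
  interpret q: primeideal q R by (rule q(1))
  have xc: "x j \<in> carrier R" if "j < Suc n" for j using Suc.prems(1)[OF that] q.Icarr by simp
  note cone = model_cone[OF model_complex[OF xc[OF less_SucI]] xc]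
  show ?case
  proof (rule Suc.IH)
    show "x j \<in> q" if "j < n" for j using Suc.prems(1) that by simp
    show "cycles (koszul_model R x n X) i \<subseteq>
        saturation R q (obj (koszul_model R x n X) i) (boundaries (koszul_model R x n X) i)" for i
      by (rule mult_cone.cone_torsion[OF cone q(1) _ model_noeth[OF _ noeth] Suc.prems(2)])
        (use Suc.prems(1) xc in simp_all)
  qed
qed

text \<open>The basis element \<open>S\<close> lives in Koszul degree \<open>card S\<close>, so the
  component at \<open>S\<close> reads only that summand of \<open>u\<close>.\<close>

definition tensor_to_model :: "'a list \<Rightarrow> int \<Rightarrow> (int \<Rightarrow> ((nat set \<Rightarrow> 'a) \<times> 'b \<Rightarrow> 'a) set) \<Rightarrow> nat set \<Rightarrow> 'b"
  where "tensor_to_model xs k u = (\<lambda>S\<in>Pow {..<length xs}.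
    tensor_coord R (koszul_basis (length xs) (int (card S))) (obj X (k - int (card S))) S (u (int (card S))))"

text \<open>The Koszul modules are finite free, so every summand is determined by its coordinates,
  which can be prescribed freely. Compatibility with the differentials splits into two identities
  between homomorphisms, checked on pure tensors: \<open>coord1\<close> for the Koszul differential
  and \<open>coord2\<close> for that of \<open>X\<close>.\<close>

lemma tensor_koszul_iso:
  assumes xs: "set xs \<subseteq> carrier R"
  shows "chain_iso R (koszul_model R ((!) xs) (length xs) X) (tensor_cx R (koszul R xs) X) (tensor_to_model xs)"
proof -
  let ?n = "length xs"
  let ?KB = "koszul_basis ?n"
  let ?K = "\<lambda>i. free_mod R (?KB i)"
  let ?C = "koszul_model R ((!) xs) ?n X"
  let ?T = "tensor_cx R (koszul R xs) X"
  let ?\<Phi> = "tensor_to_model xs"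
  note KM = free_mod_module
  have xsc: "xs ! j \<in> carrier R" if "j < ?n" for j using xs that by auto
  interpret C: ring_complex R ?C by (rule model_complex[OF xsc])
  have Tobj: "obj ?T k = dsum UNIV (\<lambda>i. tensor_mod R (?K i) (obj X (k - i)))" for k
    by (simp add: tensor_cx_def koszul_obj)
  have Tmod: "module R (obj ?T k)" for k
    unfolding Tobj by (rule dsum_module[OF is_cring tensor_mod_module[OF KM obj_module]])
  have Cobj: "obj ?C k = dsum (Pow {..<?n}) (\<lambda>S. obj X (k - int (card S)))" for k
    by (simp add: koszul_model_def)
  have basis: "S \<in> ?KB (int (card S))" if "S \<in> Pow {..<?n}" for S
    using that by (simp add: koszul_basis_iff)
  have ucomp: "u i \<in> carrier (tensor_mod R (?K i) (obj X (k - i)))" if "u \<in> carrier (obj ?T k)" for u k i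
    using that dsum_component[of u UNIV _ i] unfolding Tobj by blast
  have \<Phi>_hom: "?\<Phi> k \<in> mod_hom R (obj ?T k) (obj ?C k)" for k
    unfolding Cobj tensor_to_model_def[abs_def]
  proof (rule mod_hom_into_dsum)
    fix S assume S: "S \<in> Pow {..<?n}"
    show "(\<lambda>u. tensor_coord R (?KB (int (card S))) (obj X (k - int (card S))) S (u (int (card S))))
        \<in> mod_hom R (obj ?T k) (obj X (k - int (card S)))"
    proof (rule mod_hom_comp[OF _ tensor_coord_hom(1)[OF obj_module basis[OF S]]])
      show "(\<lambda>u. u (int (card S))) \<in> mod_hom R (obj ?T k)
          (tensor_mod R (?K (int (card S))) (obj X (k - int (card S))))"
        unfolding Tobj by (rule dsum_component_hom) simp
    qed
  qed simp
  have Tbd: "bd ?T k u i =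
      tensor_map R (?K (i + 1)) (obj X (k - 1 - i)) (?K i) (obj X (k - 1 - i)) (bd (koszul R xs) (i + 1)) id (u (i + 1))
      \<oplus>\<^bsub>tensor_mod R (?K i) (obj X (k - 1 - i))\<^esub> alt_sign R i \<odot>\<^bsub>tensor_mod R (?K i) (obj X (k - 1 - i))\<^esub>
      tensor_map R (?K i) (obj X (k - i)) (?K i) (obj X (k - 1 - i)) id (bd X (k - i)) (u i)" for k u i
    by (simp add: tensor_cx_def Let_def koszul_obj)
  have Kbd: "bd (koszul R xs) (i + 1) \<in> mod_hom R (?K (i + 1)) (?K i)" for i
    using koszul_bd_hom[OF xs, of "i + 1"] by (simp add: koszul_obj)
  have Xbd: "bd X (k - i) \<in> mod_hom R (obj X (k - i)) (obj X (k - 1 - i))" for k i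
  proof -
    have "k - i - 1 = k - 1 - i" by simp
    then show ?thesis using bd_hom[of "k - i"] by (simp only:)
  qed
  have u1: "u (i + 1) \<in> carrier (tensor_mod R (?K (i + 1)) (obj X (k - 1 - i)))" if "u \<in> carrier (obj ?T k)" for u k i
  proof -
    have "k - (i + 1) = k - 1 - i" by simp
    then show ?thesis using ucomp[OF that, of "i + 1"] by (simp only:)
  qed
  note map1 = tensor_map_hom[OF KM obj_module KM obj_module Kbd mod_hom_id]
  note map2 = tensor_map_hom[OF KM obj_module KM obj_module mod_hom_id Xbd]
  have bd_comp: "bd ?T k u i \<in> carrier (tensor_mod R (?K i) (obj X (k - 1 - i)))" if u: "u \<in> carrier (obj ?T k)" for u k i
  proof -
    interpret Tn: module R "tensor_mod R (?K i) (obj X (k - 1 - i))" by (rule tensor_mod_module[OF KM obj_module])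
    show ?thesis
      unfolding Tbd using mod_homD(1)[OF map1(1) u1[OF u]] mod_homD(1)[OF map2(1) ucomp[OF u]] by simp
  qed
  \<comment> \<open>Outside the degrees from \<open>0\<close> to the length there are no subsets, so
    the summands vanish. Hence any family of components has finite support and belongs to the direct
    sum over all integers.\<close>
  have empty: "?KB i = {}" if "i \<notin> {0..int ?n}" for i
  proof (rule ccontr)
    assume "?KB i \<noteq> {}"
    then obtain S where "S \<in> ?KB i" by blast
    then have "S \<subseteq> {..<?n}" "int (card S) = i" by (simp_all add: koszul_basis_iff)
    moreover from this have "card S \<le> ?n" using card_mono[of "{..<?n}" S] by simp
    ultimately show False using that by simp
  qed
  have zero: "t = \<zero>\<^bsub>tensor_mod R (?K i) N\<^esub>"
    if "i \<notin> {0..int ?n}" "t \<in> carrier (tensor_mod R (?K i) N)" "module R N"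
    for i t and N :: "('a, 'b) module"
  proof -
    interpret Tn: module R "tensor_mod R (?K i) N" by (rule tensor_mod_module[OF KM that(3)])
    show ?thesis
      by (rule tensor_coord_inj[OF that(3) finite_koszul_basis that(2) Tn.M.zero_closed])
        (simp add: empty[OF that(1)])
  qed
  have dsumI: "u \<in> carrier (obj ?T k)"
    if "\<And>i. u i \<in> carrier (tensor_mod R (?K i) (obj X (k - i)))" for u k
    unfolding Tobj dsum_carrier_iff
  proof
    show "u \<in> (\<Pi>\<^sub>E i\<in>UNIV. carrier (tensor_mod R (?K i) (obj X (k - i))))"
      by (rule PiE_I) (use that in auto)
    have "{i \<in> UNIV. u i \<noteq> \<zero>\<^bsub>tensor_mod R (?K i) (obj X (k - i))\<^esub>} \<subseteq> {0..int ?n}"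
      using zero[OF _ that obj_module] by blast
    then show "finite {i \<in> UNIV. u i \<noteq> \<zero>\<^bsub>tensor_mod R (?K i) (obj X (k - i))\<^esub>}"
      by (rule finite_subset) simp
  qed
  have coord1: "tensor_coord R (?KB (int (card S))) (obj X d) S
        (tensor_map R (?K (int (card S) + 1)) (obj X d) (?K (int (card S))) (obj X d) (bd (koszul R xs) (int (card S) + 1)) id t) =
      (\<Oplus>\<^bsub>obj X d\<^esub> j \<in> {..<?n} - S. (alt_sign R (int (card {i \<in> S. i < j})) \<otimes> xs ! j) \<odot>\<^bsub>obj X d\<^esub>
        tensor_coord R (?KB (int (card S) + 1)) (obj X d) (insert j S) t)"
    if S: "S \<in> Pow {..<?n}" and t: "t \<in> carrier (tensor_mod R (?K (int (card S) + 1)) (obj X d))" for S d t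
  proof -
    let ?c = "int (card S)"
    let ?N = "obj X d"
    let ?a = "\<lambda>j. alt_sign R (int (card {i \<in> S. i < j})) \<otimes> xs ! j"
    interpret tp: tensor_pair R "?K (?c + 1)" ?N using KM obj_module by (simp add: tensor_pair_def)
    have ins: "insert j S \<in> ?KB (?c + 1)" if "j \<in> {..<?n} - S" for j
      using that S card_insert_int[of S ?n j] by (auto simp: koszul_basis_iff)
    have a: "?a j \<in> carrier R" if "j \<in> {..<?n} - S" for j using that xsc by simp
    note tc = tensor_coord_hom[OF obj_module]
    have f: "(\<lambda>t. tensor_coord R (?KB ?c) ?N S (tensor_map R (?K (?c + 1)) ?N (?K ?c) ?N (bd (koszul R xs) (?c + 1)) id t))
        \<in> mod_hom R tp.Ten ?N"
      by (rule mod_hom_comp[OF map1(1) tc(1)[OF basis[OF S]]])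
    have g: "(\<lambda>t. \<Oplus>\<^bsub>?N\<^esub> j \<in> {..<?n} - S. ?a j \<odot>\<^bsub>?N\<^esub> tensor_coord R (?KB (?c + 1)) ?N (insert j S) t)
        \<in> mod_hom R tp.Ten ?N"
    proof (rule finsum_mod_hom[OF tp.Ten.module_axioms obj_module])
      fix j assume j: "j \<in> {..<?n} - S"
      note h = mod_homD[OF tc(1)[OF ins[OF j]]]
      show "(\<lambda>t. ?a j \<odot>\<^bsub>?N\<^esub> tensor_coord R (?KB (?c + 1)) ?N (insert j S) t) \<in> mod_hom R tp.Ten ?N"
        by (rule mod_homI)
          (use h a[OF j] in \<open>simp_all add: obj.smult_r_distr obj.smult_assoc1[symmetric] m_comm\<close>)
    qed simp
    show ?thesis
    proof (rule tp.tensor_hom_eqI[OF obj_module f g _ t])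
      fix \<phi> y assume \<phi>: "\<phi> \<in> carrier (?K (?c + 1))" and y: "y \<in> carrier ?N"
      have val: "\<phi> (insert j S) \<in> carrier R" if "j \<in> {..<?n} - S" for j
        using \<phi> ins[OF that] by (auto simp: free_mod_carrier_iff)
      have "tensor_coord R (?KB ?c) ?N S
          (tensor_map R (?K (?c + 1)) ?N (?K ?c) ?N (bd (koszul R xs) (?c + 1)) id (tp.pure \<phi> y)) =
          bd (koszul R xs) (?c + 1) \<phi> S \<odot>\<^bsub>?N\<^esub> y"
        using map1(2)[OF \<phi> y] tc(2)[OF basis[OF S] mod_homD(1)[OF Kbd \<phi>] y] by simp
      \<comment> \<open>Reading the sum in \<open>self_mod R\<close> makes multiplication into
        \<open>y\<close> a module homomorphism out of it, which can then be moved inside the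
        sum.\<close>
      also have "\<dots> = (\<Oplus>\<^bsub>self_mod R\<^esub> j \<in> {..<?n} - S. ?a j \<otimes> \<phi> (insert j S)) \<odot>\<^bsub>?N\<^esub> y"
        using koszul_bd[of S xs "?c + 1" R \<phi>] basis[OF S] by (simp add: finsum_self_mod)
      also have "\<dots> = (\<Oplus>\<^bsub>?N\<^esub> j \<in> {..<?n} - S. (?a j \<otimes> \<phi> (insert j S)) \<odot>\<^bsub>?N\<^esub> y)"
        by (rule mod_hom_finsum[OF self_mod_module obj_module obj.smult_hom[OF y]])
          (use a val in auto)
      also have "\<dots> = (\<Oplus>\<^bsub>?N\<^esub> j \<in> {..<?n} - S. ?a j \<odot>\<^bsub>?N\<^esub>
          tensor_coord R (?KB (?c + 1)) ?N (insert j S) (tp.pure \<phi> y))"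
      proof (rule obj.M.finsum_cong')
        show "(?a j \<otimes> \<phi> (insert j S)) \<odot>\<^bsub>?N\<^esub> y =
            ?a j \<odot>\<^bsub>?N\<^esub> tensor_coord R (?KB (?c + 1)) ?N (insert j S) (tp.pure \<phi> y)" if j: "j \<in> {..<?n} - S" for j
          unfolding tc(2)[OF ins[OF j] \<phi> y] by (rule obj.smult_assoc1[OF a[OF j] val[OF j] y])
        show "(\<lambda>j. ?a j \<odot>\<^bsub>?N\<^esub> tensor_coord R (?KB (?c + 1)) ?N (insert j S) (tp.pure \<phi> y))
            \<in> {..<?n} - S \<rightarrow> carrier ?N"
          using a mod_homD(1)[OF tc(1)[OF ins] tp.pure_closed] by (intro Pi_I obj.smult_closed)
      qed simp
      finally show "tensor_coord R (?KB ?c) ?N S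
          (tensor_map R (?K (?c + 1)) ?N (?K ?c) ?N (bd (koszul R xs) (?c + 1)) id (tp.pure \<phi> y)) =
          (\<Oplus>\<^bsub>?N\<^esub> j \<in> {..<?n} - S. ?a j \<odot>\<^bsub>?N\<^esub>
          tensor_coord R (?KB (?c + 1)) ?N (insert j S) (tp.pure \<phi> y))" .
    qed
  qed
  have coord2: "tensor_coord R (?KB i) (obj X (k - 1 - i)) S
        (tensor_map R (?K i) (obj X (k - i)) (?K i) (obj X (k - 1 - i)) id (bd X (k - i)) t) =
      bd X (k - i) (tensor_coord R (?KB i) (obj X (k - i)) S t)"
    if S: "S \<in> ?KB i" and t: "t \<in> carrier (tensor_mod R (?K i) (obj X (k - i)))" for S i k t
  proof -
    interpret tp: tensor_pair R "?K i" "obj X (k - i)" using KM obj_module by (simp add: tensor_pair_def)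
    note tc = tensor_coord_hom[OF obj_module S]
    show ?thesis
    proof (rule tp.tensor_hom_eqI[OF obj_module mod_hom_comp[OF map2(1) tc(1)] mod_hom_comp[OF tc(1) Xbd] _ t])
      fix \<phi> y assume \<phi>: "\<phi> \<in> carrier (?K i)" and y: "y \<in> carrier (obj X (k - i))"
      have val: "\<phi> S \<in> carrier R" using \<phi> S by (auto simp: free_mod_carrier_iff)
      show "tensor_coord R (?KB i) (obj X (k - 1 - i)) S
          (tensor_map R (?K i) (obj X (k - i)) (?K i) (obj X (k - 1 - i)) id (bd X (k - i)) (tp.pure \<phi> y)) =
          bd X (k - i) (tensor_coord R (?KB i) (obj X (k - i)) S (tp.pure \<phi> y))"
        unfolding map2(2)[OF \<phi> y] id_apply tc(2)[OF \<phi> mod_homD(1)[OF Xbd y]] tc(2)[OF \<phi> y]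
        by (rule mod_homD(3)[OF Xbd val y, symmetric])
    qed
  qed
  show ?thesis
  proof (intro chain_iso.intro chain_iso_axioms.intro)
    show "ring_complex R ?C" by (rule C.ring_complex_axioms)
    fix k
    show "module R (obj ?T k)" by (rule Tmod)
    show "?\<Phi> k \<in> mod_hom R (obj ?T k) (obj ?C k)" by (rule \<Phi>_hom)
    show "u = v" if u: "u \<in> carrier (obj ?T k)" and v: "v \<in> carrier (obj ?T k)" and eq: "?\<Phi> k u = ?\<Phi> k v" for u v
    proof
      fix i
      show "u i = v i"
      proof (rule tensor_coord_inj[OF obj_module finite_koszul_basis ucomp[OF u] ucomp[OF v]])
        fix S assume S: "S \<in> ?KB i"
        then have "S \<in> Pow {..<?n}" "int (card S) = i" by (auto simp: koszul_basis_iff)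
        then show "tensor_coord R (?KB i) (obj X (k - i)) S (u i) = tensor_coord R (?KB i) (obj X (k - i)) S (v i)"
          using fun_cong[OF eq, of S] by (simp add: tensor_to_model_def)
      qed
    qed
    show "\<exists>u\<in>carrier (obj ?T k). ?\<Phi> k u = g" if g: "g \<in> carrier (obj ?C k)" for g
    proof -
      have "g \<in> ?KB i \<rightarrow> carrier (obj X (k - i))" for i
        using model_component[OF g] by (auto simp: koszul_basis_iff)
      then have "\<exists>t\<in>carrier (tensor_mod R (?K i) (obj X (k - i))).
          \<forall>b\<in>?KB i. tensor_coord R (?KB i) (obj X (k - i)) b t = g b" for i
        by (rule tensor_coord_surj[OF obj_module finite_koszul_basis])
      then obtain u where u: "\<And>i. u i \<in> carrier (tensor_mod R (?K i) (obj X (k - i)))"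
          "\<And>i b. b \<in> ?KB i \<Longrightarrow> tensor_coord R (?KB i) (obj X (k - i)) b (u i) = g b"
        by metis
      have "?\<Phi> k u = g"
      proof (rule PiE_ext)
        show "?\<Phi> k u \<in> (\<Pi>\<^sub>E S\<in>Pow {..<?n}. carrier (obj X (k - int (card S))))"
          using mod_homD(1)[OF \<Phi>_hom dsumI[OF u(1)]] by (simp only: model_carrier_iff)
        show "g \<in> (\<Pi>\<^sub>E S\<in>Pow {..<?n}. carrier (obj X (k - int (card S))))"
          using g by (simp only: model_carrier_iff)
        show "?\<Phi> k u S = g S" if "S \<in> Pow {..<?n}" for S
          using u(2)[OF basis[OF that]] that by (simp add: tensor_to_model_def)
      qed
      then show ?thesis using dsumI[OF u(1)] by blast
    qed
    fix u assume u: "u \<in> carrier (obj ?T k)"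
    show bdu: "bd ?T k u \<in> carrier (obj ?T (k - 1))" by (rule dsumI[OF bd_comp[OF u]])
    show "?\<Phi> (k - 1) (bd ?T k u) = bd ?C k (?\<Phi> k u)"
    proof (rule PiE_ext)
      show "?\<Phi> (k - 1) (bd ?T k u) \<in> (\<Pi>\<^sub>E S\<in>Pow {..<?n}. carrier (obj X (k - 1 - int (card S))))"
        using mod_homD(1)[OF \<Phi>_hom bdu] by (simp only: model_carrier_iff)
      show "bd ?C k (?\<Phi> k u) \<in> (\<Pi>\<^sub>E S\<in>Pow {..<?n}. carrier (obj X (k - 1 - int (card S))))"
        using C.bd_closed[OF mod_homD(1)[OF \<Phi>_hom u]] by (simp only: model_carrier_iff)
      fix S assume S: "S \<in> Pow {..<?n}"
      then have S': "S \<subseteq> {..<?n}" by simp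
      let ?c = "int (card S)"
      let ?d = "k - 1 - ?c"
      let ?coord = "tensor_coord R (?KB ?c) (obj X ?d) S"
      note h = mod_homD[OF tensor_coord_hom(1)[OF obj_module basis[OF S]]]
      note m1 = mod_homD(1)[OF map1(1) u1[OF u]] and m2 = mod_homD(1)[OF map2(1) ucomp[OF u]]
      interpret Tn: module R "tensor_mod R (?K ?c) (obj X ?d)" by (rule tensor_mod_module[OF KM obj_module])
      have "?\<Phi> (k - 1) (bd ?T k u) S = ?coord (bd ?T k u ?c)"
        unfolding tensor_to_model_def restrict_apply'[OF S] ..
      also have "\<dots> = ?coord (tensor_map R (?K (?c + 1)) (obj X ?d) (?K ?c) (obj X ?d) (bd (koszul R xs) (?c + 1)) id (u (?c + 1)))
          \<oplus>\<^bsub>obj X ?d\<^esub> alt_sign R ?c \<odot>\<^bsub>obj X ?d\<^esub>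
          ?coord (tensor_map R (?K ?c) (obj X (k - ?c)) (?K ?c) (obj X ?d) id (bd X (k - ?c)) (u ?c))"
        unfolding Tbd h(2)[OF m1 Tn.smult_closed[OF alt_sign_closed m2]] h(3)[OF alt_sign_closed m2] ..
      also have "\<dots> = (\<Oplus>\<^bsub>obj X ?d\<^esub> j \<in> {..<?n} - S. (alt_sign R (int (card {i \<in> S. i < j})) \<otimes> xs ! j) \<odot>\<^bsub>obj X ?d\<^esub>
            tensor_coord R (?KB (?c + 1)) (obj X ?d) (insert j S) (u (?c + 1)))
          \<oplus>\<^bsub>obj X ?d\<^esub> alt_sign R ?c \<odot>\<^bsub>obj X ?d\<^esub> bd X (k - ?c) (tensor_coord R (?KB ?c) (obj X (k - ?c)) S (u ?c))"
        unfolding coord1[OF S u1[OF u]] coord2[OF basis[OF S] ucomp[OF u]] ..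
      also have "\<dots> = bd ?C k (?\<Phi> k u) S"
      proof -
        have val: "?\<Phi> k u (insert j S) = tensor_coord R (?KB (?c + 1)) (obj X ?d) (insert j S) (u (?c + 1))"
          if j: "j \<in> {..<?n} - S" for j
        proof -
          have jS: "insert j S \<in> Pow {..<?n}" "int (card (insert j S)) = ?c + 1"
            using j S card_insert_int[OF S', of j] by auto
          have deg: "k - (?c + 1) = ?d" by simp
          show ?thesis unfolding tensor_to_model_def restrict_apply'[OF jS(1)] jS(2) deg ..
        qed
        have "(\<Oplus>\<^bsub>obj X ?d\<^esub> j \<in> {..<?n} - S. (alt_sign R (int (card {i \<in> S. i < j})) \<otimes> xs ! j) \<odot>\<^bsub>obj X ?d\<^esub>
            tensor_coord R (?KB (?c + 1)) (obj X ?d) (insert j S) (u (?c + 1))) =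
          (\<Oplus>\<^bsub>obj X ?d\<^esub> j \<in> {..<?n} - S. (alt_sign R (int (card {i \<in> S. i < j})) \<otimes> xs ! j) \<odot>\<^bsub>obj X ?d\<^esub>
            ?\<Phi> k u (insert j S))"
          by (rule obj.M.finsum_cong'[OF refl model_terms[OF mod_homD(1)[OF \<Phi>_hom u] S' xsc]])
            (simp_all only: val)
        moreover have "?\<Phi> k u S = tensor_coord R (?KB ?c) (obj X (k - ?c)) S (u ?c)"
          unfolding tensor_to_model_def restrict_apply'[OF S] ..
        ultimately show ?thesis unfolding model_bd[OF S'] by (simp only:)
      qed
      finally show "?\<Phi> (k - 1) (bd ?T k u) S = bd ?C k (?\<Phi> k u) S" .
    qed
  qed
qed

end

section \<open>Length systems of parameters\<close>

lemma (in field) krull_dim_field: "krull_dim R = 0"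
proof -
  have "{ereal (of_nat n) | n. \<exists>P. (\<forall>i\<le>n. primeideal (P i) R) \<and> (\<forall>i<n. P i \<subset> P (Suc i))} = {0}"
  proof (intro equalityI subsetI; clarify)
    fix n P assume P: "\<forall>i\<le>n. primeideal (P i) R" "\<forall>i<n. P i \<subset> P (Suc i)"
    have zero: "P i = {\<zero>}" if "i \<le> n" for i
    proof -
      interpret primeideal "P i" R using P(1) that by simp
      show ?thesis using all_ideals is_ideal I_notcarr by blast
    qed
    have "n = 0"
    proof (rule ccontr)
      assume "n \<noteq> 0"
      then have "P 0 \<subset> P (Suc 0)" "P 0 = {\<zero>}" "P (Suc 0) = {\<zero>}" using P(2) zero by auto
      then show False by simp
    qed
    then show "ereal (real n) = 0" by simp
  next
    show "\<exists>n. 0 = ereal (real n) \<and> (\<exists>P. (\<forall>i\<le>n. primeideal (P i) R) \<and> (\<forall>i<n. P i \<subset> P (Suc i)))"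
      using zeroprimeideal by (intro exI[of _ "0::nat"] conjI exI[of _ "\<lambda>_. {\<zero>}"]) auto
  qed
  then show ?thesis by (simp add: krull_dim_def)
qed

text \<open>A prime \<open>P\<close> in the support contains \<open>n\<close>, since otherwise a
  power of an element of \<open>n\<close> outside \<open>P\<close> would make every class vanish at
  \<open>P\<close>; it lies in \<open>n\<close>, since all other elements are units. At
  \<open>n\<close> the residue ring is a field, of dimension zero, and localizing inverts only
  units, so the supremum has the single term \<open>- cx_inf W\<close>.\<close>

lemma local_cx_dim:
  assumes W: "ring_complex A W" and n: "primeideal n A"
    and units: "\<And>\<alpha>. \<alpha> \<in> carrier A - n \<Longrightarrow> \<alpha> \<in> Units A"
    and power: "\<And>i \<zeta> \<alpha>. \<lbrakk>\<zeta> \<in> cycles W i; \<alpha> \<in> n\<rbrakk> \<Longrightarrow> \<exists>k::nat. (\<alpha> [^]\<^bsub>A\<^esub> k) \<odot>\<^bsub>obj W i\<^esub> \<zeta> \<in> boundaries W i"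
  shows "cx_dim A W = - cx_inf W"
proof -
  interpret W: ring_complex A W by fact
  interpret n: primeideal n A by fact
  interpret nloc: prime_loc_complex A W n by (simp add: prime_loc_complex_def W n)
  have full: "J = carrier A" if "ideal J A" "\<alpha> \<in> J" "\<alpha> \<in> carrier A - n" for J \<alpha>
  proof -
    interpret J: ideal J A by fact
    note u = units[OF that(3)]
    have "inv\<^bsub>A\<^esub> \<alpha> \<otimes>\<^bsub>A\<^esub> \<alpha> \<in> J" by (rule J.I_l_closed[OF that(2) W.Units_inv_closed[OF u]])
    then show ?thesis unfolding W.Units_l_inv[OF u] by (rule J.one_imp_carrier)
  qed
  have "maximalideal n A"
  proof (rule maximalidealI[OF n.is_ideal n.I_notcarr])
    show "J = n \<or> J = carrier A" if "ideal J A" "n \<subseteq> J" "J \<subseteq> carrier A" for J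
      using full[OF that(1)] that(2,3) by blast
  qed
  then have kd: "krull_dim (A Quot n) = 0"
    using maximalideal.quotient_is_field[OF _ W.is_cring] field.krull_dim_field by blast
  have zero_iff: "zero_mod (homology nloc.W i) \<longleftrightarrow> zero_mod (homology W i)" for i
    unfolding nloc.W_zero_homology_iff W.zero_homology_iff
  proof
    assume ann: "\<forall>z\<in>cycles W i. \<exists>u\<in>carrier A - n. u \<odot>\<^bsub>obj W i\<^esub> z \<in> boundaries W i"
    show "cycles W i \<subseteq> boundaries W i"
    proof
      fix z assume z: "z \<in> cycles W i"
      then obtain u where u: "u \<in> carrier A - n" "u \<odot>\<^bsub>obj W i\<^esub> z \<in> boundaries W i" using ann by blast
      have zc: "z \<in> carrier (obj W i)" using z by (simp add: W.cycles_iff)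
      have "inv\<^bsub>A\<^esub> u \<odot>\<^bsub>obj W i\<^esub> (u \<odot>\<^bsub>obj W i\<^esub> z) \<in> boundaries W i"
        using W.obj.submoduleE(4)[OF W.submodule_boundaries _ u(2)] units[OF u(1)] by simp
      then show "z \<in> boundaries W i"
        using units[OF u(1)] u(1) zc by (simp add: W.obj.smult_assoc1[symmetric])
    qed
  next
    assume "cycles W i \<subseteq> boundaries W i"
    then show "\<forall>z\<in>cycles W i. \<exists>u\<in>carrier A - n. u \<odot>\<^bsub>obj W i\<^esub> z \<in> boundaries W i"
      using nloc.S_one by (auto simp: W.cycles_iff intro!: bexI[of _ "\<one>\<^bsub>A\<^esub>"])
  qed
  have inf: "cx_inf nloc.W = cx_inf W" unfolding cx_inf_def zero_iff ..
  have only: "P = n" if P: "P \<in> mod_Supp A (homology W i)" for P i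
  proof -
    have pP: "primeideal P A" using P by (simp add: mod_Supp_def)
    interpret P: primeideal P A by (rule pP)
    interpret Ploc: prime_loc_complex A W P by (simp add: prime_loc_complex_def W pP)
    obtain \<zeta> where \<zeta>: "\<zeta> \<in> cycles W i" "\<And>u. u \<in> carrier A - P \<Longrightarrow> u \<odot>\<^bsub>obj W i\<^esub> \<zeta> \<notin> boundaries W i"
      using P Ploc.mod_Supp_homology_iff[of i] Ploc.W_zero_homology_iff[of i] by blast
    have "n \<subseteq> P"
    proof
      fix \<alpha> assume \<alpha>: "\<alpha> \<in> n"
      then obtain k :: nat where k: "(\<alpha> [^]\<^bsub>A\<^esub> k) \<odot>\<^bsub>obj W i\<^esub> \<zeta> \<in> boundaries W i" using power[OF \<zeta>(1)] by blast
      show "\<alpha> \<in> P"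
        using \<zeta>(2)[OF prime_pow_notin[OF pP, of \<alpha> k]] k n.Icarr[OF \<alpha>] by blast
    qed
    moreover have "P \<subseteq> n"
      using full[OF P.is_ideal] P.I_notcarr P.Icarr by blast
    ultimately show ?thesis by simp
  qed
  have Supp: "cx_Supp A W = (if \<exists>i. \<not> zero_mod (homology W i) then {n} else {})"
  proof (cases "\<exists>i. \<not> zero_mod (homology W i)")
    case True
    then obtain i where "\<not> zero_mod (homology W i)" by blast
    then have "n \<in> mod_Supp A (homology W i)" using nloc.mod_Supp_homology_iff zero_iff by blast
    then have "cx_Supp A W = {n}" unfolding cx_Supp_def using only by blast
    then show ?thesis using True by simp
  next
    case False
    have "P \<notin> mod_Supp A (homology W i)" for P i
    proof
      assume P: "P \<in> mod_Supp A (homology W i)"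
      then have "n \<in> mod_Supp A (homology W i)" using only by blast
      then show False using nloc.mod_Supp_homology_iff zero_iff False by blast
    qed
    then have "cx_Supp A W = {}" unfolding cx_Supp_def by blast
    then show ?thesis using False by simp
  qed
  show ?thesis
  proof (cases "\<exists>i. \<not> zero_mod (homology W i)")
    case True
    then have "{krull_dim (A Quot P) - cx_inf (prime_loc_cx A P W) | P. P \<in> cx_Supp A W} = {- cx_inf W}"
      by (simp add: Supp kd inf minus_ereal_def)
    then show ?thesis unfolding cx_dim_def by simp
  next
    case False
    \<comment> \<open>In the acyclic case both sides are minus infinity, by the conventions for the
      empty supremum and infimum.\<close>
    then have "cx_Supp A W = {}" by (simp add: Supp)
    then have "cx_dim A W = - \<infinity>" by (simp add: cx_dim_def bot_ereal_def)
    moreover have "cx_inf W = \<infinity>" using False by (simp add: cx_inf_def top_ereal_def)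
    ultimately show ?thesis by simp
  qed
qed

lemma (in mult_set) S_pow: "s \<in> S \<Longrightarrow> s [^] (k::nat) \<in> S"
  by (induction k) (simp_all add: S_one S_mult)

lemma (in mult_set) loc_ring_pow:
  assumes "a \<in> carrier R" "s \<in> S"
  shows "self.frac a s [^]\<^bsub>loc_ring R S\<^esub> (k::nat) = self.frac (a [^] k) (s [^] k)"
proof (induction k)
  case 0
  interpret A: cring "loc_ring R S" by (rule loc_ring_cring)
  show ?case by (simp add: loc_ring_simps(5))
next
  case (Suc k)
  interpret A: cring "loc_ring R S" by (rule loc_ring_cring)
  show ?case using assms by (simp add: Suc.IH loc_ring_mult S_pow)
qed

text \<open>Being an anchor prime concerns the localized complex over the localized ring, so the
  power condition has to be moved there. For a cycle \<open>x/s\<close>, some multiple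
  \<open>u x\<close> with \<open>u\<close> outside \<open>P\<close> is a cycle of \<open>X\<close>;
  a power of \<open>a\<close> takes it into the boundaries, and the factor \<open>u\<close> is
  harmless after localization.\<close>

lemma Anc_maximal:
  assumes P: "primeideal P R" and X: "ring_complex R X" and inf: "cx_inf X > -\<infinity>"
    and power: "\<And>i z a. \<lbrakk>z \<in> cycles X i; a \<in> P\<rbrakk> \<Longrightarrow> \<exists>k::nat. (a [^]\<^bsub>R\<^esub> k) \<odot>\<^bsub>obj X i\<^esub> z \<in> boundaries X i"
  shows "P \<in> Anc R X"
proof -
  interpret X: ring_complex R X by fact
  interpret P: primeideal P R by fact
  interpret prime_loc_complex R X P by (simp add: prime_loc_complex_def P X)
  have A: "A = loc_ring R S" by (simp add: prime_loc_ring_def)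
  have "cx_dim A W = - cx_inf W"
  proof (rule local_cx_dim[OF W_complex prime_loc_max[OF P]])
    fix i \<zeta> \<alpha> assume \<zeta>: "\<zeta> \<in> cycles W i" and \<alpha>: "\<alpha> \<in> loc_max R P"
    have "\<zeta> \<in> carrier (obj W i)" using \<zeta> by (simp add: W.cycles_iff)
    then obtain x s where x: "x \<in> carrier (obj X i)" "s \<in> S" "\<zeta> = loc.frac i x s" by (rule W_carrierE)
    then obtain u where u: "u \<in> S" "u \<odot>\<^bsub>obj X i\<^esub> x \<in> cycles X i" using \<zeta> W_cycles_iff by blast
    obtain a t where a: "a \<in> P" "t \<in> S" "\<alpha> = self.frac a t" using \<alpha> unfolding loc_max_def by blast
    have aR: "a \<in> carrier R" using a(1) P.Icarr by simp
    obtain k :: nat where k: "(a [^]\<^bsub>R\<^esub> k) \<odot>\<^bsub>obj X i\<^esub> (u \<odot>\<^bsub>obj X i\<^esub> x) \<in> boundaries X i"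
      using power[OF u(2) a(1)] by blast
    have ux: "u \<odot>\<^bsub>obj X i\<^esub> ((a [^]\<^bsub>R\<^esub> k) \<odot>\<^bsub>obj X i\<^esub> x) \<in> boundaries X i"
      using k u(1) aR x(1) by (simp add: X.obj.smult_assoc1[symmetric] X.m_comm)
    have ts: "t [^]\<^bsub>R\<^esub> k \<in> S" using S_pow[OF a(2)] .
    have "(\<alpha> [^]\<^bsub>A\<^esub> k) \<odot>\<^bsub>obj W i\<^esub> \<zeta> = loc.frac i ((a [^]\<^bsub>R\<^esub> k) \<odot>\<^bsub>obj X i\<^esub> x) (t [^]\<^bsub>R\<^esub> k \<otimes>\<^bsub>R\<^esub> s)"
      unfolding A W_obj a(3) x(3) loc_ring_pow[OF aR a(2)]
      by (rule loc.loc_smult) (use aR ts x in auto)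
    moreover have "(a [^]\<^bsub>R\<^esub> k) \<odot>\<^bsub>obj X i\<^esub> x \<in> carrier (obj X i)" using aR x(1) by simp
    ultimately show "\<exists>k::nat. (\<alpha> [^]\<^bsub>A\<^esub> k) \<odot>\<^bsub>obj W i\<^esub> \<zeta> \<in> boundaries W i"
      using W_boundaries_iff[OF _ S_mult[OF ts x(2)]] ux u(1) by metis
  qed
  then show ?thesis unfolding Anc_def using inf P by simp
qed

section \<open>Length sequences over a local ring\<close>

context noetherian_local_ring
begin

lemma finite_length_homology_power:
  assumes Y: "ring_complex R Y" "finite_length R (homology Y i)" and a: "a \<in> \<mm>"
  shows "\<exists>k::nat. \<forall>z\<in>cycles Y i. (a [^] k) \<odot>\<^bsub>obj Y i\<^esub> z \<in> boundaries Y i"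
proof -
  interpret Y: ring_complex R Y by fact
  have "\<one> \<notin> \<mm>" using one_imp_carrier I_notcarr by auto
  then obtain k :: nat where k: "\<And>h. h \<in> carrier (homology Y i) \<Longrightarrow> (a [^] k) \<odot>\<^bsub>homology Y i\<^esub> h = \<zero>\<^bsub>homology Y i\<^esub>"
    using finite_length_power[OF is_ideal Units_local _ Y.homology_module Y(2) a] by blast
  have "(a [^] k) \<odot>\<^bsub>obj Y i\<^esub> z \<in> boundaries Y i" if z: "z \<in> cycles Y i" for z
    using k[of "Y.hclass i z"] Y.hclass_smult_zero_iff[OF _ z, of "a [^] k"] Y.homology_carrier z Icarr[OF a] by simp
  then show ?thesis by blast
qed

lemma length_seq_complex:
  assumes "ring_complex R X" "length_seq R \<mm> X xs"
  shows "chain_iso R (koszul_model R ((!) xs) (length xs) X) (tensor_cx R (koszul R xs) X)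
    (ring_complex.tensor_to_model R X xs)"
  using ring_complex.tensor_koszul_iso[OF assms(1), of xs] assms(2) a_subset
  by (auto simp: length_seq_def subset_iff)

lemma length_seq_Anc:
  assumes X: "ring_complex R X" "homologically_finite R X" and xs: "length_seq R \<mm> X xs"
  shows "\<mm> \<in> Anc R (tensor_cx R (koszul R xs) X)"
proof -
  interpret X: ring_complex R X by fact
  interpret iso: chain_iso R "koszul_model R ((!) xs) (length xs) X" "tensor_cx R (koszul R xs) X" "X.tensor_to_model xs"
    by (rule length_seq_complex[OF X(1) xs])
  have nth: "xs ! j \<in> carrier R" if "j < length xs" for j
    using xs that nth_mem[OF that] a_subset by (auto simp: length_seq_def subset_iff)
  obtain lo where lo: "\<And>i. i < lo \<Longrightarrow> cycles X i \<subseteq> boundaries X i"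
    using X.homologically_finite_bounded[OF X(2)] by blast
  \<comment> \<open>Homology that vanishes below \<open>lo\<close> for \<open>X\<close> also does
    for the Koszul model and hence for the tensor complex, so the infimum is not minus
    infinity.\<close>
  have "ereal (of_int lo) \<le> cx_inf (tensor_cx R (koszul R xs) X)"
    by (rule iso.T.cx_inf_ge[OF iso.iso_bounded[OF X.model_bounded[OF nth lo]]])
  then have inf: "cx_inf (tensor_cx R (koszul R xs) X) > -\<infinity>" by auto
  show ?thesis
  proof (rule Anc_maximal[OF primeideal_max iso.T_complex inf])
    show "\<exists>k::nat. (a [^] k) \<odot>\<^bsub>obj (tensor_cx R (koszul R xs) X) i\<^esub> z \<in> boundaries (tensor_cx R (koszul R xs) X) i"
      if "z \<in> cycles (tensor_cx R (koszul R xs) X) i" "a \<in> \<mm>" for i z a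
      using finite_length_homology_power[OF iso.T_complex _ that(2), of i] that(1) xs
      by (auto simp: length_seq_def)
  qed
qed

text \<open>If a prime \<open>q\<close> containing \<open>P\<close> and \<open>xs\<close> were not maximal, then the homology of the Koszul
  complex would vanish at \<open>q\<close>, and by Nakayama's lemma so would that of \<open>X\<close>.\<close>

lemma length_seq_krull_dim_le:
  assumes X: "ring_complex R X" "homologically_finite R X" and xs: "length_seq R \<mm> X xs"
    and P: "P \<in> cx_Supp R X"
  shows "krull_dim (R Quot P) \<le> ereal (of_nat (length xs))"
proof -
  interpret X: ring_complex R X by fact
  interpret iso: chain_iso R "koszul_model R ((!) xs) (length xs) X" "tensor_cx R (koszul R xs) X" "X.tensor_to_model xs"
    by (rule length_seq_complex[OF X(1) xs])
  let ?Y = "tensor_cx R (koszul R xs) X"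
  obtain i where i: "P \<in> mod_Supp R (homology X i)" using P unfolding cx_Supp_def by blast
  then have pP: "primeideal P R" by (simp add: mod_Supp_def)
  interpret Ploc: prime_loc_complex R X P by (simp add: prime_loc_complex_def X pP)
  have xm: "set xs \<subseteq> \<mm>" using xs by (simp add: length_seq_def)
  show ?thesis
  proof (rule krull_dim_quot_le[OF pP xm], rule ccontr)
    fix q assume q: "primeideal q R" "P \<subseteq> q" "set xs \<subseteq> q" and ne: "q \<noteq> \<mm>"
    interpret q: primeideal q R by (rule q(1))
    have "q \<subseteq> \<mm>" using prime_le_max[OF q.is_ideal] q.I_notcarr by simp
    then obtain a where a: "a \<in> \<mm>" "a \<notin> q" using ne by blast
    \<comment> \<open>A power of \<open>a\<close> annihilates the homology in degree
      \<open>j\<close>, as that has finite length, and this power lies outside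
      \<open>q\<close>.\<close>
    have "cycles ?Y j \<subseteq> saturation R q (obj ?Y j) (boundaries ?Y j)" for j
    proof
      fix z assume z: "z \<in> cycles ?Y j"
      obtain k :: nat where "(a [^] k) \<odot>\<^bsub>obj ?Y j\<^esub> z \<in> boundaries ?Y j"
        using finite_length_homology_power[OF iso.T_complex _ a(1), of j] xs z by (auto simp: length_seq_def)
      moreover have "a [^] k \<in> carrier R - q" using prime_pow_notin[OF q(1)] a Icarr by simp
      moreover have "z \<in> carrier (obj ?Y j)" using z by (simp add: iso.T.cycles_iff)
      ultimately show "z \<in> saturation R q (obj ?Y j) (boundaries ?Y j)" unfolding saturation_def by blast
    qed
    then have tors: "cycles X i \<subseteq> saturation R q (obj X i) (boundaries X i)"
      using X.model_torsion[OF q(1) _ X.homologically_finite_noeth[OF noetherian_ring_axioms X(2)]] q(3)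
      unfolding iso.iso_torsion_iff by (metis nth_mem subsetD)
    \<comment> \<open>Since \<open>P \<subseteq> q\<close>, a factor outside \<open>q\<close> is
      also outside \<open>P\<close>; the homology of \<open>X\<close> in degree \<open>i\<close>
      would then vanish at \<open>P\<close>, against the choice of \<open>i\<close>.\<close>
    have "\<exists>u\<in>carrier R - P. u \<odot>\<^bsub>obj X i\<^esub> z \<in> boundaries X i" if "z \<in> cycles X i" for z
      using tors that q(2) unfolding saturation_def by blast
    then show False
      using i Ploc.mod_Supp_homology_iff Ploc.W_zero_homology_iff by blast
  qed
qed

end

theorem lemma3p3:
  fixes R :: "('a, 'r) ring_scheme" and \<mm> :: "'a set" and X :: "('a, 'b) cx"
  assumes "noetherian_local_ring R \<mm>"
    and "ring_complex R X"
    and "homologically_finite R X"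
  shows "(\<forall>xs. length_sop R \<mm> X xs \<longrightarrow> \<mm> \<in> Anc R (tensor_cx R (koszul R xs) X)) \<and>
    ldim R \<mm> X \<ge> cx_dim R X"
proof
  interpret noetherian_local_ring R \<mm> by fact
  show "\<forall>xs. length_sop R \<mm> X xs \<longrightarrow> \<mm> \<in> Anc R (tensor_cx R (koszul R xs) X)"
    using length_seq_Anc[OF assms(2,3)] by (simp add: length_sop_def)
  show "cx_dim R X \<le> ldim R \<mm> X"
    unfolding cx_dim_def
  proof (rule Sup_least, clarify)
    fix P assume P: "P \<in> cx_Supp R X"
    then have "primeideal P R" by (auto simp: cx_Supp_def mod_Supp_def)
    then interpret Ploc: prime_loc_complex R X P by (simp add: prime_loc_complex_def assms(2))
    \<comment> \<open>The bound holds for each length sequence separately and so passes to the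
      infimum of their lengths.\<close>
    have "krull_dim (R Quot P) \<le> Inf {ereal (of_nat (length xs)) | xs. length_seq R \<mm> X xs}"
      using length_seq_krull_dim_le[OF assms(2,3) _ P] by (auto intro!: Inf_greatest)
    \<comment> \<open>Localizing can only raise the infimum of a complex, and subtraction of
      extended reals is monotone in this sense for infinite values too.\<close>
    then show "krull_dim (R Quot P) - cx_inf (prime_loc_cx R P X) \<le> ldim R \<mm> X"
      unfolding ldim_def using Ploc.cx_inf_loc_ge by (rule ereal_minus_mono)
  qed
qed

end
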